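(* Let $J \subset \mathbb{R}$ be an open interval and let $\gamma \colon J \to S^{2}$ be a $\mathcal{C}^{3}$-curve such that $\operatorname{span}\{\gamma(\theta),\dot{\gamma}(\theta),\ddot{\gamma}(\theta)\} = \mathbb{R}^{3}$ for all $\theta \in J$. For $\theta \in J$ let $V_{\theta} := \operatorname{span}(\gamma(\theta))^{\perp}$ and let $\pi_{\theta} \colon \mathbb{R}^{3} \to V_{\theta}$ be the orthogonal projection onto the plane $V_{\theta}$. For every $s > 1$ there exists a constant $\sigma(s) > 1$ (depending only on $s$) such that the following holds: if $B \subset \mathbb{R}^{3}$ is an analytic set with $\dim B = s$, then $$\dim \pi_{\theta}(B) \geq \sigma(s) \quad \text{for almost every } \theta \in J.$$
   Context: $\dim$ denotes Hausdorff dimension, $S^{2}$ is the unit sphere of $\mathbb{R}^{3}$, and "almost every" refers to Lebesgue measure on $J$. "Analytic set" means analytic (Suslin) set in the sense of descriptive set theory. *)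

theory Defs
  imports "HOL-Analysis.Analysis"
begin

text \<open>
  Iterated derivatives of a curve. The derivative is two-sided (the filter is \<open>at t\<close>),
  so these are meant to be used at interior points of the parameter domain only.
\<close>

primrec nth_vector_derivative :: "nat \<Rightarrow> (real \<Rightarrow> 'a::real_normed_vector) \<Rightarrow> real \<Rightarrow> 'a" where
  "nth_vector_derivative 0 f = f"
| "nth_vector_derivative (Suc k) f =
     (\<lambda>t. vector_derivative (nth_vector_derivative k f) (at t))"

text \<open>
  \<open>k\<close> times continuously differentiable on an open set \<open>S\<close>. Continuity of the derivatives
  of order less than \<open>k\<close> follows from their differentiability.
\<close>

definition Ck_curve_on :: "nat \<Rightarrow> real set \<Rightarrow> (real \<Rightarrow> 'a::real_normed_vector) \<Rightarrow> bool" where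
  "Ck_curve_on k S f \<longleftrightarrow>
     (\<forall>i<k. \<forall>t\<in>S. nth_vector_derivative i f differentiable (at t)) \<and>
     continuous_on S (nth_vector_derivative k f)"

definition orth_proj :: "'a::euclidean_space set \<Rightarrow> 'a \<Rightarrow> 'a" where
  "orth_proj V x = (THE y. y \<in> V \<and> x - y \<in> V\<^sup>\<bottom>)"

text \<open>
  Analytic (Suslin) sets: the empty set and the continuous images of the Baire space, which is
  the type \<open>nat \<Rightarrow> nat\<close> with the product of the discrete topologies.
\<close>

definition analytic_set :: "'a::topological_space set \<Rightarrow> bool" where
  "analytic_set A \<longleftrightarrow>
     A = {} \<or> (\<exists>f :: (nat \<Rightarrow> nat) \<Rightarrow> 'a. continuous_on UNIV f \<and> range f = A)"

text \<open>
  The gauge \<open>diam(U)^s\<close>, with the conventions \<open>diam({})^s = 0\<close> and \<open>0^0 = 1\<close> for nonempty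
  \<open>U\<close> (whereas \<open>0 powr 0 = 0\<close>), so that the measure of dimension \<open>0\<close> is counting measure.
\<close>

definition diam_powr :: "real \<Rightarrow> 'a::metric_space set \<Rightarrow> ennreal" where
  "diam_powr s U =
     (if U = {} then 0 else if s = 0 then 1 else ennreal (diameter U powr s))"

text \<open>Boundedness is required because \<open>diameter\<close> is unspecified on unbounded sets.\<close>

definition hausdorff_premeasure :: "real \<Rightarrow> real \<Rightarrow> 'a::metric_space set \<Rightarrow> ennreal" where
  "hausdorff_premeasure s \<delta> A =
     Inf {(\<Sum>i. diam_powr s (U i)) | U :: nat \<Rightarrow> 'a set.
            A \<subseteq> (\<Union>i. U i) \<and> (\<forall>i. bounded (U i) \<and> diameter (U i) \<le> \<delta>)}"

definition hausdorff_measure :: "real \<Rightarrow> 'a::metric_space set \<Rightarrow> ennreal" where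
  "hausdorff_measure s A = (SUP \<delta>\<in>{0<..}. hausdorff_premeasure s \<delta> A)"

definition hausdorff_dim :: "'a::metric_space set \<Rightarrow> ennreal" where
  "hausdorff_dim A = Inf {ennreal s | s. 0 \<le> s \<and> hausdorff_measure s A = 0}"

end

theory Submission
  imports Defs
begin

text \<open>
  Everything reduces to pairs of points. Fix \<open>1 < t < s\<close>. By the increasing sets lemma for dyadic
  Hausdorff content, \<open>B\<close> contains a compact set of positive \<open>t\<close>-content, which carries, for every
  scale \<open>(1/2)^n\<close>, a finite system of weights with the Frostman condition of exponent \<open>t\<close> above that
  scale. The angles \<open>\<theta>\<close> with \<open>\<bar>\<pi>\<^sub>\<theta>(x - y)\<bar> \<le> \<delta>\<close> form a set of measure \<open>O(\<delta> / \<bar>x - y\<bar>)\<close>, and there are none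
  unless \<open>x - y\<close> is \<open>\<delta>\<close>-close to the cone over \<open>\<gamma>\<close>. It therefore suffices to show that the pairs
  \<open>\<delta>\<close>-close to the cone have mass \<open>O(\<delta>\<^sup>\<eta>)\<close> for some \<open>\<eta> > 0\<close>. Were this false, there would be many
  \<open>(x, a, b, d)\<close> with \<open>x - a\<close>, \<open>x - b\<close>, \<open>x - d\<close> all close to the cone. The three angles are separated
  for most of them, as a \<open>\<rho>\<close>-tube has mass \<open>O(\<rho>\<^bsup>t-1\<^esup>)\<close> and \<open>t > 1\<close>. For fixed \<open>a, b, d\<close> and
  separated angles, \<open>x\<close> lies on three surfaces with linearly independent normals, so it is
  confined to a few balls of radius almost \<open>\<delta>\<close>, which have mass at most about \<open>\<delta>\<^sup>t\<close>.
\<close>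

section \<open>Dyadic content and analytic sets\<close>

text \<open>At an angle \<open>\<theta>\<close> where the projection of \<open>K\<close> has
  dimension below \<open>\<sigma>\<close>, covers of small total gauge force
  \<open>scale_energy\<close>, a Riesz energy cut off at scale \<open>(1/2)^n\<close>, to be large.
  Its integral over \<open>\<theta>\<close> is a sum over scales \<open>\<delta>\<close> of pair
  masses times angle measures, divided by \<open>\<delta> powr \<sigma>\<close>. Measures of order
  \<open>\<delta>\<close> alone give only dimension 1, and any extra power of
  \<open>\<delta>\<close> raises it. The power obtained is \<open>(t - 1)\<^sup>2 / 240\<close>:
  half goes into \<open>\<sigma>\<close>, the other half makes the series over scales geometric. The
  arc and the set \<open>B\<close> enter only through multiplicative constants, so
  \<open>\<sigma>\<close> depends on \<open>s\<close> alone. Weights on finite sets replace a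
  Frostman measure: pair estimates become finite sums, angles can be chosen without measurability,
  and no weak limit is taken. The price is that the mass bound holds only above the scale of the
  weights; \<open>K\<close> is compact so that covers become finite and have a finest scale.\<close>

text \<open>\<open>(k, cell k x)\<close> encodes the half-open dyadic cube of side \<open>2\<^bsup>-k\<^esup>\<close> that contains \<open>x\<close>.\<close>

definition cell :: "nat \<Rightarrow> real ^ 3 \<Rightarrow> int \<times> int \<times> int" where
  "cell k x = (\<lfloor>2 ^ k * x $ 1\<rfloor>, \<lfloor>2 ^ k * x $ 2\<rfloor>, \<lfloor>2 ^ k * x $ 3\<rfloor>)"

definition covers :: "(nat \<times> int \<times> int \<times> int) set \<Rightarrow> (real ^ 3) set \<Rightarrow> bool" where
  "covers F A \<longleftrightarrow> (\<forall>x\<in>A. \<exists>k. (k, cell k x) \<in> F)"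

text \<open>The sum of side^t over the cells, as a weighted counting measure of the family, so that
  additivity, continuity from below and subadditivity are facts about measures.\<close>

definition cost :: "real \<Rightarrow> (nat \<times> int \<times> int \<times> int) set \<Rightarrow> ennreal" where
  "cost t F = emeasure (density (count_space UNIV) (\<lambda>(k, z). ennreal (2 powr (- t * real k)))) F"

definition dcontent :: "real \<Rightarrow> (real ^ 3) set \<Rightarrow> ennreal" where
  "dcontent t A = (INF F\<in>{F. covers F A}. cost t F)"

text \<open>Maximality under inclusion, phrased through the points of the cell, which avoids a
  parent map on indices.\<close>

definition top_cells :: "(nat \<times> int \<times> int \<times> int) set \<Rightarrow> (nat \<times> int \<times> int \<times> int) set" where
  "top_cells F = {(k, z) \<in> F. \<forall>x. cell k x = z \<longrightarrow> (\<forall>j<k. (j, cell j x) \<notin> F)}"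

section \<open>Nested cells, submodularity and the increasing sets lemma\<close>

lemma floor_pow_mono:
  assumes "j \<le> k" "\<lfloor>2 ^ k * (a::real)\<rfloor> = \<lfloor>2 ^ k * (b::real)\<rfloor>"
  shows "\<lfloor>2 ^ j * a\<rfloor> = \<lfloor>2 ^ j * b\<rfloor>"
proof -
  have e: "\<lfloor>2 ^ j * u\<rfloor> = \<lfloor>2 ^ k * u\<rfloor> div 2 ^ (k - j)" for u :: real
  proof -
    have "2 ^ j * u = (2 ^ k * u) / real_of_int (2 ^ (k - j))"
      using assms(1) by (simp add: field_simps flip: power_add)
    then show ?thesis
      by (simp only: floor_divide_real_eq_div zero_le_power zero_le_numeral)
  qed
  show ?thesis
    using assms(2) by (simp add: e)
qed

lemma cell_mono: "j \<le> k \<Longrightarrow> cell k x = cell k y \<Longrightarrow> cell j x = cell j y"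
  unfolding cell_def using floor_pow_mono by blast

lemma cost_mono: "F \<subseteq> G \<Longrightarrow> cost t F \<le> cost t G"
  unfolding cost_def by (intro emeasure_mono) auto

lemma cost_Un_Int: "cost t (F \<union> G) + cost t (F \<inter> G) = cost t F + cost t G"
proof -
  have "cost t (F \<union> G) = cost t F + cost t (G - F)"
    unfolding cost_def by (subst plus_emeasure) auto
  moreover have "cost t G = cost t (F \<inter> G) + cost t (G - F)"
    unfolding cost_def by (subst plus_emeasure) (auto simp: Int_commute[of F] Int_Diff_Un)
  ultimately show ?thesis
    by (simp add: ac_simps)
qed

lemma cost_Union_incseq:
  assumes "incseq F"
  shows "cost t (\<Union>n. F n) = (SUP n. cost t (F n))"
  unfolding cost_def using assms by (intro SUP_emeasure_incseq[symmetric]) auto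

lemma covers_mono: "covers F A \<Longrightarrow> F \<subseteq> G \<Longrightarrow> B \<subseteq> A \<Longrightarrow> covers G B"
  unfolding covers_def by blast

lemma covers_top_cells:
  assumes "covers F A"
  shows "covers (top_cells F) A"
  unfolding covers_def
proof
  fix x assume "x \<in> A"
  define k where "k = (LEAST k. (k, cell k x) \<in> F)"
  have 1: "(k, cell k x) \<in> F"
    unfolding k_def using assms \<open>x \<in> A\<close> unfolding covers_def
    by (intro LeastI_ex[where P="\<lambda>k. (k, cell k x) \<in> F"]) auto
  have 2: "(j, cell j x) \<notin> F" if "j < k" for j
    using that unfolding k_def by (rule not_less_Least)
  have "(k, cell k x) \<in> top_cells F"
    unfolding top_cells_def
  proof (clarsimp simp: 1)
    fix y j assume y: "cell k y = cell k x" and "j < k" "(j, cell j y) \<in> F"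
    then show False
      using 2[of j] cell_mono[of j k y x] by simp
  qed
  then show "\<exists>k. (k, cell k x) \<in> top_cells F" ..
qed

lemma dcontent_le: "covers F A \<Longrightarrow> dcontent t A \<le> cost t F"
  unfolding dcontent_def by (auto intro: INF_lower)

lemma dcontent_mono: "A \<subseteq> B \<Longrightarrow> dcontent t A \<le> dcontent t B"
  unfolding dcontent_def by (intro INF_superset_mono) (auto simp: covers_def)

text \<open>
  The cells of the two families that are not among the maximal cells of the union still cover
  \<open>A\<close>, since the deeper of two cells through the same point is never maximal.
\<close>

lemma dcontent_submodular:
  assumes "covers U A" "covers G A"
  shows "dcontent t A + cost t (top_cells (U \<union> G)) \<le> cost t (top_cells U) + cost t G"
proof -
  define D where "D = top_cells U"
  define T where "T = top_cells (U \<union> G)"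
  define N where "N = (D - T) \<union> (G - T) \<union> (D \<inter> G)"
  have T: "T \<subseteq> D \<union> G"
    unfolding T_def D_def top_cells_def by auto
  have DU: "D \<subseteq> U" unfolding D_def top_cells_def by auto
  have "covers N A"
    unfolding covers_def
  proof
    fix x assume x: "x \<in> A"
    obtain i where i: "(i, cell i x) \<in> D"
      using covers_top_cells[OF assms(1)] x unfolding D_def covers_def by blast
    obtain j where j: "(j, cell j x) \<in> G"
      using assms(2) x unfolding covers_def by blast
    consider "i = j" | "i < j" | "j < i" by linarith
    then show "\<exists>k. (k, cell k x) \<in> N"
    proof cases
      case 1
      then show ?thesis using i j unfolding N_def by blast
    next
      case 2
      then have "(j, cell j x) \<notin> T"
        using i DU unfolding T_def top_cells_def by auto
      then show ?thesis using j unfolding N_def by blast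
    next
      case 3
      then have "(i, cell i x) \<notin> T"
        using j unfolding T_def top_cells_def by auto
      then show ?thesis using i unfolding N_def by blast
    qed
  qed
  then have "dcontent t A + cost t T \<le> cost t N + cost t T"
    by (intro add_mono dcontent_le) auto
  also have "\<dots> = cost t (N \<union> T) + cost t (N \<inter> T)"
    by (simp add: cost_Un_Int)
  \<comment> \<open>A cell of \<open>N\<close> that also lies in \<open>T\<close> can only come from
    the part \<open>D \<inter> G\<close>. Keeping \<open>cost t T\<close> on both sides avoids
    subtracting infinite costs.\<close>
  also have "\<dots> \<le> cost t (D \<union> G) + cost t (D \<inter> G)"
    using T unfolding N_def by (intro add_mono cost_mono) auto
  also have "\<dots> = cost t D + cost t G"
    by (simp add: cost_Un_Int)
  finally show ?thesis unfolding D_def T_def .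
qed

text \<open>Uniting near-optimal covers of all \<open>A n\<close> would add up their costs. Passing
  to maximal cells prevents this: by submodularity each further cover adds only the increase of the
  content and its own error, and the errors are chosen summable.\<close>

lemma dcontent_incseq:
  assumes A: "incseq A"
  shows "dcontent t (\<Union>n. A n) \<le> (SUP n. dcontent t (A n))"
proof (cases "(SUP n. dcontent t (A n)) = top")
  case False
  define L where "L = (SUP n. dcontent t (A n))"
  have L: "dcontent t (A n) \<le> L" for n
    unfolding L_def by (rule SUP_upper) simp
  have Lt: "L < top"
    using False unfolding L_def by (simp only: top.not_eq_extremum not_False_eq_True)
  have fin: "dcontent t (A n) < top" for n
    using L Lt by (rule le_less_trans)
  show ?thesis
    unfolding L_def[symmetric]
  proof (rule ennreal_le_epsilon)
    fix e :: real assume e: "0 < e"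
    have "\<exists>F. covers F (A n) \<and> cost t F \<le> dcontent t (A n) + ennreal (e * (1/2) ^ Suc n)" for n
    proof -
      have "dcontent t (A n) < dcontent t (A n) + ennreal (e * (1/2) ^ Suc n)"
        using fin[of n] e by (simp add: ennreal_add_left_cancel_less)
      then show ?thesis
        unfolding dcontent_def INF_less_iff by (auto intro: less_imp_le)
    qed
    then obtain F where F: "\<And>n. covers (F n) (A n)"
      and Fc: "\<And>n. cost t (F n) \<le> dcontent t (A n) + ennreal (e * (1/2) ^ Suc n)"
      by metis
    define U where "U n = (\<Union>i\<le>n. F i)" for n
    have Uc: "covers (U n) (A n)" for n
      by (rule covers_mono[OF F[of n]]) (auto simp: U_def)
    have step: "cost t (top_cells (U n)) \<le> dcontent t (A n) + ennreal (e * (1 - (1/2) ^ Suc n))" for n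
    proof (induction n)
      case 0
      have "cost t (top_cells (U 0)) \<le> cost t (F 0)"
        by (intro cost_mono) (auto simp: U_def top_cells_def)
      then show ?case using Fc[of 0] by (simp add: order_trans)
    next
      case (Suc n)
      have "A n \<subseteq> A (Suc n)" using A by (simp add: incseq_Suc_iff)
      then have c: "covers (F (Suc n)) (A n)"
        using covers_mono[OF F[of "Suc n"]] by blast
      have "U (Suc n) = U n \<union> F (Suc n)"
        by (auto simp: U_def atMost_Suc)
      then have "dcontent t (A n) + cost t (top_cells (U (Suc n)))
          \<le> cost t (top_cells (U n)) + cost t (F (Suc n))"
        using dcontent_submodular[OF Uc c] by simp
      also have "\<dots> \<le> (dcontent t (A n) + ennreal (e * (1 - (1/2) ^ Suc n)))
          + (dcontent t (A (Suc n)) + ennreal (e * (1/2) ^ Suc (Suc n)))"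
        by (intro add_mono Suc.IH Fc)
      also have "\<dots> = dcontent t (A n) + (dcontent t (A (Suc n)) +
          (ennreal (e * (1 - (1/2) ^ Suc n)) + ennreal (e * (1/2) ^ Suc (Suc n))))"
        by (simp only: ac_simps)
      also have "ennreal (e * (1 - (1/2) ^ Suc n)) + ennreal (e * (1/2) ^ Suc (Suc n))
          = ennreal (e * (1 - (1/2) ^ Suc (Suc n)))"
        using e power_le_one[of "1/2 :: real" "Suc n"]
        by (subst ennreal_plus[symmetric]) (auto simp: algebra_simps)
      finally show ?case
        using fin[of n] by (simp only: ennreal_add_left_cancel_le) auto
    qed
    define D where "D = top_cells (\<Union>n. U n)"
    have incU: "incseq U"
      unfolding U_def by (intro monoI UN_mono) auto
    have "covers (\<Union>n. U n) (\<Union>n. A n)"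
      using Uc unfolding covers_def by blast
    then have "dcontent t (\<Union>n. A n) \<le> cost t D"
      unfolding D_def by (intro dcontent_le covers_top_cells)
    also have "D = (\<Union>n. D \<inter> U n)"
      unfolding D_def top_cells_def by auto
    also have "cost t (\<Union>n. D \<inter> U n) = (SUP n. cost t (D \<inter> U n))"
      using incU by (intro cost_Union_incseq) (auto simp: mono_def)
    also have "\<dots> \<le> L + ennreal e"
    proof (rule SUP_least)
      fix n
      \<comment> \<open>A cell that is maximal in the whole union is maximal in each
        \<open>U n\<close> containing it, so the bounds for the finite stages pass to the
        limit.\<close>
      have "cost t (D \<inter> U n) \<le> cost t (top_cells (U n))"
        by (intro cost_mono) (auto simp: D_def top_cells_def)
      also note step[of n]
      also have "dcontent t (A n) + ennreal (e * (1 - (1/2) ^ Suc n)) \<le> L + ennreal e"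
        using e by (intro add_mono L ennreal_leI) (simp add: algebra_simps)
      finally show "cost t (D \<inter> U n) \<le> L + ennreal e" .
    qed
    finally show "dcontent t (\<Union>n. A n) \<le> L + ennreal e" .
  qed
qed (simp only: top_greatest)

section \<open>Compact subsets of analytic sets\<close>

lemma cost_neighbours:
  "cost t {(k, z). \<exists>(a, b, c)\<in>{-1..1} \<times> {-1..1} \<times> {-1..1}. (k, z + (a, b, c)) \<in> F} \<le> 27 * cost t F"
proof -
  let ?I = "{-1..1::int} \<times> {-1..1::int} \<times> {-1..1::int}"
  let ?s = "\<lambda>e (k :: nat, z). (k, z - e) :: nat \<times> int \<times> int \<times> int"
  have sh: "cost t (?s e ` F) = cost t F" for e
  proof -
    have inj: "inj_on (?s e) F" by (auto simp: inj_on_def)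
    have c: "cost t G = (\<integral>\<^sup>+ x. (case x of (k, z) \<Rightarrow> ennreal (2 powr (- t * real k))) \<partial>count_space G)" for G
      unfolding cost_def
      by (subst emeasure_density) (auto simp: nn_integral_count_space_indicator)
    have "(\<integral>\<^sup>+ x. (case ?s e x of (k, z) \<Rightarrow> ennreal (2 powr (- t * real k))) \<partial>count_space F)
       = (\<integral>\<^sup>+ x. (case x of (k, z) \<Rightarrow> ennreal (2 powr (- t * real k))) \<partial>count_space (?s e ` F))"
      using inj by (intro nn_integral_bij_count_space) (simp add: bij_betw_def)
    then show ?thesis
      by (simp add: c split_beta')
  qed
  have "{(k, z). \<exists>(a, b, c)\<in>?I. (k, z + (a, b, c)) \<in> F} \<subseteq> (\<Union>e\<in>?I. ?s e ` F)"
    by (force simp: image_iff)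
  then have "cost t {(k, z). \<exists>(a, b, c)\<in>?I. (k, z + (a, b, c)) \<in> F} \<le> cost t (\<Union>e\<in>?I. ?s e ` F)"
    by (rule cost_mono)
  also have "\<dots> \<le> (\<Sum>e\<in>?I. cost t (?s e ` F))"
    unfolding cost_def by (intro emeasure_subadditive_finite) auto
  also have "\<dots> = 27 * cost t F"
    by (simp add: sh card_cartesian_product)
  finally show ?thesis .
qed


lemma cell_neighbourhood:
  assumes "\<And>i. \<bar>2 ^ k * x $ i - 2 ^ k * y $ i\<bar> < 1"
  obtains a b c where "(a, b, c) \<in> {-1..1} \<times> {-1..1} \<times> {-1..1}" "cell k x + (a, b, c) = cell k y"
proof
  have *: "\<lfloor>v\<rfloor> - \<lfloor>u\<rfloor> \<in> {-1..1}" if "\<bar>u - v\<bar> < 1" for u v :: real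
    using that by (auto; linarith)
  show "(\<lfloor>2 ^ k * y $ 1\<rfloor> - \<lfloor>2 ^ k * x $ 1\<rfloor>, \<lfloor>2 ^ k * y $ 2\<rfloor> - \<lfloor>2 ^ k * x $ 2\<rfloor>,
      \<lfloor>2 ^ k * y $ 3\<rfloor> - \<lfloor>2 ^ k * x $ 3\<rfloor>) \<in> {-1..1} \<times> {-1..1} \<times> {-1..1}"
    using *[OF assms[of 1]] *[OF assms[of 2]] *[OF assms[of 3]] by blast
qed (simp add: cell_def)

text \<open>Cells are half-open, while compactness arguments need an open set of comparable content.
  Balls whose radius is the side of a cell, centred in it, stay inside the 27 cells around
  it.\<close>

lemma dcontent_neighbours:
  assumes "covers F K"
  obtains U where "open U" "K \<subseteq> U" "dcontent t U \<le> 27 * cost t F"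
proof
  let ?U = "\<Union>x\<in>K. \<Union>k\<in>{k. (k, cell k x) \<in> F}. ball x (1 / 2 ^ k)"
  show "open ?U" by auto
  show "K \<subseteq> ?U" using assms unfolding covers_def by fastforce
  let ?G = "{(k, z). \<exists>(a, b, c)\<in>{-1..1} \<times> {-1..1} \<times> {-1..1}. (k, z + (a, b, c)) \<in> F}"
  have "covers ?G ?U"
    unfolding covers_def
  proof
    fix y assume "y \<in> ?U"
    then obtain x k where k: "(k, cell k x) \<in> F" "dist x y < 1 / 2 ^ k" by auto
    have "\<bar>2 ^ k * y $ i - 2 ^ k * x $ i\<bar> < 1" for i
    proof -
      have "\<bar>(y - x) $ i\<bar> < 1 / 2 ^ k"
        using k(2) component_le_norm_cart[of "y - x" i] by (simp add: dist_norm norm_minus_commute)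
      then have "2 ^ k * \<bar>(y - x) $ i\<bar> < 1" by (simp add: field_simps)
      then show ?thesis by (simp add: abs_mult right_diff_distrib[symmetric])
    qed
    then obtain a b c where *: "(a, b, c) \<in> {-1..1} \<times> {-1..1} \<times> {-1..1}" "cell k y + (a, b, c) = cell k x"
      by (rule cell_neighbourhood)
    have "(k, cell k y) \<in> ?G"
      using * k(1) by (simp only: mem_Collect_eq case_prod_conv) (rule bexI[of _ "(a, b, c)"], auto)
    then show "\<exists>k. (k, cell k y) \<in> ?G" ..
  qed
  then show "dcontent t ?U \<le> 27 * cost t F"
    by (rule order_trans[OF dcontent_le cost_neighbours])
qed

lemma compact_bounded_sequences: "compact {\<sigma> :: nat \<Rightarrow> nat. \<forall>i. \<sigma> i \<le> a i}"
proof -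
  have "compactin (product_topology (\<lambda>i::nat. euclidean) UNIV) (PiE UNIV (\<lambda>i. {..a i}))"
    unfolding compactin_PiE by (auto simp: compactin_euclidean_iff finite_imp_compact)
  moreover have "PiE UNIV (\<lambda>i. {..a i}) = {\<sigma>. \<forall>i. \<sigma> i \<le> a i}"
    by (auto simp: PiE_def Pi_def)
  ultimately show ?thesis
    by (simp add: euclidean_product_topology compactin_euclidean_iff)
qed

text \<open>Sequences outside \<open>V\<close> that obey the first \<open>j\<close> bounds are
  truncated by 0 to fall into the compact box. A subsequential limit of the truncations is one of
  the original sequences too, since each coordinate is eventually unchanged, and it lies in
  \<open>V\<close>.\<close>

lemma open_bounded_sequences:
  assumes "open V" "{\<sigma> :: nat \<Rightarrow> nat. \<forall>i. \<sigma> i \<le> a i} \<subseteq> V"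
  shows "\<exists>j. {\<sigma>. \<forall>i<j. \<sigma> i \<le> a i} \<subseteq> V"
proof (rule ccontr)
  assume "\<nexists>j. {\<sigma>. \<forall>i<j. \<sigma> i \<le> a i} \<subseteq> V"
  then have "\<forall>j. \<exists>\<sigma>. (\<forall>i<j. \<sigma> i \<le> a i) \<and> \<sigma> \<notin> V"
    by blast
  then obtain \<sigma> where "\<forall>j. (\<forall>i<j. \<sigma> j i \<le> a i) \<and> \<sigma> j \<notin> V"
    by (rule choice[THEN exE])
  then have s: "\<And>j i. i < j \<Longrightarrow> \<sigma> j i \<le> a i" "\<And>j. \<sigma> j \<notin> V"
    by simp_all
  define \<tau> where "\<tau> j i = (if i < j then \<sigma> j i else 0)" for i j
  have "\<tau> j \<in> {\<sigma>. \<forall>i. \<sigma> i \<le> a i}" for j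
    using s by (auto simp: \<tau>_def)
  then have tau: "\<forall>j. \<tau> j \<in> {\<sigma>. \<forall>i. \<sigma> i \<le> a i}" by blast
  have sc: "seq_compact {\<sigma> :: nat \<Rightarrow> nat. \<forall>i. \<sigma> i \<le> a i}"
    by (intro compact_imp_seq_compact compact_bounded_sequences)
  obtain l r where l: "l \<in> {\<sigma>. \<forall>i. \<sigma> i \<le> a i}" "strict_mono r" "(\<tau> \<circ> r) \<longlonglongrightarrow> l"
    by (rule seq_compactE[OF sc tau])
  have cw: "u \<longlonglongrightarrow> l \<longleftrightarrow> (\<forall>i. (\<lambda>n. u n i) \<longlonglongrightarrow> l i)" for u :: "nat \<Rightarrow> nat \<Rightarrow> nat"
    using limitin_componentwise[of "\<lambda>_. euclidean" UNIV u l sequentially]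
    by (simp add: euclidean_product_topology)
  have "(\<lambda>n. \<sigma> (r n) i) \<longlonglongrightarrow> l i" for i
  proof -
    have "(\<lambda>n. \<tau> (r n) i) \<longlonglongrightarrow> l i"
      using l(3) unfolding cw by (simp add: comp_def)
    moreover have "\<forall>\<^sub>F n in sequentially. \<tau> (r n) i = \<sigma> (r n) i"
    proof (rule eventually_sequentiallyI[of "Suc i"])
      fix n assume "Suc i \<le> n"
      then have "i < r n" using seq_suble[OF l(2), of n] by linarith
      then show "\<tau> (r n) i = \<sigma> (r n) i" by (simp add: \<tau>_def)
    qed
    ultimately show ?thesis by (rule Lim_transform_eventually)
  qed
  then have "(\<lambda>n. \<sigma> (r n)) \<longlonglongrightarrow> l"
    unfolding cw by blast
  then have "\<forall>\<^sub>F n in sequentially. \<sigma> (r n) \<in> V"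
    using assms l(1) by (intro topological_tendstoD) auto
  then show False
    using s(2) by (auto dest: eventually_happens)
qed

text \<open>Choquet's capacitability argument. The bounds \<open>a i\<close> are fixed one at a
  time: raising the next bound exhausts the current cylinder, so by \<open>dcontent_incseq\<close>
  some bound keeps the content of the image above \<open>c\<close>. For the passage to the compact
  set \<open>T\<close>, a cover of its image is enlarged to an open set, which contains the image of
  a whole cylinder; the enlargement costs the factor 27.\<close>

lemma analytic_set_compact_subset:
  assumes B: "analytic_set B" and c: "c < dcontent t B"
  obtains K where "compact K" "K \<subseteq> B" "c \<le> 27 * dcontent t K"
proof -
  have "dcontent t {} \<le> cost t {}"
    by (intro dcontent_le) (simp add: covers_def)
  then have "B \<noteq> {}" using c by (auto simp: cost_def)
  then obtain f :: "(nat \<Rightarrow> nat) \<Rightarrow> real ^ 3" where f: "continuous_on UNIV f" "range f = B"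
    using B unfolding analytic_set_def by blast
  define S where "S xs = {\<sigma> :: nat \<Rightarrow> nat. \<forall>i<length xs. \<sigma> i \<le> xs ! i}" for xs
  have ext: "\<exists>m. c < dcontent t (f ` S (xs @ [m]))" if "c < dcontent t (f ` S xs)" for xs
  proof -
    have "S xs = (\<Union>m. S (xs @ [m]))"
      unfolding S_def by (auto simp: nth_append less_Suc_eq)
    then have "f ` S xs = (\<Union>m. f ` S (xs @ [m]))" by (simp add: image_UN)
    moreover have "incseq (\<lambda>m. f ` S (xs @ [m]))"
      unfolding S_def by (auto intro!: monoI image_mono simp: nth_append less_Suc_eq)
    ultimately have "c < (SUP m. dcontent t (f ` S (xs @ [m])))"
      using that dcontent_incseq[of "\<lambda>m. f ` S (xs @ [m])" t] by simp
    then show ?thesis by (simp add: less_SUP_iff)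
  qed
  then obtain g where g: "\<And>xs. c < dcontent t (f ` S xs) \<Longrightarrow> c < dcontent t (f ` S (xs @ [g xs]))"
    by metis
  define L where "L = rec_nat [] (\<lambda>_ xs. xs @ [g xs])"
  have L: "L 0 = []" "L (Suc n) = L n @ [g (L n)]" for n
    by (simp_all add: L_def)
  have len: "length (L n) = n" for n by (induction n) (simp_all add: L)
  define a where "a n = g (L n)" for n
  have La: "i < n \<Longrightarrow> L n ! i = a i" for n i
    by (induction n) (auto simp: L len nth_append a_def less_Suc_eq)
  have big: "c < dcontent t (f ` S (L n))" for n
  proof (induction n)
    case 0
    then show ?case using c f(2) by (simp add: L S_def)
  next
    case (Suc n)
    then show ?case using g by (simp add: L)
  qed
  define T where "T = {\<sigma> :: nat \<Rightarrow> nat. \<forall>i. \<sigma> i \<le> a i}"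
  show thesis
  proof
    show "compact (f ` T)"
      unfolding T_def by (intro compact_continuous_image compact_bounded_sequences continuous_on_subset[OF f(1)]) auto
    show "f ` T \<subseteq> B" using f(2) by blast
    show "c \<le> 27 * dcontent t (f ` T)"
    proof -
      have "c / 27 \<le> dcontent t (f ` T)"
        unfolding dcontent_def
      proof (rule INF_greatest, clarify)
        fix F assume F: "covers F (f ` T)"
        obtain U where U: "open U" "f ` T \<subseteq> U" "dcontent t U \<le> 27 * cost t F"
          using dcontent_neighbours[OF F] by blast
        have "open (f -` U)"
          using f(1) U(1) by (simp add: continuous_on_open_vimage)
        moreover have "T \<subseteq> f -` U" using U(2) by blast
        ultimately obtain j where j: "{\<sigma>. \<forall>i<j. \<sigma> i \<le> a i} \<subseteq> f -` U"
          using open_bounded_sequences[of "f -` U" a] unfolding T_def by blast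
        have "f ` S (L j) \<subseteq> U"
          using j La by (auto simp: S_def len)
        then have "c \<le> dcontent t U"
          using big[of j] dcontent_mono by (meson less_imp_le less_le_trans)
        also note U(3)
        finally have "c / 27 \<le> (27 * cost t F) / 27"
          by (rule divide_right_mono_ennreal)
        then show "c / 27 \<le> cost t F"
          by (simp add: ennreal_mult_divide_eq mult.commute[of 27])
      qed
      then have "27 * (c / 27) \<le> 27 * dcontent t (f ` T)"
        by (rule mult_left_mono) simp
      then show ?thesis
        by (simp add: ennreal_times_divide ennreal_mult_divide_eq mult.commute[of 27])
    qed
  qed
qed


section \<open>Discrete Frostman weights\<close>

text \<open>
  Insert the points one at a time, each with the largest admissible weight: some cell through the
  new point then attains its bound, and it keeps doing so.
\<close>

lemma saturated_weights:
  assumes "finite P"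
  shows "\<exists>w. (\<forall>p. 0 \<le> w p) \<and>
    (\<forall>k\<le>n. \<forall>z. (\<Sum>p\<in>{p\<in>P. cell k p = z}. w p) \<le> 2 powr (- t * real k)) \<and>
    (\<forall>p\<in>P. \<exists>k\<le>n. (\<Sum>q\<in>{q\<in>P. cell k q = cell k p}. w q) = 2 powr (- t * real k))"
  using assms
proof (induction P)
  case empty
  show ?case by (intro exI[of _ "\<lambda>_. 0"]) simp
next
  case (insert p P)
  then obtain w :: "real ^ 3 \<Rightarrow> real" where w0: "\<And>p. 0 \<le> w p"
    and w1: "\<And>k z. k \<le> n \<Longrightarrow> (\<Sum>p\<in>{p\<in>P. cell k p = z}. w p) \<le> 2 powr (- t * real k)"
    and w2: "\<And>p. p \<in> P \<Longrightarrow> \<exists>k\<le>n. (\<Sum>q\<in>{q\<in>P. cell k q = cell k p}. w q) = 2 powr (- t * real k)"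
    by blast
  define slack where "slack k = 2 powr (- t * real k) - (\<Sum>q\<in>{q\<in>P. cell k q = cell k p}. w q)" for k
  define m where "m = Min (slack ` {..n})"
  have m: "m \<in> slack ` {..n}" unfolding m_def by (intro Min_in) auto
  have mle: "m \<le> slack k" if "k \<le> n" for k
    unfolding m_def using that by (intro Min_le) auto
  have "0 \<le> slack k" if "k \<le> n" for k
    using w1[OF that, of "cell k p"] unfolding slack_def by linarith
  then have "0 \<le> m" using m by auto
  define w' where "w' = w(p := m)"
  have sum': "(\<Sum>q\<in>{q\<in>insert p P. cell k q = z}. w' q) =
      (if cell k p = z then m else 0) + (\<Sum>q\<in>{q\<in>P. cell k q = z}. w q)" for k z
  proof -
    have "(\<Sum>q\<in>{q\<in>P. cell k q = z}. w' q) = (\<Sum>q\<in>{q\<in>P. cell k q = z}. w q)"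
      using insert.hyps by (intro sum.cong) (auto simp: w'_def)
    moreover have "{q\<in>insert p P. cell k q = z} =
        (if cell k p = z then insert p {q\<in>P. cell k q = z} else {q\<in>P. cell k q = z})"
      by auto
    ultimately show ?thesis
      using insert.hyps by (simp add: w'_def)
  qed
  have le: "(\<Sum>q\<in>{q\<in>insert p P. cell k q = z}. w' q) \<le> 2 powr (- t * real k)" if "k \<le> n" for k z
    using mle[OF that] w1[OF that, of z] unfolding sum' slack_def by auto
  have "\<exists>k\<le>n. (\<Sum>r\<in>{r\<in>insert p P. cell k r = cell k q}. w' r) = 2 powr (- t * real k)" if q: "q \<in> insert p P" for q
  proof (cases "q = p")
    case True
    obtain k where k: "k \<le> n" "m = slack k" using m by auto
    have "(\<Sum>r\<in>{r\<in>insert p P. cell k r = cell k q}. w' r) = 2 powr (- t * real k)"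
      unfolding sum' True using k(2) by (simp add: slack_def)
    then show ?thesis using k(1) by blast
  next
    case False
    then obtain k where k: "k \<le> n" "(\<Sum>r\<in>{r\<in>P. cell k r = cell k q}. w r) = 2 powr (- t * real k)"
      using w2 q by blast
    have "(\<Sum>r\<in>{r\<in>insert p P. cell k r = cell k q}. w' r) \<ge> 2 powr (- t * real k)"
      unfolding sum' using k \<open>0 \<le> m\<close> by simp
    then show ?thesis
      using le[OF k(1), of "cell k q"] k(1) by (intro exI[of _ k]) linarith
  qed
  moreover have "0 \<le> w' q" for q using w0 \<open>0 \<le> m\<close> by (simp add: w'_def)
  ultimately show ?case using le by (intro exI[of _ w']) blast
qed

text \<open>Every point of \<open>K\<close> shares a saturated cell with some point of
  \<open>P\<close>, and maximal saturated cells are disjoint, so this cover costs exactly the weight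
  inside it.\<close>

lemma dcontent_le_saturated:
  assumes P: "finite P" and K: "\<And>x. x \<in> K \<Longrightarrow> \<exists>p\<in>P. cell n p = cell n x"
    and w0: "\<And>p. 0 \<le> w p"
    and sat: "\<And>p. p \<in> P \<Longrightarrow> \<exists>k\<le>n. (\<Sum>q\<in>{q\<in>P. cell k q = cell k p}. w q) = 2 powr (- t * real k)"
  shows "dcontent t K \<le> ennreal (\<Sum>p\<in>P. w p)"
proof -
  define F where "F = {(k, z). k \<le> n \<and> z \<in> cell k ` P \<and> (\<Sum>q\<in>{q\<in>P. cell k q = z}. w q) = 2 powr (- t * real k)}"
  define T where "T = top_cells F"
  have "finite (SIGMA k:{..n}. cell k ` P)" using P by auto
  then have "finite F" by (rule rev_finite_subset) (auto simp: F_def)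
  moreover have TF: "T \<subseteq> F" by (auto simp: T_def top_cells_def)
  ultimately have finT: "finite T" by (rule rev_finite_subset)
  have "covers F K"
    unfolding covers_def
  proof
    fix x assume "x \<in> K"
    then obtain p where p: "p \<in> P" "cell n p = cell n x" using K by blast
    then obtain k where k: "k \<le> n" "(\<Sum>q\<in>{q\<in>P. cell k q = cell k p}. w q) = 2 powr (- t * real k)"
      using sat by blast
    have "cell k p = cell k x" using cell_mono[OF k(1) p(2)] .
    then have "(k, cell k x) \<in> F"
      using k p(1) by (auto simp: F_def intro: image_eqI[of _ _ p])
    then show "\<exists>k. (k, cell k x) \<in> F" ..
  qed
  then have "dcontent t K \<le> cost t T"
    unfolding T_def by (intro dcontent_le covers_top_cells)
  also have "cost t T = (\<Sum>x\<in>T. case x of (k, z) \<Rightarrow> ennreal (2 powr (- t * real k)))"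
    unfolding cost_def using finT
    by (subst emeasure_density) (auto simp: nn_integral_count_space_indicator[symmetric] nn_integral_count_space_finite)
  also have "\<dots> = (\<Sum>x\<in>T. ennreal (\<Sum>p\<in>P. if cell (fst x) p = snd x then w p else 0))"
  proof (rule sum.cong[OF refl])
    fix x assume "x \<in> T"
    then have "(\<Sum>q\<in>{q\<in>P. cell (fst x) q = snd x}. w q) = 2 powr (- t * real (fst x))"
      using TF by (auto simp: F_def)
    then show "(case x of (k, z) \<Rightarrow> ennreal (2 powr (- t * real k))) =
        ennreal (\<Sum>p\<in>P. if cell (fst x) p = snd x then w p else 0)"
      using P by (simp add: split_beta sum.If_cases Int_def)
  qed
  also have "\<dots> = ennreal (\<Sum>x\<in>T. \<Sum>p\<in>P. if cell (fst x) p = snd x then w p else 0)"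
    by (intro sum_ennreal sum_nonneg) (auto simp: w0)
  also have "\<dots> \<le> ennreal (\<Sum>p\<in>P. w p)"
  proof (rule ennreal_leI)
    have "(\<Sum>x\<in>T. \<Sum>p\<in>P. if cell (fst x) p = snd x then w p else 0)
        = (\<Sum>p\<in>P. \<Sum>x\<in>T. if cell (fst x) p = snd x then w p else 0)"
      by (rule sum.swap)
    also have "\<dots> \<le> (\<Sum>p\<in>P. w p)"
    proof (rule sum_mono)
      fix p
      let ?S = "{x \<in> T. cell (fst x) p = snd x}"
      have "x = y" if "x \<in> ?S" "y \<in> ?S" for x y
      proof -
        define i j where "i = fst x" and "j = fst y"
        have ij: "x = (i, cell i p)" "y = (j, cell j p)"
          using that by (simp_all add: i_def j_def)
        have "\<not> i < j" "\<not> j < i"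
          using that ij unfolding T_def top_cells_def by auto
        then show ?thesis using ij by auto
      qed
      then have "\<forall>x\<in>?S. \<forall>y\<in>?S. x = y" by blast
      moreover have "finite ?S" using finT by simp
      ultimately have "card ?S \<le> 1"
        by (simp only: One_nat_def card_le_Suc0_iff_eq)
      moreover have "(\<Sum>x\<in>T. if cell (fst x) p = snd x then w p else 0) = real (card ?S) * w p"
        using finT by (simp add: sum.If_cases Int_def)
      ultimately show "(\<Sum>x\<in>T. if cell (fst x) p = snd x then w p else 0) \<le> w p"
        using mult_right_mono[of "real (card ?S)" 1 "w p"] w0[of p] by simp
    qed
    finally show "(\<Sum>x\<in>T. \<Sum>p\<in>P. if cell (fst x) p = snd x then w p else 0) \<le> (\<Sum>p\<in>P. w p)" .
  qed
  finally show ?thesis .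
qed

lemma finite_cell_image:
  assumes "bounded K"
  shows "finite (cell k ` K)"
proof -
  obtain R where R: "\<And>x. x \<in> K \<Longrightarrow> norm x \<le> R"
    using assms bounded_iff by blast
  let ?I = "{\<lfloor>- (2 ^ k * R)\<rfloor>..\<lfloor>2 ^ k * R\<rfloor>}"
  have "\<lfloor>2 ^ k * x $ i\<rfloor> \<in> ?I" if "x \<in> K" for x i
  proof -
    have "\<bar>x $ i\<bar> \<le> R" using component_le_norm_cart R[OF that] order_trans by blast
    then have "\<bar>2 ^ k * x $ i\<bar> \<le> 2 ^ k * R" by (simp add: abs_mult)
    then show ?thesis by (auto intro!: floor_mono simp: abs_le_iff)
  qed
  then have "cell k ` K \<subseteq> ?I \<times> ?I \<times> ?I"
    by (auto simp: cell_def)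
  then show ?thesis by (rule finite_subset) simp
qed

lemma dyadic_scale:
  assumes "(1/2) ^ n \<le> r" "r < (1::real)"
  shows "\<exists>k\<le>n. r < (1/2) ^ k \<and> (1/2) ^ k \<le> 2 * r"
  using assms
proof (induction n)
  case (Suc n)
  show ?case
  proof (cases "(1/2) ^ n \<le> r")
    case True
    then show ?thesis using Suc by (meson le_SucI)
  next
    case False
    then show ?thesis using Suc.prems by (intro exI[of _ n]) auto
  qed
qed simp

text \<open>The constant \<open>A\<close> is the same for all scales \<open>n\<close>; only radii
  from \<open>(1/2)^n\<close> on are controlled. A ball of radius \<open>r < 1\<close> meets at most
  27 cells of a level with side comparable to \<open>r\<close>.\<close>

lemma discrete_frostman:
  assumes "bounded K" "0 \<le> t"
  obtains A where "1 \<le> A" "\<And>n. \<exists>P w. finite P \<and> P \<subseteq> K \<and> (\<forall>p. 0 \<le> w p) \<and>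
    dcontent t K \<le> ennreal (\<Sum>p\<in>P. w p) \<and>
    (\<forall>x r. (1/2) ^ n \<le> r \<longrightarrow> (\<Sum>p\<in>{p\<in>P. dist x p \<le> r}. w p) \<le> A * r powr t)"
proof
  \<comment> \<open>The first entry serves \<open>r < 1\<close>: 27 cells of side at most
    \<open>2 * r\<close>. The second serves \<open>r \<ge> 1\<close>: the total mass is at most one
    unit for each level-0 cell that meets \<open>K\<close>.\<close>
  define A where "A = max (27 * 2 powr t) (real (card (cell 0 ` K)))"
  have "1 \<le> (2::real) powr t" using assms(2) by (simp add: ge_one_powr_ge_zero)
  then show "1 \<le> A" by (simp add: A_def)
  fix n
  define P where "P = inv_into K (cell n) ` (cell n ` K)"
  have finP: "finite P" unfolding P_def using finite_cell_image[OF assms(1)] by blast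
  have PK: "P \<subseteq> K" unfolding P_def by (auto intro: inv_into_into)
  have Pc: "\<exists>p\<in>P. cell n p = cell n x" if "x \<in> K" for x
    unfolding P_def using that by (intro bexI[of _ "inv_into K (cell n) (cell n x)"]) (auto simp: f_inv_into_f)
  obtain w where w0: "\<And>p. 0 \<le> w p"
    and w1: "\<And>k z. k \<le> n \<Longrightarrow> (\<Sum>p\<in>{p\<in>P. cell k p = z}. w p) \<le> 2 powr (- t * real k)"
    and w2: "\<And>p. p \<in> P \<Longrightarrow> \<exists>k\<le>n. (\<Sum>q\<in>{q\<in>P. cell k q = cell k p}. w q) = 2 powr (- t * real k)"
    using saturated_weights[OF finP, of n t] by blast
  have "(\<Sum>p\<in>{p\<in>P. dist x p \<le> r}. w p) \<le> A * r powr t" if r: "(1/2) ^ n \<le> r" for x r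
  proof (cases "r < 1")
    case False
    have "(\<Sum>p\<in>{p\<in>P. dist x p \<le> r}. w p) \<le> (\<Sum>p\<in>P. w p)"
      using finP w0 by (intro sum_mono2) auto
    also have "\<dots> = (\<Sum>z\<in>cell 0 ` P. \<Sum>p\<in>{p\<in>P. cell 0 p = z}. w p)"
      using finP by (intro sum.image_gen)
    also have "\<dots> \<le> (\<Sum>z\<in>cell 0 ` P. 1)"
      using w1[of 0] by (intro sum_mono) simp
    also have "\<dots> \<le> real (card (cell 0 ` K))"
      using PK finite_cell_image[OF assms(1)] by (simp add: card_mono image_mono)
    also have "\<dots> \<le> A * 1" by (simp add: A_def)
    also have "\<dots> \<le> A * r powr t"
      using False assms(2) \<open>1 \<le> A\<close> by (intro mult_left_mono) (auto simp: ge_one_powr_ge_zero)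
    finally show ?thesis .
  next
    case True
    then obtain k where k: "k \<le> n" "r < (1/2) ^ k" "(1/2) ^ k \<le> 2 * r"
      using dyadic_scale r by blast
    have "0 < r" using r by (meson less_le_trans zero_less_power zero_less_divide_1_iff zero_less_numeral)
    let ?I = "{-1..1::int} \<times> {-1..1::int} \<times> {-1..1::int}"
    have "{p\<in>P. dist x p \<le> r} \<subseteq> (\<Union>e\<in>?I. {p\<in>P. cell k p = cell k x + e})"
    proof
      fix p assume p: "p \<in> {p\<in>P. dist x p \<le> r}"
      have "\<bar>2 ^ k * x $ i - 2 ^ k * p $ i\<bar> < 1" for i
      proof -
        have "\<bar>(x - p) $ i\<bar> < (1/2) ^ k"
          using p k(2) component_le_norm_cart[of "x - p" i] by (simp add: dist_norm)
        then have "2 ^ k * \<bar>(x - p) $ i\<bar> < 1" by (simp add: field_simps power_divide)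
        then show ?thesis by (simp add: abs_mult right_diff_distrib[symmetric])
      qed
      then obtain a b c where "(a, b, c) \<in> ?I" "cell k x + (a, b, c) = cell k p"
        by (rule cell_neighbourhood)
      then show "p \<in> (\<Union>e\<in>?I. {p\<in>P. cell k p = cell k x + e})"
        using p by (intro UN_I[of "(a, b, c)"]) auto
    qed
    then have "(\<Sum>p\<in>{p\<in>P. dist x p \<le> r}. w p) \<le> (\<Sum>p\<in>(\<Union>e\<in>?I. {p\<in>P. cell k p = cell k x + e}). w p)"
      using finP w0 by (intro sum_mono2) auto
    also have "\<dots> = (\<Sum>e\<in>?I. \<Sum>p\<in>{p\<in>P. cell k p = cell k x + e}. w p)"
      using finP by (intro sum.UNION_disjoint) auto
    also have "\<dots> \<le> (\<Sum>e\<in>?I. 2 powr (- t * real k))"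
      by (intro sum_mono w1 k)
    also have "\<dots> = 27 * ((1/2) ^ k) powr t"
    proof -
      have "((1/2) ^ k :: real) = 2 powr (- real k)"
        by (simp add: powr_minus powr_realpow power_one_over inverse_eq_divide)
      then have "((1/2) ^ k :: real) powr t = 2 powr (- t * real k)"
        by (simp add: powr_powr mult.commute)
      then show ?thesis by (simp add: card_cartesian_product)
    qed
    also have "\<dots> \<le> 27 * (2 * r) powr t"
      using k(3) assms(2) by (intro mult_left_mono powr_mono2) auto
    also have "\<dots> = 27 * 2 powr t * r powr t"
      using \<open>0 < r\<close> by (simp add: powr_mult)
    also have "\<dots> \<le> A * r powr t"
      by (intro mult_right_mono) (auto simp: A_def)
    finally show ?thesis .
  qed
  moreover have "dcontent t K \<le> ennreal (\<Sum>p\<in>P. w p)"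
    using finP Pc w0 w2 by (rule dcontent_le_saturated)
  ultimately show "\<exists>P w. finite P \<and> P \<subseteq> K \<and> (\<forall>p. 0 \<le> w p) \<and>
    dcontent t K \<le> ennreal (\<Sum>p\<in>P. w p) \<and>
    (\<forall>x r. (1/2) ^ n \<le> r \<longrightarrow> (\<Sum>p\<in>{p\<in>P. dist x p \<le> r}. w p) \<le> A * r powr t)"
    using finP PK w0 by blast
qed

section \<open>Comparison of dyadic content with Hausdorff measure\<close>

lemma diameter_cell:
  "bounded {x. cell k x = z}" "diameter {x. cell k x = z} \<le> 3 * 2 powr (- real k)"
proof -
  have d: "dist x y \<le> 3 * 2 powr (- real k)" if "cell k x = z" "cell k y = z" for x y
  proof -
    have c: "\<bar>(x - y) $ i\<bar> \<le> 2 powr (- real k)" for i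
    proof -
      have "\<lfloor>2 ^ k * x $ i\<rfloor> = \<lfloor>2 ^ k * y $ i\<rfloor>"
        using that unfolding cell_def using exhaust_3[of i] by auto
      then have "\<bar>2 ^ k * x $ i - 2 ^ k * y $ i\<bar> \<le> 1" by linarith
      then have "2 ^ k * \<bar>(x - y) $ i\<bar> \<le> 1"
        by (simp add: abs_mult right_diff_distrib[symmetric])
      then show ?thesis
        by (simp add: powr_minus powr_realpow field_simps)
    qed
    have "dist x y \<le> (\<Sum>i\<in>UNIV. \<bar>(x - y) $ i\<bar>)"
      unfolding dist_norm by (rule norm_le_l1_cart)
    also have "\<dots> \<le> (\<Sum>i\<in>(UNIV::3 set). 2 powr (- real k))"
      by (intro sum_mono c)
    finally show ?thesis by simp
  qed
  show b: "bounded {x. cell k x = z}"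
    unfolding bounded_two_points using d by blast
  show "diameter {x. cell k x = z} \<le> 3 * 2 powr (- real k)"
  proof (rule diameter_le)
    show "norm (x - y) \<le> 3 * 2 powr (- real k)" if "x \<in> {x. cell k x = z}" "y \<in> {x. cell k x = z}" for x y
      using d[of x y] that by (simp add: dist_norm)
  qed simp
qed

lemma hausdorff_premeasure_le_cost:
  assumes t: "0 < t" and F: "covers F B"
    and small: "\<And>k z. (k, z) \<in> F \<Longrightarrow> 3 * 2 powr (- real k) \<le> \<delta>" and "0 \<le> \<delta>"
  shows "hausdorff_premeasure t \<delta> B \<le> ennreal (3 powr t) * cost t F"
proof -
  define U where "U i = (if i \<in> to_nat ` F then case from_nat i of (k, z) \<Rightarrow> {x. cell k x = z} else {})" for i :: nat
  have "hausdorff_premeasure t \<delta> B \<le> (\<Sum>i. diam_powr t (U i))"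
    unfolding hausdorff_premeasure_def
  proof (rule Inf_lower, clarify, intro exI conjI)
    show "B \<subseteq> (\<Union>i. U i)"
    proof
      fix x assume "x \<in> B"
      then obtain k where "(k, cell k x) \<in> F" using F unfolding covers_def by blast
      then have "x \<in> U (to_nat (k, cell k x))" by (simp add: U_def)
      then show "x \<in> (\<Union>i. U i)" by blast
    qed
    show "\<forall>i. bounded (U i) \<and> diameter (U i) \<le> \<delta>"
    proof
      fix i
      show "bounded (U i) \<and> diameter (U i) \<le> \<delta>"
      proof (cases "i \<in> to_nat ` F")
        case True
        then obtain k z where kz: "(k, z) \<in> F" "i = to_nat (k, z)" by auto
        then have "U i = {x. cell k x = z}" by (simp add: U_def)
        then show ?thesis
          using diameter_cell[of k z] small[OF kz(1)] by simp
      next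
        case False
        then show ?thesis using \<open>0 \<le> \<delta>\<close> by (simp add: U_def)
      qed
    qed
  qed simp
  also have "\<dots> = (\<integral>\<^sup>+ i. diam_powr t (U i) \<partial>count_space UNIV)"
    by (simp add: nn_integral_count_space_nat)
  also have "\<dots> = (\<integral>\<^sup>+ i. diam_powr t (U i) \<partial>count_space (to_nat ` F))"
    by (intro nn_integral_count_space_eq) (auto simp: U_def diam_powr_def)
  also have "\<dots> = (\<integral>\<^sup>+ c. diam_powr t (U (to_nat c)) \<partial>count_space F)"
    by (intro nn_integral_bij_count_space[symmetric]) (auto simp: bij_betw_def intro: inj_on_subset[OF inj_to_nat])
  also have "\<dots> \<le> (\<integral>\<^sup>+ c. ennreal (3 powr t) * (case c of (k, z) \<Rightarrow> ennreal (2 powr (- t * real k))) \<partial>count_space F)"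
  proof (rule nn_integral_mono)
    fix c assume "c \<in> space (count_space F)"
    then have c: "c \<in> F" by simp
    obtain k z where kz: "c = (k, z)" by (cases c)
    have U: "U (to_nat c) = {x. cell k x = z}"
      using c by (simp add: U_def kz)
    have "diam_powr t (U (to_nat c)) \<le> ennreal (diameter (U (to_nat c)) powr t)"
      using t by (auto simp: diam_powr_def)
    also have "\<dots> \<le> ennreal ((3 * 2 powr (- real k)) powr t)"
      using diameter_cell[of k z] t unfolding U
      by (intro ennreal_leI powr_mono2) (auto intro: diameter_ge_0)
    also have "\<dots> = ennreal (3 powr t) * ennreal (2 powr (- t * real k))"
      by (simp add: powr_mult powr_powr ennreal_mult mult.commute)
    finally show "diam_powr t (U (to_nat c)) \<le>
        ennreal (3 powr t) * (case c of (k, z) \<Rightarrow> ennreal (2 powr (- t * real k)))"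
      by (simp add: kz)
  qed
  also have "\<dots> = ennreal (3 powr t) * cost t F"
    unfolding cost_def
    by (subst emeasure_density) (auto simp: nn_integral_count_space_indicator nn_integral_cmult)
  finally show ?thesis .
qed

text \<open>Content puts no bound on the size of the cells, but a cover of small cost contains only
  small cells, because each cell alone already costs side^t. So zero content forces the measure
  itself to vanish.\<close>

lemma hausdorff_dim_le_of_dcontent_eq_0:
  assumes t: "0 < t" and B: "dcontent t B = 0"
  shows "hausdorff_dim B \<le> ennreal t"
proof -
  have "hausdorff_premeasure t \<delta> B = 0" if d: "0 < \<delta>" for \<delta>
  proof -
    have *: "hausdorff_premeasure t \<delta> B \<le> 0 + ennreal e" if e: "0 < e" for e
    proof -
      \<comment> \<open>The first entry absorbs the factor \<open>3 powr t\<close> between diameters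
        and sides; the second forces every side below \<open>\<delta> / 3\<close>.\<close>
      define e' where "e' = min (e / 3 powr t) ((\<delta> / 3) powr t)"
      have e': "0 < e'" using e d by (simp add: e'_def)
      have "dcontent t B < ennreal e'" using B e' by simp
      then obtain F where F: "covers F B" "cost t F < ennreal e'"
        unfolding dcontent_def INF_less_iff by blast
      have "3 * 2 powr (- real k) \<le> \<delta>" if "(k, z) \<in> F" for k z
      proof -
        have "ennreal (2 powr (- t * real k)) = cost t {(k, z)}"
          unfolding cost_def
          by (subst emeasure_density) (auto simp: nn_integral_count_space_indicator[symmetric] nn_integral_count_space_finite)
        also have "\<dots> \<le> cost t F"
          using that by (intro cost_mono) auto
        also note F(2)
        finally have "2 powr (- t * real k) < e'"
          by (simp add: ennreal_less_iff)
        also have "e' \<le> (\<delta> / 3) powr t" by (simp add: e'_def)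
        also have "2 powr (- t * real k) = (2 powr (- real k)) powr t"
          by (simp add: powr_powr mult.commute)
        finally have "2 powr (- real k) < \<delta> / 3"
          using powr_mono2[of t "\<delta> / 3" "2 powr (- real k)"] t d by linarith
        then show ?thesis by simp
      qed
      then have "hausdorff_premeasure t \<delta> B \<le> ennreal (3 powr t) * cost t F"
        using t d F(1) by (intro hausdorff_premeasure_le_cost) auto
      also have "\<dots> \<le> ennreal (3 powr t) * ennreal e'"
        using F(2) by (intro mult_left_mono) auto
      also have "\<dots> = ennreal (3 powr t * e')"
        using e' by (simp add: ennreal_mult)
      also have "\<dots> \<le> ennreal e"
        using mult_left_mono[of e' "e / 3 powr t" "3 powr t"] by (intro ennreal_leI) (simp add: e'_def)
      finally show ?thesis by simp
    qed
    have "hausdorff_premeasure t \<delta> B \<le> 0"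
      by (rule ennreal_le_epsilon) (rule *)
    then show ?thesis by simp
  qed
  then have "hausdorff_measure t B = 0"
    unfolding hausdorff_measure_def by (intro antisym SUP_least) auto
  then show ?thesis
    unfolding hausdorff_dim_def using t by (intro Inf_lower) auto
qed

lemma analytic_frostman:
  fixes B :: "(real ^ 3) set"
  assumes "analytic_set B" "0 < t" "ennreal t < hausdorff_dim B"
  obtains K A where "compact K" "K \<subseteq> B" "1 \<le> A"
    "\<And>n. \<exists>P w. finite P \<and> P \<subseteq> K \<and> (\<forall>p. 0 \<le> w p) \<and> 1 \<le> (\<Sum>p\<in>P. w p) \<and>
      (\<forall>x r. (1/2) ^ n \<le> r \<longrightarrow> (\<Sum>p\<in>{p\<in>P. dist x p \<le> r}. w p) \<le> A * r powr t)"
proof -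
  have "0 < dcontent t B"
    using hausdorff_dim_le_of_dcontent_eq_0[of t B] assms(2,3) by (metis leD not_gr_zero)
  then obtain c where c: "0 < c" "c < dcontent t B" using dense by blast
  obtain K where K: "compact K" "K \<subseteq> B" "c \<le> 27 * dcontent t K"
    using analytic_set_compact_subset[OF assms(1) c(2)] .
  have "dcontent t K \<noteq> 0" using K(3) c(1) by auto
  then obtain b where b: "0 < b" "b \<le> 1" "ennreal b \<le> dcontent t K"
  proof -
    \<comment> \<open>The minimum with 1 yields a real number without a proof that the content is
      finite, and \<open>b \<le> 1\<close> keeps \<open>A / b\<close> at least 1.\<close>
    have "0 < min 1 (dcontent t K)" "min 1 (dcontent t K) \<noteq> top" using \<open>dcontent t K \<noteq> 0\<close>
      by (auto simp: min_def zero_less_iff_neq_zero)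
    then obtain b where "min 1 (dcontent t K) = ennreal b" "0 < b"
      by (cases "min 1 (dcontent t K)") auto
    then show ?thesis
      using that[of b] by (metis ennreal_le_1 min.cobounded1 min.cobounded2)
  qed
  obtain A where A: "1 \<le> A" "\<And>n. \<exists>P w. finite P \<and> P \<subseteq> K \<and> (\<forall>p. 0 \<le> w p) \<and>
    dcontent t K \<le> ennreal (\<Sum>p\<in>P. w p) \<and>
    (\<forall>x r. (1/2) ^ n \<le> r \<longrightarrow> (\<Sum>p\<in>{p\<in>P. dist x p \<le> r}. w p) \<le> A * r powr t)"
    using discrete_frostman[OF compact_imp_bounded[OF K(1)] less_imp_le[OF assms(2)]] by blast
  show thesis
  proof (rule that[OF K(1,2)])
    show "1 \<le> A / b" using A(1) b by (simp add: field_simps)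
    fix n
    obtain P w where P: "finite P" "P \<subseteq> K" and w: "\<forall>p. 0 \<le> w p" "dcontent t K \<le> ennreal (\<Sum>p\<in>P. w p)"
      "\<And>x r. (1/2) ^ n \<le> r \<Longrightarrow> (\<Sum>p\<in>{p\<in>P. dist x p \<le> r}. w p) \<le> A * r powr t"
      using A(2)[of n] by blast
    have "ennreal b \<le> ennreal (\<Sum>p\<in>P. w p)" using b(3) w(2) by (rule order_trans)
    then have "b \<le> (\<Sum>p\<in>P. w p)"
      using w(1) by (simp add: ennreal_le_iff sum_nonneg)
    then have "1 \<le> (\<Sum>p\<in>P. w p / b)"
      using b(1) by (simp add: sum_divide_distrib[symmetric])
    moreover have "(\<Sum>p\<in>{p\<in>P. dist x p \<le> r}. w p / b) \<le> A / b * r powr t" if "(1/2) ^ n \<le> r" for x r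
      using divide_right_mono[OF w(3)[OF that, of x], of b] b(1) by (simp add: sum_divide_distrib[symmetric])
    ultimately show "\<exists>P w. finite P \<and> P \<subseteq> K \<and> (\<forall>p. 0 \<le> w p) \<and> 1 \<le> (\<Sum>p\<in>P. w p) \<and>
      (\<forall>x r. (1/2) ^ n \<le> r \<longrightarrow> (\<Sum>p\<in>{p\<in>P. dist x p \<le> r}. w p) \<le> A / b * r powr t)"
      using P w(1) b(1) by (intro exI[of _ P] exI[of _ "\<lambda>p. w p / b"]) auto
  qed
qed

section \<open>Geometry of nondegenerate arcs\<close>

text \<open>The Lagrange remainder has no vector-valued form, hence the pairing with a fixed
  \<open>v\<close>, on which \<open>\<xi>\<close> depends.\<close>

lemma inner_taylor:
  fixes f f1 f2 :: "real \<Rightarrow> 'a::real_inner"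
  assumes "\<And>x. x \<in> {l..u} \<Longrightarrow> (f has_vector_derivative f1 x) (at x)"
    and "\<And>x. x \<in> {l..u} \<Longrightarrow> (f1 has_vector_derivative f2 x) (at x)"
    and "a \<in> {l..u}" "b \<in> {l..u}"
  shows "\<exists>\<xi>\<in>{l..u}. v \<bullet> f b = v \<bullet> f a + v \<bullet> f1 a * (b - a) + v \<bullet> f2 \<xi> / 2 * (b - a)\<^sup>2"
proof (cases "a = b")
  case False
  define D where "D n = (if n = 0 then (\<lambda>x. v \<bullet> f x) else if n = 1 then (\<lambda>x. v \<bullet> f1 x) else (\<lambda>x. v \<bullet> f2 x))" for n :: nat
  have d: "DERIV (\<lambda>x. v \<bullet> g x) x :> v \<bullet> g' x" if "(g has_vector_derivative g' x) (at x)" for g g' x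
    using bounded_linear.has_vector_derivative[OF bounded_linear_inner_right that]
    by (simp add: has_real_derivative_iff_has_vector_derivative)
  have "\<exists>t. (if b < a then b < t \<and> t < a else a < t \<and> t < b) \<and>
    v \<bullet> f b = (\<Sum>m<2. (D m a / fact m) * (b - a)^m) + (D 2 t / fact 2) * (b - a)^2"
    using assms False d
    by (intro Taylor[where a=l and b=u]) (auto simp: D_def less_2_cases_iff)
  then obtain t where t: "(if b < a then b < t \<and> t < a else a < t \<and> t < b)"
    "v \<bullet> f b = (\<Sum>m<2. (D m a / fact m) * (b - a)^m) + (D 2 t / fact 2) * (b - a)^2"
    by blast
  have "v \<bullet> f b = v \<bullet> f a + v \<bullet> f1 a * (b - a) + v \<bullet> f2 t / 2 * (b - a)\<^sup>2"
    using t(2) by (simp add: D_def numeral_2_eq_2)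
  moreover have "t \<in> {l..u}" using t(1) assms(3,4) by (auto split: if_splits)
  ultimately show ?thesis by blast
qed (use assms in auto)

lemma inner_mvt:
  fixes f f1 :: "real \<Rightarrow> 'a::real_inner"
  assumes "\<And>x. x \<in> {l..u} \<Longrightarrow> (f has_vector_derivative f1 x) (at x)"
    and "a \<in> {l..u}" "b \<in> {l..u}"
  shows "\<exists>\<xi>\<in>{l..u}. v \<bullet> (f b - f a) = v \<bullet> f1 \<xi> * (b - a)"
proof -
  have d: "DERIV (\<lambda>x. v \<bullet> f x) x :> v \<bullet> f1 x" if "x \<in> {l..u}" for x
    using bounded_linear.has_vector_derivative[OF bounded_linear_inner_right assms(1)[OF that]]
    by (simp add: has_real_derivative_iff_has_vector_derivative)
  consider "a = b" | "a < b" | "b < a" by linarith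
  then show ?thesis
  proof cases
    case 2
    have "\<exists>z>a. z < b \<and> v \<bullet> f b - v \<bullet> f a = (b - a) * (v \<bullet> f1 z)"
      using 2 assms(2,3) by (intro MVT2 d) auto
    then obtain z where "a < z" "z < b" "v \<bullet> f b - v \<bullet> f a = (b - a) * (v \<bullet> f1 z)" by blast
    then show ?thesis
      using assms(2,3) by (intro bexI[of _ z]) (auto simp: inner_diff_right mult.commute)
  next
    case 3
    have "\<exists>z>b. z < a \<and> v \<bullet> f a - v \<bullet> f b = (a - b) * (v \<bullet> f1 z)"
      using 3 assms(2,3) by (intro MVT2 d) auto
    then obtain z where "b < z" "z < a" "v \<bullet> f a - v \<bullet> f b = (a - b) * (v \<bullet> f1 z)" by blast
    then show ?thesis
      using assms(2,3) by (intro bexI[of _ z]) (auto simp: inner_diff_right algebra_simps)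
  qed (use assms in auto)
qed

text \<open>By pigeonhole one of the three products at \<open>z\<close> is at least
  \<open>4 * (c * norm v)\<close>, and it stays above \<open>c * norm v\<close> on the arc. A large
  value is seen at \<open>a\<close> directly; a large first derivative separates the values at
  \<open>a\<close> and \<open>b\<close>; a large second derivative makes the function convex or
  concave, which three separated points detect.\<close>

lemma three_values_lower_bound:
  fixes N0 N1 N2 :: "real \<Rightarrow> 'a::real_inner"
  assumes d0: "\<And>x. x \<in> {l..u} \<Longrightarrow> (N0 has_vector_derivative N1 x) (at x)"
    and d1: "\<And>x. x \<in> {l..u} \<Longrightarrow> (N1 has_vector_derivative N2 x) (at x)"
    and z: "z \<in> {l..u}" and lu: "u - l \<le> 1" and c: "0 \<le> c"
    and low: "\<And>v. 12 * c * norm v \<le> \<bar>v \<bullet> N0 z\<bar> + \<bar>v \<bullet> N1 z\<bar> + \<bar>v \<bullet> N2 z\<bar>"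
    and close: "\<And>x. x \<in> {l..u} \<Longrightarrow> norm (N0 x - N0 z) \<le> c" "\<And>x. x \<in> {l..u} \<Longrightarrow> norm (N1 x - N1 z) \<le> c"
      "\<And>x. x \<in> {l..u} \<Longrightarrow> norm (N2 x - N2 z) \<le> c"
    and a: "a \<in> {l..u}" and b: "b \<in> {l..u}" and d: "d \<in> {l..u}"
    and sep: "a + \<rho> \<le> b" "b + \<rho> \<le> d" and r: "0 < \<rho>"
    and m: "\<bar>v \<bullet> N0 a\<bar> \<le> m" "\<bar>v \<bullet> N0 b\<bar> \<le> m" "\<bar>v \<bullet> N0 d\<bar> \<le> m"
  shows "c / 4 * \<rho>\<^sup>2 * norm v \<le> m"
proof -
  have near: "\<bar>v \<bullet> f x - v \<bullet> f z\<bar> \<le> c * norm v" if "norm (f x - f z) \<le> c" for f :: "real \<Rightarrow> 'a" and x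
  proof -
    have "\<bar>v \<bullet> (f x - f z)\<bar> \<le> norm v * norm (f x - f z)" by (rule Cauchy_Schwarz_ineq2)
    also have "\<dots> \<le> norm v * c" using that by (intro mult_left_mono) auto
    finally show ?thesis by (simp add: inner_diff_right mult.commute)
  qed
  have cv: "0 \<le> c * norm v" using c by simp
  have "\<rho> \<le> 1" using a d sep lu r by auto
  have r2: "\<rho>\<^sup>2 \<le> \<rho>" using \<open>\<rho> \<le> 1\<close> r by (simp add: power2_eq_square mult_left_le)
  have fact: "c / 4 * \<rho>\<^sup>2 * norm v = (c * norm v) * \<rho>\<^sup>2 / 4" by simp
  consider "4 * (c * norm v) \<le> \<bar>v \<bullet> N0 z\<bar>" | "4 * (c * norm v) \<le> \<bar>v \<bullet> N1 z\<bar>" | "4 * (c * norm v) \<le> \<bar>v \<bullet> N2 z\<bar>"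
    using low[of v] by linarith
  then show ?thesis
  proof cases
    case 1
    then have "c * norm v \<le> \<bar>v \<bullet> N0 a\<bar>" using near[OF close(1)[OF a]] cv by linarith
    then have "c * norm v \<le> m" using m by linarith
    moreover have "(c * norm v) * \<rho>\<^sup>2 \<le> (c * norm v) * 1"
      using cv r2 \<open>\<rho> \<le> 1\<close> by (intro mult_left_mono) auto
    ultimately show ?thesis using cv unfolding fact by linarith
  next
    case 2
    obtain x where x: "x \<in> {l..u}" "v \<bullet> (N0 b - N0 a) = v \<bullet> N1 x * (b - a)"
      using inner_mvt[OF d0 a b] by blast
    have "c * norm v \<le> \<bar>v \<bullet> N1 x\<bar>" using 2 near[OF close(2)[OF x(1)]] cv by linarith
    then have "(c * norm v) * \<rho> \<le> \<bar>v \<bullet> N1 x\<bar> * (b - a)"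
      using sep r cv by (intro mult_mono) auto
    also have "\<dots> = \<bar>v \<bullet> (N0 b - N0 a)\<bar>"
      using x(2) sep r by (simp add: abs_mult)
    also have "\<dots> \<le> 2 * m" using m by (simp add: inner_diff_right)
    finally have "(c * norm v) * \<rho> \<le> 2 * m" .
    moreover have "(c * norm v) * \<rho>\<^sup>2 \<le> (c * norm v) * \<rho>" using cv r2 by (rule mult_left_mono[rotated])
    moreover have "0 \<le> m" using m(1) by linarith
    ultimately show ?thesis using cv unfolding fact by linarith
  next
    case 3
    define s :: real where "s = (if 0 \<le> v \<bullet> N2 z then 1 else - 1)"
    have s1: "\<bar>s\<bar> \<le> 1" by (simp add: s_def)
    have pos: "c * norm v \<le> s * (v \<bullet> N2 x)" if "x \<in> {l..u}" for x
    proof (cases "0 \<le> v \<bullet> N2 z")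
      case True
      then have "c * norm v \<le> v \<bullet> N2 x" using 3 near[OF close(3)[OF that]] cv by linarith
      then show ?thesis using True by (simp add: s_def)
    next
      case False
      then have "c * norm v \<le> - (v \<bullet> N2 x)" using 3 near[OF close(3)[OF that]] cv by linarith
      then show ?thesis using False by (simp add: s_def)
    qed
    have tay: "s * (v \<bullet> N0 e) \<ge> s * (v \<bullet> N0 b) + s * (v \<bullet> N1 b) * (e - b) + (c * norm v) * \<rho>\<^sup>2 / 2"
      if e: "e \<in> {l..u}" "\<rho> \<le> \<bar>e - b\<bar>" for e
    proof -
      obtain x where x: "x \<in> {l..u}" "v \<bullet> N0 e = v \<bullet> N0 b + v \<bullet> N1 b * (e - b) + v \<bullet> N2 x / 2 * (e - b)\<^sup>2"
        using inner_taylor[OF d0 d1 b e(1)] by blast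
      have "\<rho>\<^sup>2 \<le> (e - b)\<^sup>2" using e(2) r by (metis abs_ge_zero abs_of_pos abs_le_square_iff)
      then have "(c * norm v) * \<rho>\<^sup>2 \<le> s * (v \<bullet> N2 x) * (e - b)\<^sup>2"
        by (intro mult_mono[OF pos[OF x(1)] _ order_trans[OF cv pos[OF x(1)]]]) auto
      then show ?thesis unfolding x(2) by (simp add: algebra_simps)
    qed
    have sm: "\<bar>s * (v \<bullet> N0 e)\<bar> \<le> m" if "\<bar>v \<bullet> N0 e\<bar> \<le> m" for e
      using mult_mono[OF s1 that] by (simp add: abs_mult)
    \<comment> \<open>The signed function exceeds its tangent at \<open>b\<close> by a quadratic
      term, and on one side of \<open>b\<close> the tangent does not descend, so the value at
      \<open>d\<close> or at \<open>a\<close> exceeds the one at \<open>b\<close>.\<close>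
    have "(c * norm v) * \<rho>\<^sup>2 / 2 \<le> 2 * m"
    proof (cases "s * (v \<bullet> N1 b) \<ge> 0")
      case True
      then have "s * (v \<bullet> N1 b) * (d - b) \<ge> 0" using sep r by (intro mult_nonneg_nonneg[OF True]) auto
      then show ?thesis
        using tay[OF d] sm[OF m(2)] sm[OF m(3)] sep r by (simp add: abs_le_iff)
    next
      case False
      then have "s * (v \<bullet> N1 b) * (a - b) \<ge> 0" using sep r by (intro mult_nonpos_nonpos[where b="a - b"]) linarith+
      then show ?thesis
        using tay[OF a] sm[OF m(2)] sm[OF m(1)] sep r by (simp add: abs_le_iff)
    qed
    then show ?thesis unfolding fact by linarith
  qed
qed


text \<open>With \<open>x, y, z, w\<close> as \<open>\<gamma>\<close> and its first three
  derivatives, the vectors paired with \<open>v\<close> are the normal and its first two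
  derivatives. The first two equations make \<open>cross3 v x\<close> orthogonal to the frame, so
  \<open>v\<close> is a multiple of \<open>x\<close>; this removes the \<open>w\<close> term and
  leaves a multiple of the determinant of the frame.\<close>

lemma cross_frame_eq_0:
  fixes x y z v :: "real ^ 3"
  assumes span: "span {x, y, z} = UNIV" and "x \<noteq> 0"
    and v: "v \<bullet> cross3 x y = 0" "v \<bullet> cross3 x z = 0" "v \<bullet> (cross3 y z + cross3 x w) = 0"
  shows "v = 0"
proof -
  have dep: "a = 0" if "a \<bullet> x = 0" "a \<bullet> y = 0" "a \<bullet> z = 0" for a :: "real ^ 3"
  proof -
    have "{x, y, z} \<subseteq> {b. a \<bullet> b = 0}" using that by auto
    then have "span {x, y, z} \<subseteq> {b. a \<bullet> b = 0}"
      by (rule span_minimal) (rule subspace_hyperplane)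
    then have "a \<bullet> a = 0" unfolding span by blast
    then show ?thesis by simp
  qed
  have cyc: "v \<bullet> cross3 a b = cross3 v a \<bullet> b" for a b
    using cross_triple[of v a b] by (metis cross_triple inner_commute)
  have "cross3 v x = 0"
    using v(1,2) dot_cross_self[of v x] by (intro dep) (simp_all add: cyc inner_commute)
  then have "v \<bullet> cross3 x w = 0" by (simp add: cyc)
  then have "v \<bullet> cross3 y z = 0" using v(3) by (simp add: inner_add_right)
  have "collinear {0, x, v}"
    using \<open>cross3 v x = 0\<close> cross_eq_0[of x v] cross_skew[of v x] by simp
  then obtain k where k: "v = k *\<^sub>R x"
    using \<open>x \<noteq> 0\<close> by (auto simp: collinear_lemma)
  show ?thesis
  proof (rule ccontr)
    assume "v \<noteq> 0"
    then have "k \<noteq> 0" using k by auto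
    then have "x \<bullet> cross3 y z = 0" using \<open>v \<bullet> cross3 y z = 0\<close> k by simp
    \<comment> \<open>A vanishing determinant puts the frame into a plane: \<open>cross3 y z\<close>
      is orthogonal to all three vectors, so \<open>y\<close> and \<open>z\<close> are parallel, and
      a normal of the plane contradicts \<open>dep\<close>.\<close>
    then have "cross3 y z = 0"
      using dot_cross_self[of y z] by (intro dep) (simp_all add: inner_commute)
    then have "collinear {0, y, z}" by (simp add: cross_eq_0)
    then consider "y = 0" | c where "z = c *\<^sub>R y" unfolding collinear_lemma by force
    then obtain b where b: "y \<in> span {x, b}" "z \<in> span {x, b}"
    proof cases
      case 1
      then show ?thesis by (intro that[of z]) (auto simp: span_base span_zero)
    next
      case 2
      then show ?thesis by (intro that[of y]) (auto simp: span_base span_mul)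
    qed
    have "dim {x, b} \<le> 2" using dim_le_card'[of "{x, b}"] card_insert_le_m1[of 2 "{b}" x] by simp
    then obtain a where "a \<noteq> 0" and a: "\<And>y. y \<in> span {x, b} \<Longrightarrow> orthogonal a y"
      using orthogonal_to_subspace_exists[of "{x, b}"] by auto
    have "a = 0"
      using a[OF b(1)] a[OF b(2)] a[of x] by (intro dep) (auto simp: orthogonal_def span_base)
    then show False using \<open>a \<noteq> 0\<close> by blast
  qed
qed

text \<open>
  The vector \<open>\<nu> x\<close> stands for \<open>\<gamma> x \<times> \<gamma>' x\<close>, a normal of the cone over \<open>\<gamma>\<close>. Nondegeneracy of \<open>\<gamma>\<close>
  makes \<open>\<nu>\<close> nondegenerate as well, which is the last assumption in a quantitative form.
\<close>

locale curve_arc =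
  fixes \<gamma> \<nu> :: "real \<Rightarrow> real ^ 3" and l u c C :: real
  assumes less: "l < u" and short: "u - l \<le> 1" and c_pos: "0 < c" and C_ge: "1 \<le> C"
    and unit: "x \<in> {l..u} \<Longrightarrow> norm (\<gamma> x) = 1"
    and inner_nonneg: "x \<in> {l..u} \<Longrightarrow> y \<in> {l..u} \<Longrightarrow> 0 \<le> \<gamma> x \<bullet> \<gamma> y"
    and lower: "x \<in> {l..u} \<Longrightarrow> y \<in> {l..u} \<Longrightarrow> c * \<bar>x - y\<bar> \<le> norm (\<gamma> x - \<gamma> y)"
    and upper: "x \<in> {l..u} \<Longrightarrow> y \<in> {l..u} \<Longrightarrow> norm (\<gamma> x - \<gamma> y) \<le> C * \<bar>x - y\<bar>"
    and normal: "x \<in> {l..u} \<Longrightarrow> \<nu> x \<bullet> \<gamma> x = 0"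
    and normal_bound: "x \<in> {l..u} \<Longrightarrow> norm (\<nu> x) \<le> C"
    and normal_taylor: "x \<in> {l..u} \<Longrightarrow> y \<in> {l..u} \<Longrightarrow> \<bar>\<nu> x \<bullet> \<gamma> y\<bar> \<le> C * (y - x)\<^sup>2"
    and normals_span: "x \<in> {l..u} \<Longrightarrow> y \<in> {l..u} \<Longrightarrow> z \<in> {l..u} \<Longrightarrow> 0 < \<rho> \<Longrightarrow>
      x + \<rho> \<le> y \<Longrightarrow> y + \<rho> \<le> z \<Longrightarrow>
      \<bar>v \<bullet> \<nu> x\<bar> \<le> m \<Longrightarrow> \<bar>v \<bullet> \<nu> y\<bar> \<le> m \<Longrightarrow> \<bar>v \<bullet> \<nu> z\<bar> \<le> m \<Longrightarrow> c * \<rho>\<^sup>2 * norm v \<le> m"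

text \<open>\<open>N1\<close> and \<open>N2\<close> are the derivatives of the normal
  \<open>N0\<close>; \<open>N2\<close> contains \<open>g 3\<close>, which is where the third
  derivative enters. Each property is made quantitative at \<open>z\<close> and carried to a short
  interval by continuity.\<close>

lemma curve_arc_exists:
  fixes g :: "nat \<Rightarrow> real \<Rightarrow> real ^ 3"
  assumes J: "open J" "z \<in> J"
    and deriv: "\<And>i x. i < 3 \<Longrightarrow> x \<in> J \<Longrightarrow> (g i has_vector_derivative g (Suc i) x) (at x)"
    and cont: "continuous_on J (g 3)"
    and unit: "\<And>x. x \<in> J \<Longrightarrow> norm (g 0 x) = 1"
    and span: "span {g 0 z, g 1 z, g 2 z} = UNIV"
  obtains \<nu> l u c C where "l < z" "z < u" "{l..u} \<subseteq> J" "curve_arc (g 0) \<nu> l u c C"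
proof -
  define N0 where "N0 x = cross3 (g 0 x) (g 1 x)" for x
  define N1 where "N1 x = cross3 (g 0 x) (g 2 x)" for x
  define N2 where "N2 x = cross3 (g 1 x) (g 2 x) + cross3 (g 0 x) (g 3 x)" for x
  have bb: "bounded_bilinear cross3"
    using bilinear_cross by (simp add: bilinear_conv_bounded_bilinear)
  have d0: "(N0 has_vector_derivative N1 x) (at x)" if "x \<in> J" for x
    using bounded_bilinear.has_vector_derivative[OF bb deriv[of 0] deriv[of 1]] that
    by (simp add: N0_def[abs_def] N1_def cross_refl numeral_2_eq_2)
  have d1: "(N1 has_vector_derivative N2 x) (at x)" if "x \<in> J" for x
    using bounded_bilinear.has_vector_derivative[OF bb deriv[of 0] deriv[of 2]] that
    by (simp add: N1_def[abs_def] N2_def numeral_3_eq_3 numeral_2_eq_2 add.commute)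
  have cg: "isCont (g i) z" if "i \<le> 3" for i
  proof (cases "i = 3")
    case True
    then show ?thesis using cont J by (simp add: continuous_on_eq_continuous_at)
  next
    case False
    then show ?thesis
      using that J(2) deriv[of i z] has_vector_derivative_continuous by fastforce
  qed
  have cN: "isCont N0 z" "isCont N1 z" "isCont N2 z"
    unfolding N0_def[abs_def] N1_def[abs_def] N2_def[abs_def]
    by (intro continuous_cross continuous_add cg; simp)+
  define f where "f v = (v \<bullet> N0 z, v \<bullet> N1 z, v \<bullet> N2 z)" for v
  have lin: "linear f"
    unfolding f_def by (auto intro!: linearI simp: inner_add_left)
  have "g 0 z \<noteq> 0" using unit[OF J(2)] by auto
  then have "inj f"
    using cross_frame_eq_0[OF span] unfolding linear_injective_0[OF lin]
    by (auto simp: f_def N0_def N1_def N2_def zero_prod_def)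
  then obtain B where B: "B > 0" "\<And>x. B * norm x \<le> norm (f x)"
    using linear_inj_bounded_below_pos[OF lin] by blast
  have nf: "norm (f v) \<le> \<bar>v \<bullet> N0 z\<bar> + \<bar>v \<bullet> N1 z\<bar> + \<bar>v \<bullet> N2 z\<bar>" for v
    using norm_Pair_le[of "v \<bullet> N0 z" "(v \<bullet> N1 z, v \<bullet> N2 z)"] norm_Pair_le[of "v \<bullet> N1 z" "v \<bullet> N2 z"]
    unfolding f_def by (simp only: real_norm_def)
  define b where "b = B / 12"
  have b: "0 < b" using B(1) by (simp add: b_def)
  define e where "e = norm (g 1 z)"
  \<comment> \<open>Otherwise \<open>N0 z\<close> is 0, and a nonzero vector orthogonal to
    \<open>N1 z\<close> and \<open>N2 z\<close> lies in the kernel of \<open>f\<close>.\<close>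
  have "g 1 z \<noteq> 0"
  proof
    assume "g 1 z = 0"
    then have "N0 z = 0" by (simp add: N0_def)
    have "\<exists>v \<noteq> 0. v \<bullet> N1 z = 0 \<and> v \<bullet> N2 z = 0"
    proof -
      have "dim {N1 z, N2 z} \<le> 2" using dim_le_card'[of "{N1 z, N2 z}"] card_insert_le_m1[of 2 "{N2 z}" "N1 z"] by simp
      then obtain a where "a \<noteq> 0" "\<And>y. y \<in> span {N1 z, N2 z} \<Longrightarrow> orthogonal a y"
        using orthogonal_to_subspace_exists[of "{N1 z, N2 z}"] by auto
      then show ?thesis by (auto simp: orthogonal_def span_base)
    qed
    then obtain v where "v \<noteq> 0" "f v = 0" using \<open>N0 z = 0\<close> by (auto simp: f_def zero_prod_def)
    then show False using \<open>inj f\<close> unfolding linear_injective_0[OF lin] by blast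
  qed
  then have e: "0 < e" by (simp add: e_def)
  have close: "\<forall>\<^sub>F x in nhds z. norm (h x - h z) < d" if "isCont h z" "0 < d" for h :: "real \<Rightarrow> real ^ 3" and d
  proof -
    have "(h \<longlongrightarrow> h z) (nhds z)"
      using that(1) by (simp add: isCont_def tendsto_at_iff_tendsto_nhds)
    from tendstoD[OF this that(2)] show ?thesis by (simp add: dist_norm)
  qed
  have "\<forall>\<^sub>F x in nhds z. x \<in> J \<and> norm (N0 x - N0 z) < b \<and> norm (N1 x - N1 z) < b \<and> norm (N2 x - N2 z) < b \<and>
      norm (g 0 x - g 0 z) < 1/2 \<and> norm (g 1 x - g 1 z) < e / 2 \<and> norm (g 2 x - g 2 z) < 1"
    using cg[of 0] cg[of 1] cg[of 2] cN b e J
    by (intro eventually_conj close eventually_nhds_in_open) auto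
  then obtain r where r: "0 < r" "\<And>x. dist x z < r \<Longrightarrow> x \<in> J \<and> norm (N0 x - N0 z) < b \<and> norm (N1 x - N1 z) < b \<and> norm (N2 x - N2 z) < b \<and>
      norm (g 0 x - g 0 z) < 1/2 \<and> norm (g 1 x - g 1 z) < e / 2 \<and> norm (g 2 x - g 2 z) < 1"
    unfolding eventually_nhds_metric by blast
  define h where "h = min (r / 2) (1 / 2)"
  have h: "0 < h" "h < r" "h \<le> 1/2" using r(1) by (auto simp: h_def)
  define l u where "l = z - h" and "u = z + h"
  have I: "x \<in> J \<and> norm (N0 x - N0 z) < b \<and> norm (N1 x - N1 z) < b \<and> norm (N2 x - N2 z) < b \<and>
      norm (g 0 x - g 0 z) < 1/2 \<and> norm (g 1 x - g 1 z) < e / 2 \<and> norm (g 2 x - g 2 z) < 1" if "x \<in> {l..u}" for x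
    using that h by (intro r(2)) (auto simp: l_def u_def dist_real_def)
  have z: "z \<in> {l..u}" using h by (auto simp: l_def u_def)
  define M where "M = 1 + e + norm (g 2 z) + norm (N0 z) + b"
  have M1: "1 \<le> M" using e b by (simp add: M_def)
  have bd: "norm (g 1 x) \<le> 2 * M" "norm (g 2 x) \<le> 2 * M" "norm (N0 x) \<le> 2 * M" if "x \<in> {l..u}" for x
    using I[OF that] norm_triangle_sub[of "g 1 x" "g 1 z"] norm_triangle_sub[of "g 2 x" "g 2 z"] norm_triangle_sub[of "N0 x" "N0 z"]
      e b unfolding M_def e_def[symmetric] by (simp_all, smt (verit) norm_ge_zero)+
  \<comment> \<open>\<open>e / 2\<close> bounds the speed in the direction \<open>g 1 z\<close> from
    below, and \<open>b / 4\<close> is the constant of \<open>three_values_lower_bound\<close>. In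
    \<open>CC\<close>, \<open>4 * M * M\<close> is the product of the bounds for \<open>N0\<close>
    and \<open>g 2\<close> in the Taylor remainder.\<close>
  define cc where "cc = min (e / 2) (b / 4)"
  define CC where "CC = 4 * M * M"
  have CC: "1 \<le> CC" "2 * M \<le> CC" using M1 mult_mono[of 1 M 1 M] mult_left_mono[of 1 M M] by (auto simp: CC_def)
  have dI: "(g 0 has_vector_derivative g 1 x) (at x)" "(g 1 has_vector_derivative g 2 x) (at x)" if "x \<in> {l..u}" for x
    using deriv[of 0 x] deriv[of 1 x] I[OF that] by (simp_all add: numeral_2_eq_2)
  have up: "norm (g 0 x - g 0 y) \<le> CC * \<bar>x - y\<bar>" if xy: "x \<in> {l..u}" "y \<in> {l..u}" for x y
  proof -
    let ?v = "g 0 x - g 0 y"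
    obtain \<xi> where \<xi>: "\<xi> \<in> {l..u}" "?v \<bullet> ?v = ?v \<bullet> g 1 \<xi> * (x - y)"
      using inner_mvt[OF dI(1) xy(2,1), of ?v] by blast
    have "norm ?v * norm ?v = \<bar>?v \<bullet> g 1 \<xi>\<bar> * \<bar>x - y\<bar>"
      using \<xi>(2) by (metis abs_mult abs_norm_cancel norm_mult power2_eq_square power2_norm_eq_inner real_norm_def)
    also have "\<dots> \<le> (norm ?v * CC) * \<bar>x - y\<bar>"
      using bd(1)[OF \<xi>(1)] CC(2)
      by (intro mult_right_mono order_trans[OF Cauchy_Schwarz_ineq2] mult_left_mono) auto
    finally have "norm ?v * norm ?v \<le> norm ?v * (CC * \<bar>x - y\<bar>)" by (simp add: mult.assoc)
    then show ?thesis using CC by (cases "norm ?v = 0") auto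
  qed
  have low: "cc * \<bar>x - y\<bar> \<le> norm (g 0 x - g 0 y)" if xy: "x \<in> {l..u}" "y \<in> {l..u}" for x y
  proof -
    obtain \<xi> where \<xi>: "\<xi> \<in> {l..u}" "g 1 z \<bullet> (g 0 x - g 0 y) = g 1 z \<bullet> g 1 \<xi> * (x - y)"
      using inner_mvt[OF dI(1) xy(2,1), of "g 1 z"] by blast
    have "\<bar>g 1 z \<bullet> (g 1 \<xi> - g 1 z)\<bar> \<le> e * (e / 2)"
      unfolding e_def using I[OF \<xi>(1)] by (intro order_trans[OF Cauchy_Schwarz_ineq2] mult_left_mono) (auto simp: e_def)
    moreover have "g 1 z \<bullet> g 1 z = e * e" by (simp add: e_def power2_norm_eq_inner[symmetric] power2_eq_square)
    ultimately have "e * (e / 2) \<le> \<bar>g 1 z \<bullet> g 1 \<xi>\<bar>"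
      unfolding inner_diff_right times_divide_eq_right by linarith
    then have "e * (e / 2) * \<bar>x - y\<bar> \<le> \<bar>g 1 z \<bullet> (g 0 x - g 0 y)\<bar>"
      unfolding \<xi>(2) abs_mult by (rule mult_right_mono) simp
    also have "\<dots> \<le> e * norm (g 0 x - g 0 y)" unfolding e_def by (rule Cauchy_Schwarz_ineq2)
    finally have "e / 2 * \<bar>x - y\<bar> \<le> norm (g 0 x - g 0 y)" using e by simp
    moreover have "cc * \<bar>x - y\<bar> \<le> e / 2 * \<bar>x - y\<bar>" by (intro mult_right_mono) (auto simp: cc_def)
    ultimately show ?thesis by linarith
  qed
  have "curve_arc (g 0) N0 l u cc CC"
  proof
    show "l < u" "u - l \<le> 1" using h by (auto simp: l_def u_def)
    show "0 < cc" using e b by (simp add: cc_def)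
    show "1 \<le> CC" by (rule CC)
    show "norm (g 0 x) = 1" if "x \<in> {l..u}" for x using I[OF that] unit by blast
    show "N0 x \<bullet> g 0 x = 0" for x by (simp add: N0_def dot_cross_self)
    show "norm (N0 x) \<le> CC" if "x \<in> {l..u}" for x using bd(3)[OF that] CC by linarith
    show "0 \<le> g 0 x \<bullet> g 0 y" if xy: "x \<in> {l..u}" "y \<in> {l..u}" for x y
    proof -
      have "norm (g 0 x - g 0 y) \<le> 1"
        using I[OF xy(1)] I[OF xy(2)] norm_triangle_ineq4[of "g 0 x - g 0 z" "g 0 y - g 0 z"] by simp
      then have "(norm (g 0 x - g 0 y))\<^sup>2 \<le> 1" by (simp add: power_le_one)
      moreover have "g 0 x \<bullet> g 0 x = 1" "g 0 y \<bullet> g 0 y = 1"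
        using unit I xy by (simp_all add: power2_norm_eq_inner[symmetric])
      ultimately show ?thesis
        by (simp add: power2_norm_eq_inner inner_diff_left inner_diff_right inner_commute)
    qed
    show "\<bar>N0 x \<bullet> g 0 y\<bar> \<le> CC * (y - x)\<^sup>2" if xy: "x \<in> {l..u}" "y \<in> {l..u}" for x y
    proof -
      obtain \<xi> where \<xi>: "\<xi> \<in> {l..u}" "N0 x \<bullet> g 0 y = N0 x \<bullet> g 0 x + N0 x \<bullet> g 1 x * (y - x) + N0 x \<bullet> g 2 \<xi> / 2 * (y - x)\<^sup>2"
        using inner_taylor[OF dI xy, of "N0 x"] by blast
      have eq: "N0 x \<bullet> g 0 y = N0 x \<bullet> g 2 \<xi> / 2 * (y - x)\<^sup>2"
        using \<xi>(2) by (simp add: N0_def dot_cross_self)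
      have "\<bar>N0 x \<bullet> g 2 \<xi>\<bar> \<le> (2 * M) * (2 * M)"
        using bd(3)[OF xy(1)] bd(2)[OF \<xi>(1)] M1
        by (intro order_trans[OF Cauchy_Schwarz_ineq2] mult_mono) auto
      then have "\<bar>N0 x \<bullet> g 2 \<xi> / 2\<bar> \<le> CC" unfolding CC_def by simp
      from mult_right_mono[OF this, of "(y - x)\<^sup>2"] show ?thesis
        unfolding eq abs_mult[of "N0 x \<bullet> g 2 \<xi> / 2"] by simp
    qed
    show "cc * \<rho>\<^sup>2 * norm v \<le> m"
      if "x \<in> {l..u}" "y \<in> {l..u}" "w \<in> {l..u}" "0 < \<rho>" "x + \<rho> \<le> y" "y + \<rho> \<le> w"
        "\<bar>v \<bullet> N0 x\<bar> \<le> m" "\<bar>v \<bullet> N0 y\<bar> \<le> m" "\<bar>v \<bullet> N0 w\<bar> \<le> m" for x y w \<rho> v m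
    proof -
      have "b / 4 * \<rho>\<^sup>2 * norm v \<le> m"
      proof (rule three_values_lower_bound[where ?N1.0=N1 and ?N2.0=N2 and z=z and l=l and u=u and a=x and b=y and d=w])
        show "12 * b * norm v \<le> \<bar>v \<bullet> N0 z\<bar> + \<bar>v \<bullet> N1 z\<bar> + \<bar>v \<bullet> N2 z\<bar>" for v
          using order_trans[OF B(2) nf, of v] by (simp add: b_def)
      qed (use that d0 d1 I z b h in \<open>auto intro: less_imp_le simp: l_def u_def\<close>)
      moreover have "cc * \<rho>\<^sup>2 * norm v \<le> b / 4 * \<rho>\<^sup>2 * norm v"
        by (intro mult_right_mono) (auto simp: cc_def)
      ultimately show ?thesis by linarith
    qed
  qed (use up low in auto)
  then show thesis
    using h I by (intro that[of l u N0 cc CC]) (auto simp: l_def u_def)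
qed

section \<open>Projection along a unit vector, and the angles at which two points nearly
  merge\<close>

definition perp :: "'a::real_inner \<Rightarrow> 'a \<Rightarrow> 'a" where
  "perp e x = x - (x \<bullet> e) *\<^sub>R e"

lemma perp_diff: "perp e (x - y) = perp e x - perp e y"
  by (simp add: perp_def inner_diff_left algebra_simps)

lemma perp_scaleR: "perp e (r *\<^sub>R x) = r *\<^sub>R perp e x"
  by (simp add: perp_def scaleR_right_diff_distrib)

lemma perp_add: "perp e (x + y) = perp e x + perp e y"
  by (simp add: perp_def inner_add_left algebra_simps)

lemma perp_minus_commute: "norm (perp e (x - y)) = norm (perp e (y - x))"
  by (simp add: perp_diff norm_minus_commute[of "perp e x"])

lemma perp_decomp: "x = (x \<bullet> e) *\<^sub>R e + perp e x"
  by (simp add: perp_def)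

lemma norm_perp_sq:
  assumes "norm e = 1"
  shows "(norm (perp e x))\<^sup>2 = (norm x)\<^sup>2 - (x \<bullet> e)\<^sup>2"
proof -
  have "e \<bullet> e = 1" using assms by (simp add: norm_eq_1)
  then show ?thesis
    unfolding perp_def power2_norm_eq_inner
    by (simp add: inner_diff_left inner_diff_right inner_commute[of e x] power2_eq_square)
qed

lemma norm_perp_le:
  assumes "norm e = 1"
  shows "norm (perp e x) \<le> norm x"
proof (rule power2_le_imp_le)
  show "(norm (perp e x))\<^sup>2 \<le> (norm x)\<^sup>2" by (simp add: norm_perp_sq[OF assms])
qed simp

lemma abs_inner_le_norm:
  assumes "norm e = 1"
  shows "\<bar>x \<bullet> e\<bar> \<le> norm x"
  using Cauchy_Schwarz_ineq2[of x e] assms by simp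

text \<open>Up to \<open>d\<close>, \<open>x\<close> is \<open>s\<close> times \<open>e\<close>, and
  projecting along \<open>e'\<close> gives
  \<open>\<bar>s\<bar> * norm (perp e' e) \<le> 2 * d\<close>. The sign condition rules out nearly
  opposite vectors, for which \<open>perp e' e\<close> is small while \<open>e - e'\<close> is not.
  The constant is 4 from the main part plus 2 from the remainder.\<close>

lemma perp_angle:
  assumes e: "norm e = 1" "norm e' = 1" "0 \<le> e \<bullet> e'"
    and d: "norm (perp e x) \<le> d" "norm (perp e' x) \<le> d"
  shows "norm x * norm (e - e') \<le> 6 * d"
proof -
  define s where "s = x \<bullet> e"
  have d0: "0 \<le> d" using d(1) norm_ge_zero order_trans by blast
  have "perp e' x = perp e' (s *\<^sub>R e + perp e x)"
    unfolding s_def using perp_decomp[of x e] by (rule arg_cong)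
  then have "perp e' x = s *\<^sub>R perp e' e + perp e' (perp e x)"
    by (simp only: perp_add perp_scaleR)
  then have "s *\<^sub>R perp e' e = perp e' x - perp e' (perp e x)" by simp
  then have "norm (s *\<^sub>R perp e' e) \<le> norm (perp e' x) + norm (perp e' (perp e x))"
    by (simp add: norm_triangle_ineq4)
  also have "\<dots> \<le> 2 * d" using d norm_perp_le[OF e(2), of "perp e x"] by linarith
  finally have 1: "\<bar>s\<bar> * norm (perp e' e) \<le> 2 * d" by simp
  have ee: "e \<bullet> e = 1" "e' \<bullet> e' = 1" using e by (simp_all add: norm_eq_1)
  have "e \<bullet> e' \<le> 1" using norm_cauchy_schwarz[of e e'] e by simp
  then have "(e \<bullet> e')\<^sup>2 \<le> e \<bullet> e'" using e(3) by (simp add: power2_eq_square mult_left_le)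
  moreover have "(norm (e - e'))\<^sup>2 = 2 - 2 * (e \<bullet> e')"
    unfolding power2_norm_eq_inner using ee by (simp add: inner_diff_left inner_diff_right inner_commute[of e' e])
  moreover have "(norm (perp e' e))\<^sup>2 = 1 - (e \<bullet> e')\<^sup>2"
    using norm_perp_sq[OF e(2), of e] e(1) by simp
  ultimately have "(norm (e - e'))\<^sup>2 \<le> (2 * norm (perp e' e))\<^sup>2"
    using zero_le_power2[of "norm (perp e' e)"] by (simp add: power_mult_distrib)
  then have 2: "norm (e - e') \<le> 2 * norm (perp e' e)" by (rule power2_le_imp_le) simp
  have "\<bar>s\<bar> * norm (e - e') \<le> \<bar>s\<bar> * (2 * norm (perp e' e))" using 2 by (rule mult_left_mono) simp
  then have 3: "\<bar>s\<bar> * norm (e - e') \<le> 4 * d" using 1 by simp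
  have "norm (e - e') \<le> 2" using norm_triangle_ineq4[of e e'] e by simp
  then have 4: "d * norm (e - e') \<le> d * 2" using d0 by (rule mult_left_mono)
  have "norm x = norm (s *\<^sub>R e + perp e x)"
    unfolding s_def using perp_decomp[of x e] by (rule arg_cong)
  also have "\<dots> \<le> \<bar>s\<bar> + d"
    using norm_triangle_ineq[of "s *\<^sub>R e" "perp e x"] e d by simp
  finally have "norm x \<le> \<bar>s\<bar> + d" .
  then have "norm x * norm (e - e') \<le> (\<bar>s\<bar> + d) * norm (e - e')" by (rule mult_right_mono) simp
  then show ?thesis using 3 4 by (simp add: distrib_right)
qed

lemma norm_perp_change:
  assumes e: "norm e = 1" "norm e' = 1"
  shows "norm (perp e x) \<le> norm (perp e' x) + norm x * norm (e - e')"
proof -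
  have "perp e x = perp e ((x \<bullet> e') *\<^sub>R e' + perp e' x)"
    using perp_decomp[of x e'] by (rule arg_cong)
  then have "perp e x = (x \<bullet> e') *\<^sub>R perp e e' + perp e (perp e' x)"
    by (simp only: perp_add perp_scaleR)
  then have "norm (perp e x) \<le> \<bar>x \<bullet> e'\<bar> * norm (perp e e') + norm (perp e (perp e' x))"
    using norm_triangle_ineq[of "(x \<bullet> e') *\<^sub>R perp e e'" "perp e (perp e' x)"] by simp
  also have "norm (perp e (perp e' x)) \<le> norm (perp e' x)" by (rule norm_perp_le[OF e(1)])
  also have "norm (perp e e') \<le> norm (e - e')"
  proof -
    have "perp e e' = perp e (e' - e)" using e by (simp add: perp_diff) (simp add: perp_def norm_eq_1)
    then show ?thesis using norm_perp_le[OF e(1), of "e' - e"] by (simp add: norm_minus_commute)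
  qed
  also have "\<bar>x \<bullet> e'\<bar> \<le> norm x" by (rule abs_inner_le_norm[OF e(2)])
  finally show ?thesis by (simp add: mult_left_mono mult_right_mono)
qed

lemma sum_le_card_fibres:
  fixes w :: "'a \<Rightarrow> real"
  assumes "finite S" "finite J" "f ` S \<subseteq> J" "0 \<le> B"
    and "\<And>x. x \<in> S \<Longrightarrow> sum w {y \<in> S. f y = f x} \<le> B"
  shows "sum w S \<le> real (card J) * B"
proof -
  have "sum w S = (\<Sum>j\<in>f ` S. sum w {y \<in> S. f y = j})"
    using assms(1) by (rule sum.image_gen)
  also have "\<dots> \<le> (\<Sum>j\<in>f ` S. B)"
    using assms(5) by (intro sum_mono) auto
  also have "\<dots> \<le> real (card J) * B"
    using card_mono[OF assms(2,3)] assms(4) by (simp add: mult_right_mono)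
  finally show ?thesis .
qed

context curve_arc
begin

lemma continuous_curve: "continuous_on {l..u} \<gamma>"
proof (rule lipschitz_on_continuous_on)
  show "C-lipschitz_on {l..u} \<gamma>"
    using upper C_ge by (intro lipschitz_onI) (auto simp: dist_norm)
qed

text \<open>For a difference \<open>x\<close> of two points, these are the angles at which their
  projections come within \<open>d\<close> of each other.\<close>

definition angles :: "real \<Rightarrow> real ^ 3 \<Rightarrow> real set" where
  "angles d x = {\<theta> \<in> {l..u}. norm (perp (\<gamma> \<theta>) x) \<le> d}"

lemma closed_angles: "closed (angles d x)"
proof -
  have "continuous_on {l..u} (\<lambda>\<theta>. norm (perp (\<gamma> \<theta>) x))"
    unfolding perp_def by (intro continuous_intros continuous_curve)
  then show ?thesis
    unfolding angles_def by (intro continuous_on_closed_Collect_le[of "{l..u}"] continuous_on_const) auto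
qed

lemma lmeasurable_angles: "angles d x \<in> lmeasurable"
proof (rule lmeasurable_compact)
  have "bounded (angles d x)"
    by (rule bounded_subset[of "{l..u}"]) (auto simp: angles_def)
  then show "compact (angles d x)"
    using closed_angles by (simp only: compact_eq_bounded_closed simp_thms)
qed

lemma angle_diff:
  assumes "\<theta> \<in> {l..u}" "\<theta>' \<in> {l..u}" "norm (perp (\<gamma> \<theta>) x) \<le> d" "norm (perp (\<gamma> \<theta>') x) \<le> d"
  shows "c * norm x * \<bar>\<theta> - \<theta>'\<bar> \<le> 6 * d"
proof -
  have "c * norm x * \<bar>\<theta> - \<theta>'\<bar> = norm x * (c * \<bar>\<theta> - \<theta>'\<bar>)" by simp
  also have "\<dots> \<le> norm x * norm (\<gamma> \<theta> - \<gamma> \<theta>')"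
    using lower assms by (intro mult_left_mono) auto
  also have "\<dots> \<le> 6 * d"
    using assms unit inner_nonneg by (intro perp_angle) auto
  finally show ?thesis .
qed

lemma measure_angles_le_1: "measure lebesgue (angles d x) \<le> 1"
proof -
  have "measure lebesgue (angles d x) \<le> measure lebesgue {l..u}"
  proof (rule measure_mono_fmeasurable)
    show "angles d x \<in> sets lebesgue" by (rule fmeasurableD) (rule lmeasurable_angles)
  qed (auto simp: angles_def)
  then show ?thesis using short less by simp
qed

lemma measure_angles_le:
  assumes "x \<noteq> 0" "0 \<le> d"
  shows "measure lebesgue (angles d x) \<le> 12 / c * d / norm x"
proof (cases "angles d x = {}")
  case True
  show ?thesis using assms c_pos by (simp add: True)
next
  case False
  then obtain a where a: "a \<in> angles d x" by blast
  define r where "r = 6 * d / (c * norm x)"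
  have "angles d x \<subseteq> {a - r..a + r}"
  proof
    fix b assume b: "b \<in> angles d x"
    have "c * norm x * \<bar>a - b\<bar> \<le> 6 * d"
      using a b by (intro angle_diff) (auto simp: angles_def)
    then have "\<bar>a - b\<bar> \<le> r"
      using c_pos assms by (simp add: r_def pos_le_divide_eq mult.commute)
    then show "b \<in> {a - r..a + r}" by auto
  qed
  then have "measure lebesgue (angles d x) \<le> measure lebesgue {a - r..a + r}"
  proof (rule measure_mono_fmeasurable)
    show "angles d x \<in> sets lebesgue" by (rule fmeasurableD) (rule lmeasurable_angles)
  qed auto
  also have "0 \<le> r" using a \<open>angles d x \<subseteq> {a - r..a + r}\<close> by auto
  then have "measure lebesgue {a - r..a + r} = 2 * r" by simp
  finally show ?thesis by (simp add: r_def)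
qed

end

section \<open>Pairs of points close to the cone\<close>

text \<open>A single scale \<open>\<delta>\<close>, with the mass bound only from radius
  \<open>\<delta>\<close> on. None of the constants defined in this locale involves
  \<open>\<delta>\<close>, \<open>P\<close> or \<open>w\<close>, which makes the estimates uniform
  over scales.\<close>

locale arc_weights = curve_arc \<gamma> \<nu> l u c C
  for \<gamma> \<nu> :: "real \<Rightarrow> real ^ 3" and l u c C :: real +
  fixes A R t \<delta> :: real and P :: "(real ^ 3) set" and w :: "real ^ 3 \<Rightarrow> real"
  assumes A_ge: "1 \<le> A" and R_ge: "1 \<le> R" and t_gt: "1 < t" and t_le: "t \<le> 2"
    and \<delta>_pos: "0 < \<delta>" and \<delta>_le: "\<delta> \<le> 1"
    and finite_P: "finite P" and norm_P: "p \<in> P \<Longrightarrow> norm p \<le> R" and w_nonneg: "0 \<le> w p"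
    and frostman: "\<delta> \<le> r \<Longrightarrow> sum w {p \<in> P. dist x p \<le> r} \<le> A * r powr t"
begin

lemma dist_P: "x \<in> P \<Longrightarrow> y \<in> P \<Longrightarrow> norm (x - y) \<le> 2 * R"
  using norm_triangle_ineq4[of x y] norm_P[of x] norm_P[of y] by linarith

lemma mass_mono: "S \<subseteq> T \<Longrightarrow> T \<subseteq> P \<Longrightarrow> sum w S \<le> sum w T"
  using finite_P w_nonneg by (intro sum_mono2) (auto intro: finite_subset)

lemma mass_P: "sum w P \<le> A * R powr t"
proof -
  have "sum w P \<le> sum w {p \<in> P. dist 0 p \<le> R}"
    using norm_P by (intro mass_mono) auto
  also have "\<dots> \<le> A * R powr t" using \<delta>_le R_ge by (intro frostman) auto
  finally show ?thesis .
qed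

lemma mass_P_le: "sum w P \<le> A * R\<^sup>2"
proof -
  have "R powr t \<le> R powr 2" using R_ge t_le by (intro powr_mono) auto
  then have "A * R powr t \<le> A * R\<^sup>2"
    using A_ge R_ge by (intro mult_left_mono) (auto simp: powr_numeral)
  then show ?thesis using mass_P by linarith
qed

lemma powr_minus_1:
  assumes "0 < r"
  shows "r powr t = r * r powr (t - 1)"
  using assms by (simp add: powr_diff)

text \<open>Slices of length \<open>r\<close> cut the tube into at most \<open>6 * R / r\<close>
  pieces, each inside a ball of radius \<open>3 * r\<close>; since \<open>t > 1\<close>, a positive
  power of \<open>r\<close> survives. For \<open>r > R\<close> the total mass suffices.\<close>

lemma tube_mass:
  assumes \<theta>: "\<theta> \<in> {l..u}" and x: "norm x \<le> R" and r: "\<delta> \<le> r"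
  shows "sum w {y \<in> P. norm (perp (\<gamma> \<theta>) (y - x)) \<le> r} \<le> 54 * A * R * r powr (t - 1)"
proof (cases "r \<le> R")
  case True
  define e where "e = \<gamma> \<theta>"
  have e: "norm e = 1" using unit[OF \<theta>] by (simp add: e_def)
  have r0: "0 < r" using r \<delta>_pos by linarith
  define S where "S = {y \<in> P. norm (perp e (y - x)) \<le> r}"
  define f where "f y = \<lfloor>((y - x) \<bullet> e) / r\<rfloor>" for y
  define J where "J = {\<lfloor>- (2 * R / r)\<rfloor>..\<lfloor>2 * R / r\<rfloor>}"
  have "sum w S \<le> real (card J) * (9 * A * r powr t)"
  proof (rule sum_le_card_fibres[where f=f])
    show "finite S" "finite J" using finite_P by (auto simp: S_def J_def)
    show "0 \<le> 9 * A * r powr t" using A_ge by simp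
    show "f ` S \<subseteq> J"
    proof (rule image_subsetI)
      fix y assume y: "y \<in> S"
      have "norm (y - x) \<le> 2 * R"
        using norm_triangle_ineq4[of y x] norm_P[of y] x y by (auto simp: S_def)
      then have "\<bar>(y - x) \<bullet> e\<bar> \<le> 2 * R" using abs_inner_le_norm[OF e, of "y - x"] by linarith
      then have "\<bar>((y - x) \<bullet> e) / r\<bar> \<le> 2 * R / r" using r0 by (simp add: divide_right_mono)
      then have "- (2 * R / r) \<le> ((y - x) \<bullet> e) / r" "((y - x) \<bullet> e) / r \<le> 2 * R / r"
        by linarith+
      then show "f y \<in> J" unfolding f_def J_def atLeastAtMost_iff by (intro conjI floor_mono)
    qed
    fix y assume y: "y \<in> S"
    have "{z \<in> S. f z = f y} \<subseteq> {p \<in> P. dist y p \<le> 3 * r}"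
    proof
      fix z assume z: "z \<in> {z \<in> S. f z = f y}"
      have "norm (perp e (y - z)) \<le> 2 * r"
      proof -
        have "perp e (y - z) = perp e (y - x) - perp e (z - x)" by (simp add: perp_diff)
        then show ?thesis
          using norm_triangle_ineq4[of "perp e (y - x)" "perp e (z - x)"] y z by (auto simp: S_def)
      qed
      moreover have "\<bar>((y - x) \<bullet> e) / r - ((z - x) \<bullet> e) / r\<bar> \<le> 1"
        using z unfolding f_def by (simp, linarith)
      then have "\<bar>(y - z) \<bullet> e\<bar> \<le> r"
        using r0 by (simp add: inner_diff_left diff_divide_distrib[symmetric] pos_divide_le_eq)
      moreover have "norm (y - z) = norm (((y - z) \<bullet> e) *\<^sub>R e + perp e (y - z))"
        using perp_decomp[of "y - z" e] by (rule arg_cong)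
      then have "norm (y - z) \<le> \<bar>(y - z) \<bullet> e\<bar> + norm (perp e (y - z))"
        using norm_triangle_ineq[of "((y - z) \<bullet> e) *\<^sub>R e" "perp e (y - z)"] e by simp
      ultimately show "z \<in> {p \<in> P. dist y p \<le> 3 * r}"
        using z by (auto simp: S_def dist_norm)
    qed
    then have "sum w {z \<in> S. f z = f y} \<le> sum w {p \<in> P. dist y p \<le> 3 * r}"
      by (rule mass_mono) auto
    also have "\<dots> \<le> A * (3 * r) powr t" using r r0 by (intro frostman) auto
    also have "\<dots> \<le> A * (9 * r powr t)"
    proof (intro mult_left_mono)
      have "(3::real) powr t \<le> 3 powr 2" using t_le by (intro powr_mono) auto
      then show "(3 * r) powr t \<le> 9 * r powr t"
        using r0 by (simp add: powr_mult mult_right_mono)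
    qed (use A_ge in auto)
    finally show "sum w {z \<in> S. f z = f y} \<le> 9 * A * r powr t" by simp
  qed
  also have "real (card J) \<le> 6 * R / r"
  proof -
    have le: "- (2 * R / r) \<le> 2 * R / r" using R_ge r0 by simp
    have "real (card J) = real_of_int (\<lfloor>2 * R / r\<rfloor> - \<lfloor>- (2 * R / r)\<rfloor> + 1)"
      unfolding J_def card_atLeastAtMost_int using floor_mono[OF le] by simp
    also have "\<dots> \<le> 4 * R / r + 2" by simp linarith
    also have "\<dots> \<le> 6 * R / r" using True r0 by (simp add: field_simps)
    finally show ?thesis .
  qed
  then have "real (card J) * (9 * A * r powr t) \<le> 6 * R / r * (9 * A * r powr t)"
    using A_ge by (intro mult_right_mono) auto
  also have "\<dots> = 54 * A * R * r powr (t - 1)"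
    using r0 by (simp add: powr_minus_1)
  finally show ?thesis by (simp add: S_def e_def)
next
  case False
  have "sum w {y \<in> P. norm (perp (\<gamma> \<theta>) (y - x)) \<le> r} \<le> sum w P"
    by (intro mass_mono) auto
  also note mass_P
  also have "A * R powr t = A * R * R powr (t - 1)"
    using R_ge by (simp add: powr_minus_1)
  also have "\<dots> \<le> (54 * A * R) * r powr (t - 1)"
    using False R_ge A_ge t_gt by (intro mult_mono powr_mono2) auto
  finally show ?thesis .
qed

text \<open>A Riesz potential of exponent 1, summed over dyadic shells; the constant is finite
  because \<open>t > 1\<close>. The index \<open>n\<close> only carries the induction over
  shells.\<close>

lemma riesz_sum:
  assumes "r \<le> 2 ^ n * \<delta>" "0 \<le> r"
  shows "(\<Sum>y\<in>{y \<in> P. \<delta> < dist x y \<and> dist x y \<le> r}. w y / dist x y) \<le> 2 * A / (1 - 2 powr (1 - t)) * r powr (t - 1)"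
  using assms
proof (induction n arbitrary: r)
  case 0
  then have e: "{y \<in> P. \<delta> < dist x y \<and> dist x y \<le> r} = {}" by auto
  have "(2::real) powr (1 - t) < 1" using t_gt by (simp add: powr_less_one)
  then show ?case unfolding e using A_ge by simp
next
  case (Suc n)
  define K where "K = 2 * A / (1 - 2 powr (1 - t))"
  have l1: "(2::real) powr (1 - t) < 1" using t_gt by (simp add: powr_less_one)
  then have "K * (1 - 2 powr (1 - t)) = 2 * A" using t_gt by (simp add: K_def)
  \<comment> \<open>\<open>K\<close> is the fixed point of the recursion: halving the radius
    contributes \<open>K * 2 powr (1 - t)\<close>, the outermost shell \<open>2 * A\<close>.\<close>
  then have K: "K * 2 powr (1 - t) + 2 * A = K" by (simp add: algebra_simps)
  have K0: "0 \<le> K" using l1 A_ge by (simp add: K_def)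
  show ?case
  proof (cases "\<delta> \<le> r")
    case False
    then have e: "{y \<in> P. \<delta> < dist x y \<and> dist x y \<le> r} = {}" by auto
    show ?thesis unfolding e K_def[symmetric] using K0 by simp
  next
    case True
    have r0: "0 < r" using True \<delta>_pos by linarith
    let ?S = "\<lambda>r. {y \<in> P. \<delta> < dist x y \<and> dist x y \<le> r}"
    have fin: "finite (?S r)" for r using finite_P by simp
    have "(\<Sum>y\<in>?S r. w y / dist x y) \<le> (\<Sum>y\<in>?S (r/2). w y / dist x y) + (\<Sum>y\<in>?S r - ?S (r/2). w y / dist x y)"
    proof -
      have "?S (r/2) \<subseteq> ?S r" using r0 by auto
      then show ?thesis using sum.subset_diff[of "?S (r/2)" "?S r" "\<lambda>y. w y / dist x y"] fin by simp
    qed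
    also have "(\<Sum>y\<in>?S (r/2). w y / dist x y) \<le> K * (r/2) powr (t - 1)"
      unfolding K_def using Suc.prems r0 by (intro Suc.IH) auto
    also have "(\<Sum>y\<in>?S r - ?S (r/2). w y / dist x y) \<le> (\<Sum>y\<in>?S r - ?S (r/2). w y * (2 / r))"
    proof (rule sum_mono)
      fix y assume "y \<in> ?S r - ?S (r/2)"
      then have "r / 2 < dist x y" by auto
      moreover from this have "0 < dist x y" using r0 by linarith
      ultimately have "1 / dist x y \<le> 2 / r" using r0 by (simp add: divide_simps)
      then show "w y / dist x y \<le> w y * (2 / r)"
        using mult_left_mono[OF _ w_nonneg[of y], of "1 / dist x y" "2 / r"] by simp
    qed
    also have "\<dots> = sum w (?S r - ?S (r/2)) * (2 / r)"
      by (rule sum_distrib_right[symmetric])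
    also have "\<dots> \<le> (A * r powr t) * (2 / r)"
    proof (rule mult_right_mono)
      have "sum w (?S r - ?S (r/2)) \<le> sum w {y \<in> P. dist x y \<le> r}" by (intro mass_mono) auto
      then show "sum w (?S r - ?S (r/2)) \<le> A * r powr t" using frostman[OF True, of x] by linarith
    qed (use r0 in auto)
    also have "K * (r/2) powr (t - 1) + (A * r powr t) * (2 / r) = (K * 2 powr (1 - t) + 2 * A) * r powr (t - 1)"
    proof -
      have "(r/2) powr (t - 1) = r powr (t - 1) * 2 powr (1 - t)"
        using r0 powr_minus_divide[of 2 "t - 1"] by (simp add: powr_divide)
      then show ?thesis using r0 by (simp add: powr_minus_1 algebra_simps)
    qed
    finally show ?thesis unfolding K by (simp add: K_def)
  qed
qed

definition near_const :: real where
  "near_const = A + 12 / c * (2 * A / (1 - 2 powr (1 - t)))"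

text \<open>Within distance \<open>\<delta>\<close> the angle sets have measure at most 1 and the
  mass is at most \<open>A * \<delta> powr t\<close>; beyond, the bound
  \<open>12 / c * \<delta> / dist x y\<close> is summed as a Riesz potential. Confinement to
  distance \<open>\<tau>\<close> thus gains \<open>\<tau> powr (t - 1)\<close>.\<close>

lemma near_sum:
  assumes \<tau>: "\<delta> \<le> \<tau>"
  shows "(\<Sum>y\<in>{y \<in> P. dist x y \<le> \<tau>}. w y * measure lebesgue (angles \<delta> (x - y))) \<le> near_const * \<delta> * \<tau> powr (t - 1)"
proof -
  let ?f = "\<lambda>y. w y * measure lebesgue (angles \<delta> (x - y))"
  let ?S = "{y \<in> P. \<delta> < dist x y \<and> dist x y \<le> \<tau>}"
  have "{y \<in> P. dist x y \<le> \<tau>} = {y \<in> P. dist x y \<le> \<delta>} \<union> ?S" using \<tau> by auto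
  then have "sum ?f {y \<in> P. dist x y \<le> \<tau>} = sum ?f {y \<in> P. dist x y \<le> \<delta>} + sum ?f ?S"
    using finite_P by (simp, intro sum.union_disjoint) auto
  also have "sum ?f {y \<in> P. dist x y \<le> \<delta>} \<le> sum w {y \<in> P. dist x y \<le> \<delta>}"
    using w_nonneg measure_angles_le_1 by (intro sum_mono) (simp add: mult_left_le)
  also have "\<dots> \<le> A * \<delta> powr t" by (rule frostman) simp
  also have "\<dots> \<le> A * (\<delta> * \<tau> powr (t - 1))"
    using A_ge \<delta>_pos \<tau> t_gt by (auto simp: powr_minus_1 intro!: mult_left_mono powr_mono2)
  also have "sum ?f ?S \<le> (\<Sum>y\<in>?S. 12 / c * \<delta> * (w y / dist x y))"
  proof (rule sum_mono)
    fix y assume "y \<in> ?S"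
    then have "x - y \<noteq> 0" using \<delta>_pos by auto
    then have "w y * measure lebesgue (angles \<delta> (x - y)) \<le> w y * (12 / c * \<delta> / norm (x - y))"
      using w_nonneg \<delta>_pos by (intro mult_left_mono measure_angles_le) auto
    then show "?f y \<le> 12 / c * \<delta> * (w y / dist x y)"
      by (simp add: dist_norm mult_ac)
  qed
  also have "\<dots> = 12 / c * \<delta> * (\<Sum>y\<in>?S. w y / dist x y)"
    by (simp add: sum_distrib_left)
  also have "\<dots> \<le> 12 / c * \<delta> * (2 * A / (1 - 2 powr (1 - t)) * \<tau> powr (t - 1))"
  proof (rule mult_left_mono)
    obtain n where "\<tau> / \<delta> < 2 ^ n" using real_arch_pow[of 2 "\<tau> / \<delta>"] by auto
    then have "\<tau> \<le> 2 ^ n * \<delta>" using \<delta>_pos by (simp add: field_simps)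
    then show "(\<Sum>y\<in>?S. w y / dist x y) \<le> 2 * A / (1 - 2 powr (1 - t)) * \<tau> powr (t - 1)"
      using \<tau> \<delta>_pos by (intro riesz_sum) auto
  qed (use c_pos \<delta>_pos in auto)
  finally show ?thesis by (simp add: near_const_def algebra_simps)
qed

end

lemma (in curve_arc) normals_span_separated:
  assumes I: "x \<in> {l..u}" "y \<in> {l..u}" "z \<in> {l..u}" and \<rho>: "0 < \<rho>"
    and sep: "\<rho> \<le> \<bar>x - y\<bar>" "\<rho> \<le> \<bar>x - z\<bar>" "\<rho> \<le> \<bar>y - z\<bar>"
    and m: "\<bar>v \<bullet> \<nu> x\<bar> \<le> m" "\<bar>v \<bullet> \<nu> y\<bar> \<le> m" "\<bar>v \<bullet> \<nu> z\<bar> \<le> m"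
  shows "c * \<rho>\<^sup>2 * norm v \<le> m"
proof -
  consider "x + \<rho> \<le> y \<and> y + \<rho> \<le> z" | "x + \<rho> \<le> z \<and> z + \<rho> \<le> y" | "y + \<rho> \<le> x \<and> x + \<rho> \<le> z"
    | "y + \<rho> \<le> z \<and> z + \<rho> \<le> x" | "z + \<rho> \<le> x \<and> x + \<rho> \<le> y" | "z + \<rho> \<le> y \<and> y + \<rho> \<le> x"
    using sep by (auto simp: abs_if split: if_splits)
  then show ?thesis
    by cases (use normals_span I \<rho> m in blast)+
qed

lemma sum_cube:
  fixes f :: "'a \<Rightarrow> 'b::comm_semiring_1"
  shows "(sum f S) ^ 3 = (\<Sum>a\<in>S. \<Sum>b\<in>S. \<Sum>d\<in>S. f a * (f b * f d))"
proof -
  have "(sum f S) ^ 3 = sum f S * (sum f S * sum f S)"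
    by (simp only: power3_eq_cube mult.assoc)
  also have "\<dots> = (\<Sum>a\<in>S. \<Sum>b\<in>S. f a * (\<Sum>d\<in>S. f b * f d))"
    by (simp only: sum_product)
  finally show ?thesis by (simp only: sum_distrib_left)
qed

section \<open>Triples of cone neighbours with separated angles\<close>

context arc_weights
begin

definition nbrs :: "real \<Rightarrow> real ^ 3 \<Rightarrow> (real ^ 3) set" where
  "nbrs \<tau> x = {y \<in> P. \<tau> \<le> dist x y \<and> angles \<delta> (x - y) \<noteq> {}}"

text \<open>Any choice will do: for \<open>y\<close> in \<open>nbrs \<tau> x\<close> with
  \<open>\<tau> > 0\<close>, \<open>angle_diff\<close> keeps all admissible angles within
  \<open>6 * \<delta> / (c * \<tau>)\<close> of each other.\<close>

definition ang :: "real ^ 3 \<Rightarrow> real ^ 3 \<Rightarrow> real" where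
  "ang x y = (SOME \<theta>. \<theta> \<in> angles \<delta> (x - y))"

lemma nbrs_subset: "nbrs \<tau> x \<subseteq> P"
  by (auto simp: nbrs_def)

lemma ang:
  assumes "y \<in> nbrs \<tau> x"
  shows "ang x y \<in> {l..u}" "norm (perp (\<gamma> (ang x y)) (x - y)) \<le> \<delta>"
proof -
  have "ang x y \<in> angles \<delta> (x - y)"
    using assms unfolding nbrs_def ang_def by (auto intro: someI_ex)
  then show "ang x y \<in> {l..u}" "norm (perp (\<gamma> (ang x y)) (x - y)) \<le> \<delta>"
    by (auto simp: angles_def)
qed

definition close_const :: real where
  "close_const = 54 * A * R * (1 + 2 * R * C)"

text \<open>All such \<open>b\<close> lie in a tube around the line through \<open>x\<close> with
  direction \<open>\<gamma> (ang x a)\<close>: changing the angle by \<open>\<rho>\<close> costs at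
  most \<open>2 * R * C * \<rho>\<close> for points at distance at most
  \<open>2 * R\<close>.\<close>

lemma close_angles_mass:
  assumes x: "x \<in> P" and a: "a \<in> nbrs \<tau> x" and \<rho>: "\<delta> \<le> \<rho>"
  shows "sum w {b \<in> nbrs \<tau> x. \<bar>ang x a - ang x b\<bar> < \<rho>} \<le> close_const * \<rho> powr (t - 1)"
proof -
  define k where "k = 1 + 2 * R * C"
  have k1: "1 \<le> k" using R_ge C_ge by (simp add: k_def)
  have \<rho>0: "0 < \<rho>" using \<rho> \<delta>_pos by linarith
  have "{b \<in> nbrs \<tau> x. \<bar>ang x a - ang x b\<bar> < \<rho>} \<subseteq> {y \<in> P. norm (perp (\<gamma> (ang x a)) (y - x)) \<le> k * \<rho>}"
  proof
    fix b assume b: "b \<in> {b \<in> nbrs \<tau> x. \<bar>ang x a - ang x b\<bar> < \<rho>}"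
    then have bn: "b \<in> nbrs \<tau> x" by simp
    then have bP: "b \<in> P" using nbrs_subset by blast
    have "norm (perp (\<gamma> (ang x a)) (x - b)) \<le> norm (perp (\<gamma> (ang x b)) (x - b)) + norm (x - b) * norm (\<gamma> (ang x a) - \<gamma> (ang x b))"
      by (intro norm_perp_change unit ang(1)[OF a] ang(1)[OF bn])
    also have "\<dots> \<le> \<rho> + (2 * R) * (C * \<rho>)"
    proof (intro add_mono mult_mono)
      show "norm (perp (\<gamma> (ang x b)) (x - b)) \<le> \<rho>" using ang(2)[OF bn] \<rho> by linarith
      show "norm (x - b) \<le> 2 * R" using x bP by (rule dist_P)
      have "norm (\<gamma> (ang x a) - \<gamma> (ang x b)) \<le> C * \<bar>ang x a - ang x b\<bar>"
        by (intro upper ang(1)[OF a] ang(1)[OF bn])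
      also have "\<dots> \<le> C * \<rho>" using b C_ge by (intro mult_left_mono) auto
      finally show "norm (\<gamma> (ang x a) - \<gamma> (ang x b)) \<le> C * \<rho>" .
    qed (use R_ge in auto)
    also have "\<dots> = k * \<rho>" by (simp add: k_def algebra_simps)
    finally show "b \<in> {y \<in> P. norm (perp (\<gamma> (ang x a)) (y - x)) \<le> k * \<rho>}"
      using bP by (simp add: perp_minus_commute[of _ x b])
  qed
  then have "sum w {b \<in> nbrs \<tau> x. \<bar>ang x a - ang x b\<bar> < \<rho>} \<le> sum w {y \<in> P. norm (perp (\<gamma> (ang x a)) (y - x)) \<le> k * \<rho>}"
    by (rule mass_mono) auto
  also have "\<dots> \<le> 54 * A * R * (k * \<rho>) powr (t - 1)"
    using k1 \<rho> \<rho>0 mult_right_mono[of 1 k \<rho>] by (intro tube_mass ang(1)[OF a] norm_P[OF x]) linarith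
  also have "\<dots> \<le> 54 * A * R * (k * \<rho> powr (t - 1))"
  proof (rule mult_left_mono)
    have "k powr (t - 1) \<le> k powr 1" using k1 t_le by (intro powr_mono) auto
    then show "(k * \<rho>) powr (t - 1) \<le> k * \<rho> powr (t - 1)"
      using k1 \<rho>0 by (simp add: powr_mult mult_right_mono)
  qed (use A_ge R_ge in auto)
  finally show ?thesis by (simp add: close_const_def k_def mult.assoc)
qed

definition sep_points :: "real \<Rightarrow> real \<Rightarrow> real ^ 3 \<Rightarrow> real ^ 3 \<Rightarrow> real ^ 3 \<Rightarrow> (real ^ 3) set" where
  "sep_points \<rho> \<tau> a b d = {x \<in> P. a \<in> nbrs \<tau> x \<and> b \<in> nbrs \<tau> x \<and> d \<in> nbrs \<tau> x \<and>
     \<rho> \<le> \<bar>ang x a - ang x b\<bar> \<and> \<rho> \<le> \<bar>ang x a - ang x d\<bar> \<and> \<rho> \<le> \<bar>ang x b - ang x d\<bar>}"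

text \<open>In 144, the factor \<open>36 * 2\<close> comes from squaring the angle difference and
  the remaining 2 from the distance bound \<open>2 * R\<close>; \<open>C\<close> is the constant of
  \<open>normal_taylor\<close>. \<open>\<kappa>_const\<close> sets the radius below which the
  quadratic term can be absorbed, and \<open>H_const\<close> is the bound that results.\<close>

definition Q_const :: real where "Q_const = 144 * R * C / c\<^sup>2"
definition H_const :: real where "H_const = 1 + 2 / c * (2 * C + Q_const)"
definition \<kappa>_const :: real where "\<kappa>_const = min 1 (c / (2 * Q_const))"

lemma consts_pos: "0 < Q_const" "1 \<le> H_const" "0 < \<kappa>_const" "\<kappa>_const \<le> 1"
proof -
  show Q: "0 < Q_const" using R_ge C_ge c_pos by (simp add: Q_const_def)
  then show "1 \<le> H_const" "0 < \<kappa>_const" "\<kappa>_const \<le> 1"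
    using c_pos C_ge by (simp_all add: H_const_def \<kappa>_const_def)
qed

text \<open>Both \<open>x - a\<close> and \<open>y - a\<close> are nearly multiples of
  \<open>\<gamma>\<close>, at angles \<open>p\<close> and \<open>q\<close> whose difference is
  O(\<open>(\<delta> + norm (x - y)) / \<rho>\<close>), as \<open>a\<close> is far from
  \<open>x\<close>. The normal at \<open>p\<close> annihilates \<open>\<gamma> p\<close> and meets
  \<open>\<gamma> q\<close> only to second order, so apart from \<open>\<delta>\<close> the
  displacement along it is quadratic in \<open>norm (x - y)\<close>.\<close>

lemma normal_displacement:
  assumes x: "x \<in> P" "y \<in> P" and a: "a \<in> nbrs \<tau> x" "a \<in> nbrs \<tau> y"
    and \<rho>: "0 < \<rho>" "\<rho> \<le> \<tau>"
  shows "\<bar>(x - y) \<bullet> \<nu> (ang x a)\<bar> \<le> 2 * C * \<delta> + Q_const * (\<delta>\<^sup>2 + (norm (x - y))\<^sup>2) / \<rho>\<^sup>2"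
proof -
  define p where "p = ang x a"
  define q where "q = ang y a"
  define v where "v = x - y"
  have p: "p \<in> {l..u}" "norm (perp (\<gamma> p) (x - a)) \<le> \<delta>" using ang[OF a(1)] by (simp_all add: p_def)
  have q: "q \<in> {l..u}" "norm (perp (\<gamma> q) (y - a)) \<le> \<delta>" using ang[OF a(2)] by (simp_all add: q_def)
  have aP: "a \<in> P" using a nbrs_subset by blast
  have far: "\<rho> \<le> norm (x - a)" using a(1) \<rho> by (auto simp: nbrs_def dist_norm)
  have "x - a = (y - a) + v" by (simp add: v_def)
  then have "norm (perp (\<gamma> q) (x - a)) \<le> norm (perp (\<gamma> q) (y - a)) + norm (perp (\<gamma> q) v)"
    using norm_triangle_ineq by (simp only: perp_add)
  also have "\<dots> \<le> \<delta> + norm v"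
    using q(2) norm_perp_le[OF unit[OF q(1)], of v] by linarith
  finally have "norm (perp (\<gamma> q) (x - a)) \<le> \<delta> + norm v" .
  then have "c * norm (x - a) * \<bar>p - q\<bar> \<le> 6 * (\<delta> + norm v)"
    using p(1) q(1) by (rule angle_diff[rotated -1]) (use p(2) in \<open>simp add: add_increasing2\<close>)
  moreover have "c * \<rho> * \<bar>p - q\<bar> \<le> c * norm (x - a) * \<bar>p - q\<bar>"
    using far c_pos by (intro mult_right_mono mult_left_mono) auto
  ultimately have pq: "c * \<rho> * \<bar>p - q\<bar> \<le> 6 * (\<delta> + norm v)" by linarith
  then have "\<bar>p - q\<bar> \<le> 6 * (\<delta> + norm v) / (c * \<rho>)"
    using c_pos \<rho> by (simp add: pos_le_divide_eq mult.commute)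
  then have "\<bar>p - q\<bar>\<^sup>2 \<le> (6 * (\<delta> + norm v) / (c * \<rho>))\<^sup>2" by (intro power_mono) auto
  also have "\<dots> = 36 * (\<delta> + norm v)\<^sup>2 / (c\<^sup>2 * \<rho>\<^sup>2)" by (simp only: power_divide power_mult_distrib) simp
  also have "\<dots> \<le> 36 * (2 * (\<delta>\<^sup>2 + (norm v)\<^sup>2)) / (c\<^sup>2 * \<rho>\<^sup>2)"
  proof (intro divide_right_mono mult_left_mono)
    show "(\<delta> + norm v)\<^sup>2 \<le> 2 * (\<delta>\<^sup>2 + (norm v)\<^sup>2)"
      using sum_squares_bound[of \<delta> "norm v"] by (simp add: power2_sum)
  qed auto
  finally have sq: "(q - p)\<^sup>2 \<le> 72 * (\<delta>\<^sup>2 + (norm v)\<^sup>2) / (c\<^sup>2 * \<rho>\<^sup>2)"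
    by (simp add: power2_commute)
  have small: "\<bar>perp (\<gamma> s) z \<bullet> \<nu> p\<bar> \<le> \<delta> * C" if "norm (perp (\<gamma> s) z) \<le> \<delta>" for s z
    using that normal_bound[OF p(1)] \<delta>_pos
    by (intro order_trans[OF Cauchy_Schwarz_ineq2] mult_mono) auto
  have "(x - a) \<bullet> \<nu> p = ((x - a) \<bullet> \<gamma> p) * (\<gamma> p \<bullet> \<nu> p) + perp (\<gamma> p) (x - a) \<bullet> \<nu> p"
    using arg_cong[OF perp_decomp[of "x - a" "\<gamma> p"], of "\<lambda>z. z \<bullet> \<nu> p"] by (simp only: inner_add_left inner_scaleR_left)
  then have 1: "\<bar>(x - a) \<bullet> \<nu> p\<bar> \<le> \<delta> * C"
    using normal[OF p(1)] small[OF p(2)] by (simp add: inner_commute)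
  have "(y - a) \<bullet> \<nu> p = ((y - a) \<bullet> \<gamma> q) * (\<gamma> q \<bullet> \<nu> p) + perp (\<gamma> q) (y - a) \<bullet> \<nu> p"
    using arg_cong[OF perp_decomp[of "y - a" "\<gamma> q"], of "\<lambda>z. z \<bullet> \<nu> p"] by (simp only: inner_add_left inner_scaleR_left)
  then have "\<bar>(y - a) \<bullet> \<nu> p\<bar> \<le> \<bar>(y - a) \<bullet> \<gamma> q\<bar> * \<bar>\<gamma> q \<bullet> \<nu> p\<bar> + \<bar>perp (\<gamma> q) (y - a) \<bullet> \<nu> p\<bar>"
    by (simp only: abs_mult[symmetric] abs_triangle_ineq)
  also have "\<dots> \<le> (2 * R) * (C * (72 * (\<delta>\<^sup>2 + (norm v)\<^sup>2) / (c\<^sup>2 * \<rho>\<^sup>2))) + \<delta> * C"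
  proof (intro add_mono mult_mono)
    show "\<bar>(y - a) \<bullet> \<gamma> q\<bar> \<le> 2 * R"
      using abs_inner_le_norm[OF unit[OF q(1)], of "y - a"] dist_P[OF x(2) aP] by linarith
    have "\<bar>\<gamma> q \<bullet> \<nu> p\<bar> \<le> C * (q - p)\<^sup>2"
      using normal_taylor[OF p(1) q(1)] by (simp add: inner_commute)
    also have "\<dots> \<le> C * (72 * (\<delta>\<^sup>2 + (norm v)\<^sup>2) / (c\<^sup>2 * \<rho>\<^sup>2))"
      using sq C_ge by (intro mult_left_mono) auto
    finally show "\<bar>\<gamma> q \<bullet> \<nu> p\<bar> \<le> C * (72 * (\<delta>\<^sup>2 + (norm v)\<^sup>2) / (c\<^sup>2 * \<rho>\<^sup>2))" .
    show "\<bar>perp (\<gamma> q) (y - a) \<bullet> \<nu> p\<bar> \<le> \<delta> * C" by (rule small[OF q(2)])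
  qed (use R_ge in auto)
  also have "(2 * R) * (C * (72 * X / (c\<^sup>2 * \<rho>\<^sup>2))) = Q_const * X / \<rho>\<^sup>2" for X
    by (simp add: Q_const_def)
  finally have 2: "\<bar>(y - a) \<bullet> \<nu> p\<bar> \<le> Q_const * (\<delta>\<^sup>2 + (norm v)\<^sup>2) / \<rho>\<^sup>2 + \<delta> * C" .
  have "v \<bullet> \<nu> p = (x - a) \<bullet> \<nu> p - (y - a) \<bullet> \<nu> p"
    by (simp add: v_def inner_diff_left)
  moreover have "\<delta> * C + \<delta> * C = 2 * C * \<delta>" by simp
  ultimately show ?thesis using 1 2 unfolding p_def[symmetric] v_def[symmetric] by linarith
qed

text \<open>Up to powers of \<open>\<rho>\<close>, three displacement bounds give
  \<open>norm (x - y)\<close> at most O(\<open>\<delta>\<close>) plus a quadratic term. For points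
  already moderately close the latter is at most half of the left side, so the moderate bound
  improves itself to nearly \<open>\<delta>\<close>.\<close>

lemma sep_points_local:
  assumes x: "x \<in> sep_points \<rho> \<tau> a b d" and y: "y \<in> sep_points \<rho> \<tau> a b d"
    and \<rho>: "0 < \<rho>" "\<rho> \<le> 1" "\<rho> \<le> \<tau>" "\<delta> \<le> \<rho>\<^sup>2"
    and near: "dist x y \<le> \<kappa>_const * \<rho> ^ 4"
  shows "dist x y \<le> H_const * \<delta> / \<rho>\<^sup>2"
proof -
  define V where "V = norm (x - y)"
  have V0: "0 \<le> V" by (simp add: V_def)
  have bd: "\<bar>(x - y) \<bullet> \<nu> (ang x e)\<bar> \<le> 2 * C * \<delta> + Q_const * (\<delta>\<^sup>2 + V\<^sup>2) / \<rho>\<^sup>2" if "e \<in> nbrs \<tau> x" "e \<in> nbrs \<tau> y" for e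
    unfolding V_def using x y that \<rho> by (intro normal_displacement[where \<tau>=\<tau>]) (auto simp: sep_points_def)
  have "c * \<rho>\<^sup>2 * V \<le> 2 * C * \<delta> + Q_const * (\<delta>\<^sup>2 + V\<^sup>2) / \<rho>\<^sup>2"
    unfolding V_def
  proof (rule normals_span_separated[of "ang x a" "ang x b" "ang x d" \<rho>])
    have n: "a \<in> nbrs \<tau> x" "b \<in> nbrs \<tau> x" "d \<in> nbrs \<tau> x" "a \<in> nbrs \<tau> y" "b \<in> nbrs \<tau> y" "d \<in> nbrs \<tau> y"
      using x y by (auto simp: sep_points_def)
    show "ang x a \<in> {l..u}" "ang x b \<in> {l..u}" "ang x d \<in> {l..u}"
      by (rule ang(1)[OF n(1)] ang(1)[OF n(2)] ang(1)[OF n(3)])+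
    show "\<bar>(x - y) \<bullet> \<nu> (ang x a)\<bar> \<le> 2 * C * \<delta> + Q_const * (\<delta>\<^sup>2 + (norm (x - y))\<^sup>2) / \<rho>\<^sup>2"
      "\<bar>(x - y) \<bullet> \<nu> (ang x b)\<bar> \<le> 2 * C * \<delta> + Q_const * (\<delta>\<^sup>2 + (norm (x - y))\<^sup>2) / \<rho>\<^sup>2"
      "\<bar>(x - y) \<bullet> \<nu> (ang x d)\<bar> \<le> 2 * C * \<delta> + Q_const * (\<delta>\<^sup>2 + (norm (x - y))\<^sup>2) / \<rho>\<^sup>2"
      using bd[unfolded V_def] n by blast+
  qed (use x \<rho>(1) in \<open>auto simp: sep_points_def\<close>)
  also have "\<dots> = 2 * C * \<delta> + Q_const * \<delta> * (\<delta> / \<rho>\<^sup>2) + Q_const * V\<^sup>2 / \<rho>\<^sup>2"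
    by (simp add: power2_eq_square distrib_left add_divide_distrib)
  also have "Q_const * \<delta> * (\<delta> / \<rho>\<^sup>2) \<le> Q_const * \<delta> * 1"
    using consts_pos \<delta>_pos \<rho> by (intro mult_left_mono) (auto simp: pos_divide_le_eq)
  also have "Q_const * V\<^sup>2 / \<rho>\<^sup>2 \<le> c / 2 * \<rho>\<^sup>2 * V"
  proof -
    have "V * V \<le> (\<kappa>_const * \<rho> ^ 4) * V" using near V0 unfolding V_def dist_norm by (rule mult_right_mono)
    then have "Q_const * V\<^sup>2 \<le> Q_const * (\<kappa>_const * \<rho> ^ 4 * V)"
      using consts_pos(1) by (simp add: power2_eq_square)
    also have "\<dots> = (Q_const * \<kappa>_const) * (\<rho> ^ 4 * V)" by simp
    also have "\<dots> \<le> c / 2 * (\<rho> ^ 4 * V)"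
    proof (rule mult_right_mono)
      have "Q_const * \<kappa>_const \<le> Q_const * (c / (2 * Q_const))"
        using consts_pos(1) by (intro mult_left_mono) (auto simp: \<kappa>_const_def)
      then show "Q_const * \<kappa>_const \<le> c / 2" using consts_pos(1) by simp
    qed (use \<rho> V0 in auto)
    finally have "Q_const * V\<^sup>2 / \<rho>\<^sup>2 \<le> c / 2 * (\<rho> ^ 4 * V) / \<rho>\<^sup>2" by (rule divide_right_mono) simp
    also have "\<rho> ^ 4 = \<rho>\<^sup>2 * \<rho>\<^sup>2" by (simp flip: power_add)
    also have "c / 2 * (q * q * V) / q = c / 2 * q * V" if "q \<noteq> 0" for q using that by simp
    then have "c / 2 * (\<rho>\<^sup>2 * \<rho>\<^sup>2 * V) / \<rho>\<^sup>2 = c / 2 * \<rho>\<^sup>2 * V" using \<rho>(1) by (metis power_not_zero less_irrefl)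
    finally show ?thesis .
  qed
  finally have "c / 2 * \<rho>\<^sup>2 * V \<le> (2 * C + Q_const) * \<delta>" by (simp add: algebra_simps)
  then have "V \<le> (2 / c * (2 * C + Q_const)) * \<delta> / \<rho>\<^sup>2"
    using c_pos \<rho>(1) by (simp add: field_simps)
  also have "\<dots> \<le> H_const * \<delta> / \<rho>\<^sup>2"
    using \<delta>_pos by (intro divide_right_mono mult_right_mono) (auto simp: H_const_def)
  finally show ?thesis by (simp add: V_def dist_norm)
qed

definition sep_const :: real where
  "sep_const = (12 * R / \<kappa>_const) ^ 3 * (A * H_const\<^sup>2)"

text \<open>The number of boxes of side \<open>s\<close> is O(\<open>\<rho> powr (-12)\<close>), and
  in each box the points collapse into a ball of mass O(\<open>\<delta> / \<rho> ^ 4\<close>). With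
  \<open>\<delta> = \<rho> ^ 40\<close> this leaves \<open>\<rho> ^ 24\<close>, so the exponent 40
  is generous.\<close>

lemma sep_points_mass:
  assumes \<rho>: "0 < \<rho>" "\<rho> \<le> 1" "\<rho> \<le> \<tau>" and \<delta>: "\<delta> = \<rho> ^ 40"
  shows "sum w (sep_points \<rho> \<tau> a b d) \<le> sep_const * \<rho> powr (t - 1)"
proof -
  \<comment> \<open>A third of the radius in \<open>sep_points_local\<close>, as distances in a box
    are bounded by the sum of three coordinate differences.\<close>
  define s where "s = \<kappa>_const * \<rho> ^ 4 / 3"
  have s: "0 < s" "s \<le> 1"
    using consts_pos(3,4) \<rho> mult_mono[of \<kappa>_const 1 "\<rho> ^ 4" 1] by (auto simp: s_def power_le_one)
  have \<delta>2: "\<delta> \<le> \<rho>\<^sup>2" unfolding \<delta> using \<rho> by (intro power_decreasing) auto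
  define S where "S = sep_points \<rho> \<tau> a b d"
  have SP: "S \<subseteq> P" by (auto simp: S_def sep_points_def)
  define f where "f x = (\<lfloor>x $ 1 / s\<rfloor>, \<lfloor>x $ 2 / s\<rfloor>, \<lfloor>x $ 3 / s\<rfloor>)" for x :: "real ^ 3"
  define I where "I = {\<lfloor>- (R / s)\<rfloor>..\<lfloor>R / s\<rfloor>}"
  define B where "B = A * H_const\<^sup>2 * (\<delta> / \<rho> ^ 4)"
  have "sum w S \<le> real (card (I \<times> I \<times> I)) * B"
  proof (rule sum_le_card_fibres[where f=f])
    show "finite S" using SP finite_P by (rule finite_subset)
    show "finite (I \<times> I \<times> I)" by (simp add: I_def)
    show "0 \<le> B" using A_ge \<delta>_pos \<rho> by (simp add: B_def)
    show "f ` S \<subseteq> I \<times> I \<times> I"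
    proof (rule image_subsetI)
      fix x assume "x \<in> S"
      have "\<lfloor>x $ i / s\<rfloor> \<in> I" for i
      proof -
        have "\<bar>x $ i\<bar> \<le> R" using component_le_norm_cart[of x i] norm_P \<open>x \<in> S\<close> SP by force
        then have "\<bar>x $ i / s\<bar> \<le> R / s" using s by (simp add: divide_right_mono)
        then have "- (R / s) \<le> x $ i / s" "x $ i / s \<le> R / s" by linarith+
        then show ?thesis unfolding I_def atLeastAtMost_iff by (intro conjI floor_mono)
      qed
      then show "f x \<in> I \<times> I \<times> I" by (simp add: f_def)
    qed
    fix x assume x: "x \<in> S"
    have "{y \<in> S. f y = f x} \<subseteq> {p \<in> P. dist x p \<le> H_const * \<delta> / \<rho>\<^sup>2}"
    proof
      fix y assume y: "y \<in> {y \<in> S. f y = f x}"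
      have "\<bar>(x - y) $ i\<bar> \<le> s" for i
      proof -
        have "\<lfloor>x $ i / s\<rfloor> = \<lfloor>y $ i / s\<rfloor>"
          using y exhaust_3[of i] by (auto simp: f_def)
        then have "\<bar>x $ i / s - y $ i / s\<bar> \<le> 1" by linarith
        then have "\<bar>(x $ i - y $ i) / s\<bar> \<le> 1" by (simp add: diff_divide_distrib)
        then show ?thesis using s by (simp add: pos_divide_le_eq)
      qed
      then have "(\<Sum>i\<in>UNIV. \<bar>(x - y) $ i\<bar>) \<le> (\<Sum>i\<in>(UNIV::3 set). s)" by (intro sum_mono)
      then have "dist x y \<le> \<kappa>_const * \<rho> ^ 4"
        using norm_le_l1_cart[of "x - y"] by (simp add: dist_norm s_def)
      then have "dist x y \<le> H_const * \<delta> / \<rho>\<^sup>2"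
        using x y \<rho> \<delta>2 unfolding S_def by (intro sep_points_local[of x \<rho> \<tau> a b d y]) auto
      then show "y \<in> {p \<in> P. dist x p \<le> H_const * \<delta> / \<rho>\<^sup>2}" using y SP by auto
    qed
    then have "sum w {y \<in> S. f y = f x} \<le> sum w {p \<in> P. dist x p \<le> H_const * \<delta> / \<rho>\<^sup>2}"
      by (rule mass_mono) auto
    also have "\<dots> \<le> A * (H_const * \<delta> / \<rho>\<^sup>2) powr t"
    proof (rule frostman)
      have "\<rho>\<^sup>2 \<le> 1" using \<rho> by (simp add: power_le_one)
      then have "1 \<le> H_const / \<rho>\<^sup>2" using consts_pos(2) \<rho>(1) by (simp add: pos_le_divide_eq)
      then have "1 * \<delta> \<le> H_const / \<rho>\<^sup>2 * \<delta>" using \<delta>_pos by (intro mult_right_mono) auto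
      then show "\<delta> \<le> H_const * \<delta> / \<rho>\<^sup>2" by simp
    qed
    also have "\<dots> \<le> A * (H_const\<^sup>2 * (\<delta> / \<rho> ^ 4))"
    proof (rule mult_left_mono)
      have 1: "H_const powr t \<le> H_const\<^sup>2"
        using powr_mono[of t 2 H_const] consts_pos(2) t_le by (simp add: powr_numeral)
      have 2: "\<delta> powr t \<le> \<delta>"
        using powr_mono'[of 1 t \<delta>] \<delta>_pos \<delta>_le t_gt by simp
      have "(\<rho>\<^sup>2) powr 2 \<le> (\<rho>\<^sup>2) powr t"
        using \<rho> t_le by (intro powr_mono') (auto simp: power_le_one)
      then have 3: "\<rho> ^ 4 \<le> (\<rho>\<^sup>2) powr t"
        using \<rho>(1) by (simp add: powr_numeral flip: power_mult)
      have "(H_const * \<delta> / \<rho>\<^sup>2) powr t = H_const powr t * \<delta> powr t / (\<rho>\<^sup>2) powr t"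
        using consts_pos(2) \<delta>_pos \<rho>(1) by (simp add: powr_mult powr_divide)
      also have "\<dots> \<le> H_const\<^sup>2 * \<delta> / \<rho> ^ 4"
        using 1 2 3 \<delta>_pos \<rho>(1) by (intro frac_le mult_mono) auto
      finally show "(H_const * \<delta> / \<rho>\<^sup>2) powr t \<le> H_const\<^sup>2 * (\<delta> / \<rho> ^ 4)" by simp
    qed (use A_ge in auto)
    finally show "sum w {y \<in> S. f y = f x} \<le> B" by (simp add: B_def)
  qed
  also have "real (card (I \<times> I \<times> I)) \<le> (4 * R / s) ^ 3"
  proof -
    have le: "- (R / s) \<le> R / s" using R_ge s by simp
    have "real (card I) = real_of_int (\<lfloor>R / s\<rfloor> - \<lfloor>- (R / s)\<rfloor> + 1)"
      unfolding I_def card_atLeastAtMost_int using floor_mono[OF le] by simp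
    also have "\<dots> \<le> 2 * R / s + 2" by simp linarith
    also have "\<dots> \<le> 4 * R / s" using s R_ge by (simp add: field_simps)
    finally have "real (card I) ^ 3 \<le> (4 * R / s) ^ 3" by (intro power_mono) auto
    then show ?thesis by (simp add: card_cartesian_product power3_eq_cube mult.assoc)
  qed
  then have "real (card (I \<times> I \<times> I)) * B \<le> (4 * R / s) ^ 3 * B"
    using A_ge \<delta>_pos \<rho> by (intro mult_right_mono) (auto simp: B_def)
  also have "\<dots> = sep_const * \<rho> ^ 24"
    unfolding s_def B_def sep_const_def \<delta> using \<rho>(1) consts_pos(3)
    by (simp add: power_mult_distrib power_divide field_simps flip: power_mult power_add)
  also have "\<dots> \<le> sep_const * \<rho> powr (t - 1)"
  proof (rule mult_left_mono)
    have "\<rho> powr 24 \<le> \<rho> powr (t - 1)" using \<rho> t_le by (intro powr_mono') auto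
    then show "\<rho> ^ 24 \<le> \<rho> powr (t - 1)" using \<rho>(1) by (simp add: powr_numeral)
  qed (use A_ge R_ge consts_pos(3) in \<open>auto simp: sep_const_def\<close>)
  finally show ?thesis by (simp add: S_def)
qed


section \<open>From triples of neighbours back to pairs\<close>

definition close_pair :: "real \<Rightarrow> real \<Rightarrow> real ^ 3 \<Rightarrow> real ^ 3 \<Rightarrow> real ^ 3 \<Rightarrow> bool" where
  "close_pair \<rho> \<tau> x a b \<longleftrightarrow> a \<in> nbrs \<tau> x \<and> b \<in> nbrs \<tau> x \<and> \<bar>ang x a - ang x b\<bar> < \<rho>"

lemma close_pair_sum:
  assumes \<rho>: "\<delta> \<le> \<rho>"
  shows "(\<Sum>x\<in>P. \<Sum>a\<in>P. \<Sum>b\<in>P. w x * w a * w b * of_bool (close_pair \<rho> \<tau> x a b))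
    \<le> (sum w P)\<^sup>2 * (close_const * \<rho> powr (t - 1))"
proof -
  let ?B = "close_const * \<rho> powr (t - 1)"
  have B0: "0 \<le> ?B" using A_ge R_ge C_ge by (simp add: close_const_def)
  have "(\<Sum>b\<in>P. w x * w a * w b * of_bool (close_pair \<rho> \<tau> x a b)) \<le> w x * w a * ?B"
    if "x \<in> P" for x a
  proof (cases "a \<in> nbrs \<tau> x")
    case True
    have "(\<Sum>b\<in>P. w x * w a * w b * of_bool (close_pair \<rho> \<tau> x a b))
        = w x * w a * (\<Sum>b\<in>P. if b \<in> {b \<in> nbrs \<tau> x. \<bar>ang x a - ang x b\<bar> < \<rho>} then w b else 0)"
      unfolding sum_distrib_left using True by (intro sum.cong) (auto simp: close_pair_def)
    also have "\<dots> = w x * w a * sum w {b \<in> nbrs \<tau> x. \<bar>ang x a - ang x b\<bar> < \<rho>}"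
    proof -
      have "P \<inter> {b \<in> nbrs \<tau> x. \<bar>ang x a - ang x b\<bar> < \<rho>} = {b \<in> nbrs \<tau> x. \<bar>ang x a - ang x b\<bar> < \<rho>}"
        using nbrs_subset by blast
      then show ?thesis using finite_P by (simp only: sum.inter_restrict[symmetric])
    qed
    also have "\<dots> \<le> w x * w a * ?B"
      using close_angles_mass[OF that True \<rho>] w_nonneg by (intro mult_left_mono) auto
    finally show ?thesis .
  next
    case False
    then have "(\<Sum>b\<in>P. w x * w a * w b * of_bool (close_pair \<rho> \<tau> x a b)) = 0"
      by (simp add: close_pair_def)
    moreover have "0 \<le> w x * w a * ?B" by (rule mult_nonneg_nonneg[OF mult_nonneg_nonneg[OF w_nonneg w_nonneg] B0])
    ultimately show ?thesis by linarith
  qed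
  then have "(\<Sum>x\<in>P. \<Sum>a\<in>P. \<Sum>b\<in>P. w x * w a * w b * of_bool (close_pair \<rho> \<tau> x a b))
      \<le> (\<Sum>x\<in>P. \<Sum>a\<in>P. w x * w a * ?B)"
    by (intro sum_mono) auto
  also have "\<dots> = (\<Sum>x\<in>P. \<Sum>a\<in>P. w x * w a) * ?B"
    by (simp only: sum_distrib_right)
  also have "(\<Sum>x\<in>P. \<Sum>a\<in>P. w x * w a) = (sum w P)\<^sup>2"
    by (simp only: power2_eq_square sum_product)
  finally show ?thesis .
qed

text \<open>The cube counts triples of neighbours of \<open>x\<close>: either all three angles are
  separated, or two are closer than \<open>\<rho>\<close>. Close pairs leave the third point free, a
  factor \<open>sum w P\<close>. Separated triples are summed with \<open>x\<close> innermost, where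
  \<open>sep_points_mass\<close> applies.\<close>

lemma nbrs_triple_sum:
  assumes \<rho>: "0 < \<rho>" "\<rho> \<le> 1" "\<rho> \<le> \<tau>" and \<delta>: "\<delta> = \<rho> ^ 40"
  shows "(\<Sum>x\<in>P. w x * (sum w (nbrs \<tau> x)) ^ 3) \<le> (sum w P) ^ 3 * ((3 * close_const + sep_const) * \<rho> powr (t - 1))"
proof -
  let ?g = "\<rho> powr (t - 1)"
  define W where "W = sum w P"
  have W0: "0 \<le> W" unfolding W_def using w_nonneg by (intro sum_nonneg) auto
  have \<delta>\<rho>: "\<delta> \<le> \<rho>" unfolding \<delta> using \<rho> power_decreasing[of 1 40 \<rho>] by simp
  define N where "N x a b = (of_bool (close_pair \<rho> \<tau> x a b) :: real)" for x a b
  define M where "M x a b d = (of_bool (x \<in> sep_points \<rho> \<tau> a b d) :: real)" for x a b d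
  have T: "(\<Sum>x\<in>P. \<Sum>a\<in>P. \<Sum>b\<in>P. w x * w a * w b * N x a b) \<le> W\<^sup>2 * (close_const * ?g)"
    unfolding W_def N_def by (rule close_pair_sum[OF \<delta>\<rho>])
  have "(\<Sum>x\<in>P. w x * (sum w (nbrs \<tau> x)) ^ 3)
      \<le> (\<Sum>x\<in>P. \<Sum>a\<in>P. \<Sum>b\<in>P. \<Sum>d\<in>P. w x * w a * w b * w d * (M x a b d + N x a b + N x a d + N x b d))"
  proof (rule sum_mono)
    fix x assume x: "x \<in> P"
    have "sum w (nbrs \<tau> x) = (\<Sum>a\<in>P. w a * of_bool (a \<in> nbrs \<tau> x))"
    proof -
      have "P \<inter> nbrs \<tau> x = nbrs \<tau> x" using nbrs_subset by blast
      then show ?thesis using sum.inter_restrict[OF finite_P, of w "nbrs \<tau> x"]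
        by (simp add: of_bool_def if_distrib cong: if_cong)
    qed
    then have "w x * (sum w (nbrs \<tau> x)) ^ 3 = (\<Sum>a\<in>P. \<Sum>b\<in>P. \<Sum>d\<in>P. w x * (w a * of_bool (a \<in> nbrs \<tau> x) *
        (w b * of_bool (b \<in> nbrs \<tau> x) * (w d * of_bool (d \<in> nbrs \<tau> x)))))"
      by (simp only: sum_cube sum_distrib_left mult.assoc)
    also have "\<dots> \<le> (\<Sum>a\<in>P. \<Sum>b\<in>P. \<Sum>d\<in>P. w x * w a * w b * w d * (M x a b d + N x a b + N x a d + N x b d))"
    proof (intro sum_mono)
      fix a b d
      have "of_bool (a \<in> nbrs \<tau> x) * (of_bool (b \<in> nbrs \<tau> x) * of_bool (d \<in> nbrs \<tau> x)) \<le> M x a b d + N x a b + N x a d + N x b d"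
        using x by (auto simp: M_def N_def close_pair_def sep_points_def of_bool_def)
      then have "w x * w a * w b * w d * (of_bool (a \<in> nbrs \<tau> x) * (of_bool (b \<in> nbrs \<tau> x) * of_bool (d \<in> nbrs \<tau> x)))
          \<le> w x * w a * w b * w d * (M x a b d + N x a b + N x a d + N x b d)"
        using w_nonneg by (intro mult_left_mono) auto
      then show "w x * (w a * of_bool (a \<in> nbrs \<tau> x) * (w b * of_bool (b \<in> nbrs \<tau> x) * (w d * of_bool (d \<in> nbrs \<tau> x))))
          \<le> w x * w a * w b * w d * (M x a b d + N x a b + N x a d + N x b d)"
        by (simp only: mult_ac)
    qed
    finally show "w x * (sum w (nbrs \<tau> x)) ^ 3 \<le> (\<Sum>a\<in>P. \<Sum>b\<in>P. \<Sum>d\<in>P. w x * w a * w b * w d * (M x a b d + N x a b + N x a d + N x b d))" .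
  qed
  also have "\<dots> = (\<Sum>x\<in>P. \<Sum>a\<in>P. \<Sum>b\<in>P. \<Sum>d\<in>P. w x * w a * w b * w d * M x a b d)
      + (\<Sum>x\<in>P. \<Sum>a\<in>P. \<Sum>b\<in>P. \<Sum>d\<in>P. w x * w a * w b * w d * N x a b)
      + (\<Sum>x\<in>P. \<Sum>a\<in>P. \<Sum>b\<in>P. \<Sum>d\<in>P. w x * w a * w b * w d * N x a d)
      + (\<Sum>x\<in>P. \<Sum>a\<in>P. \<Sum>b\<in>P. \<Sum>d\<in>P. w x * w a * w b * w d * N x b d)"
    by (simp only: distrib_left sum.distrib)
  also have "(\<Sum>x\<in>P. \<Sum>a\<in>P. \<Sum>b\<in>P. \<Sum>d\<in>P. w x * w a * w b * w d * N x a b)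
      = W * (\<Sum>x\<in>P. \<Sum>a\<in>P. \<Sum>b\<in>P. w x * w a * w b * N x a b)"
    unfolding W_def sum_distrib_left sum_distrib_right by (intro sum.cong refl) (simp only: mult_ac sum_distrib_left)
  also have "(\<Sum>x\<in>P. \<Sum>a\<in>P. \<Sum>b\<in>P. \<Sum>d\<in>P. w x * w a * w b * w d * N x a d)
      = W * (\<Sum>x\<in>P. \<Sum>a\<in>P. \<Sum>b\<in>P. w x * w a * w b * N x a b)"
  proof -
    have "(\<Sum>b\<in>P. \<Sum>d\<in>P. w x * w a * w b * w d * N x a d) = W * (\<Sum>d\<in>P. w x * w a * w d * N x a d)" for x a
      unfolding W_def sum_product by (intro sum.cong refl) (simp only: mult_ac)
    then show ?thesis by (simp only: sum_distrib_left)
  qed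
  also have "(\<Sum>x\<in>P. \<Sum>a\<in>P. \<Sum>b\<in>P. \<Sum>d\<in>P. w x * w a * w b * w d * N x b d)
      = W * (\<Sum>x\<in>P. \<Sum>a\<in>P. \<Sum>b\<in>P. w x * w a * w b * N x a b)"
  proof -
    have "(\<Sum>a\<in>P. \<Sum>b\<in>P. \<Sum>d\<in>P. w x * w a * w b * w d * N x b d) = W * (\<Sum>b\<in>P. \<Sum>d\<in>P. w x * w b * w d * N x b d)" for x
      unfolding W_def sum_product by (intro sum.cong refl) (simp only: mult_ac sum_distrib_left)
    then show ?thesis by (simp only: sum_distrib_left)
  qed
  also have "(\<Sum>x\<in>P. \<Sum>a\<in>P. \<Sum>b\<in>P. \<Sum>d\<in>P. w x * w a * w b * w d * M x a b d)
      = (\<Sum>a\<in>P. \<Sum>b\<in>P. \<Sum>d\<in>P. w a * w b * w d * (\<Sum>x\<in>P. w x * M x a b d))"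
  proof -
    let ?h = "\<lambda>x a b d. w x * w a * w b * w d * M x a b d"
    have "(\<Sum>x\<in>P. \<Sum>a\<in>P. \<Sum>b\<in>P. \<Sum>d\<in>P. ?h x a b d) = (\<Sum>a\<in>P. \<Sum>x\<in>P. \<Sum>b\<in>P. \<Sum>d\<in>P. ?h x a b d)"
      by (rule sum.swap)
    also have "\<dots> = (\<Sum>a\<in>P. \<Sum>b\<in>P. \<Sum>x\<in>P. \<Sum>d\<in>P. ?h x a b d)"
      by (rule sum.cong[OF refl], rule sum.swap)
    also have "\<dots> = (\<Sum>a\<in>P. \<Sum>b\<in>P. \<Sum>d\<in>P. \<Sum>x\<in>P. ?h x a b d)"
      by (rule sum.cong[OF refl], rule sum.cong[OF refl], rule sum.swap)
    finally have "(\<Sum>x\<in>P. \<Sum>a\<in>P. \<Sum>b\<in>P. \<Sum>d\<in>P. ?h x a b d) = (\<Sum>a\<in>P. \<Sum>b\<in>P. \<Sum>d\<in>P. \<Sum>x\<in>P. ?h x a b d)" .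
    then show ?thesis by (simp only: sum_distrib_left mult_ac)
  qed
  also have "\<dots> \<le> (\<Sum>a\<in>P. \<Sum>b\<in>P. \<Sum>d\<in>P. w a * w b * w d * (sep_const * ?g))"
  proof (intro sum_mono mult_left_mono)
    fix a b d
    have "P \<inter> sep_points \<rho> \<tau> a b d = sep_points \<rho> \<tau> a b d" by (auto simp: sep_points_def)
    then have "(\<Sum>x\<in>P. w x * M x a b d) = sum w (sep_points \<rho> \<tau> a b d)"
      using sum.inter_restrict[OF finite_P, of w "sep_points \<rho> \<tau> a b d"]
      by (simp add: M_def of_bool_def if_distrib cong: if_cong)
    also have "\<dots> \<le> sep_const * ?g" using \<rho> \<delta> by (rule sep_points_mass)
    finally show "(\<Sum>x\<in>P. w x * M x a b d) \<le> sep_const * ?g" .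
  qed (use w_nonneg in auto)
  also have "\<dots> = W ^ 3 * (sep_const * ?g)"
    by (simp only: W_def sum_cube sum_distrib_right mult.assoc)
  also have "W ^ 3 * (sep_const * ?g) + W * (\<Sum>x\<in>P. \<Sum>a\<in>P. \<Sum>b\<in>P. w x * w a * w b * N x a b)
        + W * (\<Sum>x\<in>P. \<Sum>a\<in>P. \<Sum>b\<in>P. w x * w a * w b * N x a b)
        + W * (\<Sum>x\<in>P. \<Sum>a\<in>P. \<Sum>b\<in>P. w x * w a * w b * N x a b)
      \<le> W ^ 3 * (sep_const * ?g) + W * (W\<^sup>2 * (close_const * ?g)) + W * (W\<^sup>2 * (close_const * ?g)) + W * (W\<^sup>2 * (close_const * ?g))"
    using mult_left_mono[OF T W0] by (intro add_mono order_refl)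
  also have "\<dots> = W ^ 3 * ((3 * close_const + sep_const) * ?g)"
    by (simp add: power2_eq_square power3_eq_cube algebra_simps)
  finally show ?thesis by (simp add: W_def)
qed


definition far_const :: real where
  "far_const = A * R\<^sup>2 + (A * R\<^sup>2) ^ 3 * (3 * close_const + sep_const)"

lemma sep_const_nonneg: "0 \<le> sep_const" and close_const_nonneg: "0 \<le> close_const"
  using A_ge R_ge C_ge consts_pos(3) by (simp_all add: sep_const_def close_const_def)

text \<open>A weighted sum of cubes of order \<open>\<beta> ^ 3 = \<rho> powr (t - 1)\<close> gives
  order \<open>\<beta>\<close> for first powers, whence the division of the exponent by 3.\<close>

lemma far_pairs:
  assumes \<rho>: "0 < \<rho>" "\<rho> \<le> 1" "\<rho> \<le> \<tau>" and \<delta>: "\<delta> = \<rho> ^ 40"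
  shows "(\<Sum>x\<in>P. w x * sum w (nbrs \<tau> x)) \<le> far_const * \<rho> powr ((t - 1) / 3)"
proof -
  define \<beta> where "\<beta> = \<rho> powr ((t - 1) / 3)"
  define W where "W = sum w P"
  define K where "K = 3 * close_const + sep_const"
  have K0: "0 \<le> K" using sep_const_nonneg close_const_nonneg by (simp add: K_def)
  have W: "0 \<le> W" "W \<le> A * R\<^sup>2"
    using w_nonneg mass_P_le by (auto simp: W_def intro: sum_nonneg)
  have \<beta>: "0 < \<beta>" using \<rho> by (simp add: \<beta>_def)
  have \<beta>3: "\<rho> powr (t - 1) = \<beta> ^ 3"
  proof -
    have "\<beta> ^ 3 = \<beta> powr 3" using \<beta> by (simp add: powr_numeral)
    also have "\<dots> = \<rho> powr ((t - 1) / 3 * 3)" by (simp only: \<beta>_def powr_powr)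
    also have "(t - 1) / 3 * 3 = t - 1" by simp
    finally show ?thesis ..
  qed
  text \<open>A substitute for the power mean inequality.\<close>
  have cube: "m \<le> \<beta> + m ^ 3 / \<beta>\<^sup>2" if m: "0 \<le> m" for m
  proof (cases "m \<le> \<beta>")
    case True
    have "0 \<le> m ^ 3 / \<beta>\<^sup>2" using m by simp
    then show ?thesis using True by linarith
  next
    case False
    then have "\<beta>\<^sup>2 \<le> m\<^sup>2" using \<beta> by (intro power_mono) auto
    then have "m * \<beta>\<^sup>2 \<le> m * m\<^sup>2" using m by (rule mult_left_mono)
    then have "m \<le> m ^ 3 / \<beta>\<^sup>2" using \<beta> by (simp add: pos_le_divide_eq power2_eq_square power3_eq_cube)
    then show ?thesis using \<beta> by linarith
  qed
  have "(\<Sum>x\<in>P. w x * sum w (nbrs \<tau> x)) \<le> (\<Sum>x\<in>P. w x * (\<beta> + (sum w (nbrs \<tau> x)) ^ 3 / \<beta>\<^sup>2))"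
    using w_nonneg by (intro sum_mono mult_left_mono cube sum_nonneg) auto
  also have "\<dots> = W * \<beta> + (\<Sum>x\<in>P. w x * (sum w (nbrs \<tau> x)) ^ 3) / \<beta>\<^sup>2"
    by (simp add: W_def distrib_left sum.distrib sum_distrib_right sum_divide_distrib)
  also have "\<dots> \<le> W * \<beta> + (W ^ 3 * (K * \<beta> ^ 3)) / \<beta>\<^sup>2"
    using nbrs_triple_sum[OF \<rho> \<delta>] \<beta> by (intro add_left_mono divide_right_mono) (auto simp: W_def K_def \<beta>3)
  also have "\<dots> = (W + W ^ 3 * K) * \<beta>"
    using \<beta> by (simp add: power2_eq_square power3_eq_cube algebra_simps)
  also have "\<dots> \<le> (A * R\<^sup>2 + (A * R\<^sup>2) ^ 3 * K) * \<beta>"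
    using W K0 \<beta> by (intro mult_right_mono add_mono power_mono) auto
  finally show ?thesis by (simp add: far_const_def K_def \<beta>_def)
qed

definition pair_const :: real where
  "pair_const = A * R\<^sup>2 * near_const + 12 / c * far_const"

text \<open>The extra power of \<open>\<delta>\<close> is what lifts the dimension above 1. Near
  pairs gain \<open>\<tau> powr (t - 1)\<close>, that is \<open>\<rho>\<close> to the power
  \<open>(t - 1)\<^sup>2 / 6\<close>; as \<open>\<delta> = \<rho> ^ 40\<close>, the denominator
  becomes 240.\<close>

lemma pair_estimate:
  "(\<Sum>x\<in>P. \<Sum>y\<in>P. w x * w y * measure lebesgue (angles \<delta> (x - y))) \<le> pair_const * \<delta> * \<delta> powr ((t - 1)\<^sup>2 / 240)"
proof -
  text \<open>
    The gain \<open>\<rho> powr ((t - 1) / 3)\<close> of the far pairs has to beat the loss \<open>1 / \<tau>\<close>, so the threshold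
    \<open>\<tau>\<close> between near and far is a small power of the separation \<open>\<rho>\<close> of the angles.
  \<close>
  define \<rho> where "\<rho> = \<delta> powr (1 / 40)"
  define \<tau> where "\<tau> = \<rho> powr ((t - 1) / 6)"
  define L where "L x y = measure lebesgue (angles \<delta> (x - y))" for x y
  have \<rho>0: "0 < \<rho>" using \<delta>_pos by (simp add: \<rho>_def)
  have \<rho>1: "\<rho> \<le> 1" using \<delta>_pos \<delta>_le by (simp add: \<rho>_def powr_le1)
  have \<delta>: "\<delta> = \<rho> ^ 40"
  proof -
    have "\<rho> ^ 40 = \<rho> powr 40" using \<rho>0 by (simp add: powr_numeral)
    then show ?thesis using \<delta>_pos by (simp add: \<rho>_def powr_powr)
  qed
  have \<rho>\<tau>: "\<rho> \<le> \<tau>"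
    using powr_mono'[of "(t - 1) / 6" 1 \<rho>] \<rho>0 \<rho>1 t_le by (simp add: \<tau>_def)
  have \<delta>\<tau>: "\<delta> \<le> \<tau>"
    using power_decreasing[of 1 40 \<rho>] \<rho>0 \<rho>1 \<rho>\<tau> \<delta> by simp
  have \<tau>0: "0 < \<tau>" using \<rho>0 \<rho>\<tau> by linarith
  let ?g = "\<delta> powr ((t - 1)\<^sup>2 / 240)"
  have g: "?g = \<rho> powr ((t - 1)\<^sup>2 / 6)" using \<delta>_pos by (simp add: \<rho>_def powr_powr)
  have "\<tau> powr (t - 1) = \<rho> powr ((t - 1) / 6 * (t - 1))" by (simp only: \<tau>_def powr_powr)
  also have "(t - 1) / 6 * (t - 1) = (t - 1)\<^sup>2 / 6" by (simp add: power2_eq_square)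
  finally have g1: "\<tau> powr (t - 1) = ?g" unfolding g .
  have g2: "\<rho> powr ((t - 1) / 3) / \<tau> \<le> ?g"
  proof -
    \<comment> \<open>Far pairs retain \<open>\<rho> powr ((t - 1) / 6)\<close>, no worse than the
      gain of the near pairs because \<open>t - 1 \<le> 1\<close>.\<close>
    have "(t - 1)\<^sup>2 \<le> t - 1" using t_gt t_le by (simp add: power2_eq_square mult_left_le)
    then have "\<rho> powr ((t - 1) / 6) \<le> ?g" unfolding g using \<rho>0 \<rho>1 by (intro powr_mono') auto
    moreover have "\<rho> powr ((t - 1) / 3) / \<tau> = \<rho> powr ((t - 1) / 6)"
      unfolding \<tau>_def powr_diff[symmetric] by (rule arg_cong[where f="\<lambda>s. \<rho> powr s"]) simp
    ultimately show ?thesis by simp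
  qed
  have near0: "0 \<le> near_const"
  proof -
    have "(2::real) powr (1 - t) < 1" using t_gt by (simp add: powr_less_one)
    then show ?thesis using A_ge c_pos by (simp add: near_const_def)
  qed
  have inner: "(\<Sum>y\<in>P. w y * L x y) \<le> near_const * \<delta> * ?g + 12 / c * \<delta> / \<tau> * sum w (nbrs \<tau> x)" for x
  proof -
    let ?N = "{y \<in> P. dist x y \<le> \<tau>}"
    have "(\<Sum>y\<in>P. w y * L x y) = (\<Sum>y\<in>?N. w y * L x y) + (\<Sum>y\<in>P - ?N. w y * L x y)"
      using finite_P sum.subset_diff[of ?N P "\<lambda>y. w y * L x y"] by simp
    also have "(\<Sum>y\<in>?N. w y * L x y) \<le> near_const * \<delta> * ?g"
      using near_sum[OF \<delta>\<tau>] unfolding L_def g1 .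
    also have "(\<Sum>y\<in>P - ?N. w y * L x y) = (\<Sum>y\<in>(P - ?N) \<inter> nbrs \<tau> x. w y * L x y)"
    proof (rule sum.mono_neutral_right)
      show "\<forall>y\<in>P - ?N - (P - ?N) \<inter> nbrs \<tau> x. w y * L x y = 0"
      proof
        fix y assume "y \<in> P - ?N - (P - ?N) \<inter> nbrs \<tau> x"
        then have "angles \<delta> (x - y) = {}" by (auto simp: nbrs_def)
        then show "w y * L x y = 0" by (simp add: L_def)
      qed
    qed (use finite_P in auto)
    also have "\<dots> \<le> (\<Sum>y\<in>(P - ?N) \<inter> nbrs \<tau> x. w y * (12 / c * \<delta> / \<tau>))"
    proof (intro sum_mono mult_left_mono w_nonneg)
      fix y assume "y \<in> (P - ?N) \<inter> nbrs \<tau> x"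
      then have y: "\<tau> \<le> norm (x - y)" by (auto simp: nbrs_def dist_norm)
      then have "x - y \<noteq> 0" using \<tau>0 by auto
      then have "L x y \<le> 12 / c * \<delta> / norm (x - y)"
        unfolding L_def using \<delta>_pos by (intro measure_angles_le) auto
      also have "\<dots> \<le> 12 / c * \<delta> / \<tau>"
        using y \<tau>0 c_pos \<delta>_pos by (intro divide_left_mono mult_pos_pos) auto
      finally show "L x y \<le> 12 / c * \<delta> / \<tau>" .
    qed
    also have "\<dots> = sum w ((P - ?N) \<inter> nbrs \<tau> x) * (12 / c * \<delta> / \<tau>)"
      by (rule sum_distrib_right[symmetric])
    also have "\<dots> \<le> sum w (nbrs \<tau> x) * (12 / c * \<delta> / \<tau>)"
      using nbrs_subset c_pos \<delta>_pos \<tau>0 by (intro mult_right_mono mass_mono) auto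
    finally show ?thesis by (simp add: mult.commute)
  qed
  have "(\<Sum>x\<in>P. \<Sum>y\<in>P. w x * w y * L x y) = (\<Sum>x\<in>P. w x * (\<Sum>y\<in>P. w y * L x y))"
    by (simp add: sum_distrib_left mult.assoc)
  also have "\<dots> \<le> (\<Sum>x\<in>P. w x * (near_const * \<delta> * ?g + 12 / c * \<delta> / \<tau> * sum w (nbrs \<tau> x)))"
    by (intro sum_mono mult_left_mono inner w_nonneg)
  also have "\<dots> = sum w P * (near_const * \<delta> * ?g) + 12 / c * \<delta> / \<tau> * (\<Sum>x\<in>P. w x * sum w (nbrs \<tau> x))"
    unfolding distrib_left sum.distrib sum_distrib_right sum_distrib_left
    by (intro arg_cong2[where f="(+)"] sum.cong refl) (simp only: mult_ac)
  also have "\<dots> \<le> (A * R\<^sup>2) * (near_const * \<delta> * ?g) + 12 / c * \<delta> / \<tau> * (far_const * \<rho> powr ((t - 1) / 3))"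
    using near0 \<delta>_pos c_pos \<tau>0
    by (intro add_mono mult_right_mono[OF mass_P_le] mult_left_mono[OF far_pairs[OF \<rho>0 \<rho>1 \<rho>\<tau> \<delta>]] mult_nonneg_nonneg) auto
  also have "12 / c * \<delta> / \<tau> * (far_const * \<rho> powr ((t - 1) / 3)) = 12 / c * far_const * \<delta> * (\<rho> powr ((t - 1) / 3) / \<tau>)"
    by simp
  also have "\<dots> \<le> 12 / c * far_const * \<delta> * ?g"
    using sep_const_nonneg close_const_nonneg A_ge R_ge c_pos \<delta>_pos
    by (intro mult_left_mono[OF g2] mult_nonneg_nonneg) (auto simp: far_const_def)
  finally show ?thesis
    unfolding L_def pair_const_def by (simp add: algebra_simps)
qed

end

section \<open>Dimension of the projections\<close>

lemma hausdorff_premeasure_mono: "A \<subseteq> B \<Longrightarrow> hausdorff_premeasure s \<delta> A \<le> hausdorff_premeasure s \<delta> B"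
  unfolding hausdorff_premeasure_def by (rule Inf_superset_mono) blast

lemma hausdorff_dim_mono:
  assumes "A \<subseteq> B"
  shows "hausdorff_dim A \<le> hausdorff_dim B"
proof -
  have "hausdorff_measure s A \<le> hausdorff_measure s B" for s
    unfolding hausdorff_measure_def by (rule SUP_mono') (rule hausdorff_premeasure_mono[OF assms])
  then have "hausdorff_measure s A = 0" if "hausdorff_measure s B = 0" for s
    using that by (metis le_zero_eq)
  then show ?thesis
    unfolding hausdorff_dim_def by (intro Inf_superset_mono) blast
qed

lemma orth_proj_orthogonal_comp_span:
  assumes "norm e = 1"
  shows "orth_proj ((span {e})\<^sup>\<bottom>) x = perp e x"
  unfolding orth_proj_def
proof (rule the_equality)
  have ee: "e \<bullet> e = 1" using assms by (simp add: norm_eq_1)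
  have p: "y \<in> (span {e})\<^sup>\<bottom> \<longleftrightarrow> e \<bullet> y = 0" for y
    by (auto simp: orthogonal_comp_def orthogonal_def span_singleton)
  have pp: "perp e x \<in> (span {e})\<^sup>\<bottom>" for x
    unfolding p using ee by (simp add: perp_def inner_diff_right inner_commute)
  have d: "x - perp e x = (x \<bullet> e) *\<^sub>R e" by (simp add: perp_def)
  show 1: "perp e x \<in> (span {e})\<^sup>\<bottom> \<and> x - perp e x \<in> (span {e})\<^sup>\<bottom>\<^sup>\<bottom>"
    using pp unfolding d by (auto simp: p orthogonal_comp_def[of "(span {e})\<^sup>\<bottom>"] orthogonal_def inner_commute)
  fix y assume y: "y \<in> (span {e})\<^sup>\<bottom> \<and> x - y \<in> (span {e})\<^sup>\<bottom>\<^sup>\<bottom>"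
  have "perp e x - y \<in> (span {e})\<^sup>\<bottom>"
    using pp[of x] y unfolding p by (simp add: inner_diff_right)
  moreover have "perp e x - y \<in> (span {e})\<^sup>\<bottom>\<^sup>\<bottom>"
  proof -
    have "(x - y) - (x - perp e x) \<in> (span {e})\<^sup>\<bottom>\<^sup>\<bottom>"
      by (rule subspace_diff[OF subspace_orthogonal_comp conjunct2[OF y] conjunct2[OF 1]])
    then show ?thesis by simp
  qed
  ultimately have "orthogonal (perp e x - y) (perp e x - y)"
    unfolding orthogonal_comp_def[of "(span {e})\<^sup>\<bottom>"] by blast
  then show "y = perp e x" by (simp add: orthogonal_self)
qed

text \<open>The covering sets are thickened to open balls, so that compactness leaves finitely many,
  and the radii are rounded to dyadic ones to match the levels of the energy. Pulling the balls back
  along \<open>g\<close> puts compactness of \<open>K\<close> itself to use.\<close>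

lemma hausdorff_dim_less_imp_finite_cover:
  fixes g :: "'a::metric_space \<Rightarrow> 'b::metric_space"
  assumes dim: "hausdorff_dim (g ` K) < ennreal \<sigma>" and K: "compact K" and g: "continuous_on UNIV g"
    and \<sigma>: "0 < \<sigma>" "\<sigma> \<le> 2" and e: "0 < e" "e \<le> 1"
  shows "\<exists>(I :: nat set) z k. finite I \<and> (\<forall>p\<in>K. \<exists>i\<in>I. dist (g p) (z i) < (1/2) ^ k i / 2) \<and>
    (\<Sum>i\<in>I. ((1/2) ^ k i) powr \<sigma>) \<le> 32 * e"
proof -
  \<comment> \<open>With \<open>e' \<le> 1/16\<close> every \<open>D i powr \<sigma>\<close> is at
    most \<open>1/8\<close>, below \<open>(1/2) powr \<sigma>\<close>; so
    \<open>2 * D i < 1\<close>, and a dyadic level exists.\<close>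
  define e' where "e' = e / 16"
  have e': "0 < e'" "e' \<le> 1/16" using e by (auto simp: e'_def)
  obtain s where s: "0 \<le> s" "hausdorff_measure s (g ` K) = 0" "ennreal s < ennreal \<sigma>"
    using dim unfolding hausdorff_dim_def Inf_less_iff by blast
  have s\<sigma>: "s < \<sigma>" using s by (simp add: ennreal_less_iff)
  have "hausdorff_premeasure s 1 (g ` K) \<le> hausdorff_measure s (g ` K)"
    unfolding hausdorff_measure_def by (rule SUP_upper) simp
  then have "hausdorff_premeasure s 1 (g ` K) < ennreal e'" using s(2) e' by simp
  then obtain U where U: "g ` K \<subseteq> (\<Union>i. U i)" "\<And>i. bounded (U i)" "\<And>i. diameter (U i) \<le> 1"
    and Us: "(\<Sum>i. diam_powr s (U i)) < ennreal e'"
    unfolding hausdorff_premeasure_def Inf_less_iff by blast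
  define I0 where "I0 = {i. U i \<noteq> {}}"
  have dge: "0 \<le> diameter (U i)" for i using U(2) by (rule diameter_ge_0)
  have dp: "ennreal (diameter (U i) powr \<sigma>) \<le> diam_powr s (U i)" if i: "i \<in> I0" for i
  proof (cases "s = 0")
    case True
    have "diameter (U i) powr \<sigma> \<le> 1" using dge U(3) \<sigma> by (intro powr_le1) auto
    then show ?thesis using True i by (simp add: diam_powr_def I0_def)
  next
    case False
    have "diameter (U i) powr \<sigma> \<le> diameter (U i) powr s"
    proof (cases "diameter (U i) = 0")
      case False
      then show ?thesis using dge[of i] U(3)[of i] s\<sigma> by (intro powr_mono') auto
    qed simp
    then show ?thesis using False i by (simp add: diam_powr_def I0_def ennreal_leI)
  qed
  define h where "h i = diameter (U i) powr \<sigma>" for i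
  \<comment> \<open>A strict enlargement of the diameter, by an amount that is summable after
    raising to the power \<open>\<sigma>\<close>; it gives singletons a positive radius.\<close>
  define D where "D i = (h i + e' * (1/2) ^ Suc i) powr (1 / \<sigma>)" for i
  have fin_sum: "(\<Sum>i\<in>I. h i) \<le> e'" if "finite I" "I \<subseteq> I0" for I
  proof -
    have "ennreal (\<Sum>i\<in>I. h i) = (\<Sum>i\<in>I. ennreal (h i))"
      by (intro sum_ennreal[symmetric]) (simp add: h_def)
    also have "\<dots> \<le> (\<Sum>i\<in>I. diam_powr s (U i))"
      using dp that unfolding h_def by (intro sum_mono) auto
    also have "\<dots> \<le> (\<Sum>i. diam_powr s (U i))"
      using that(1) by (intro sum_le_suminf) auto
    also note Us
    finally show ?thesis using e' by (simp add: ennreal_less_iff h_def sum_nonneg)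
  qed
  have D: "diameter (U i) < D i" "0 < D i" "D i powr \<sigma> = h i + e' * (1/2) ^ Suc i" "2 * D i < 1" if i: "i \<in> I0" for i
  proof -
    have h0: "0 \<le> h i" by (simp add: h_def)
    have pos: "0 < e' * (1/2) ^ Suc i" using e' by simp
    then have pos': "0 < h i + e' * (1/2) ^ Suc i" using h0 by linarith
    then show D0: "0 < D i" by (simp add: D_def)
    show eq: "D i powr \<sigma> = h i + e' * (1/2) ^ Suc i"
      using \<sigma> pos' by (simp add: D_def powr_powr)
    show "diameter (U i) < D i"
    proof (rule ccontr)
      assume "\<not> diameter (U i) < D i"
      then have "D i powr \<sigma> \<le> h i" unfolding h_def using D0 \<sigma> by (intro powr_mono2) auto
      then show False using eq pos by linarith
    qed
    have "h i \<le> e'" using fin_sum[of "{i}"] i by simp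
    moreover have "e' * (1/2) ^ Suc i \<le> e' * 1" using e' by (intro mult_left_mono power_le_one) auto
    ultimately have "D i powr \<sigma> \<le> 1/8" using eq e' by linarith
    show "2 * D i < 1"
    proof (rule ccontr)
      assume "\<not> 2 * D i < 1"
      then have "(1/2) powr \<sigma> \<le> D i powr \<sigma>" using \<sigma> by (intro powr_mono2) auto
      moreover have "(1/2) powr 2 \<le> (1/2::real) powr \<sigma>" using \<sigma> by (intro powr_mono') auto
      moreover have "(1/2::real) powr 2 = 1/4" by (simp add: powr_numeral power2_eq_square)
      ultimately show False using \<open>D i powr \<sigma> \<le> 1/8\<close> by linarith
    qed
  qed
  have "\<exists>k. 2 * D i < (1/2) ^ k \<and> (1/2) ^ k \<le> 4 * D i" if i: "i \<in> I0" for i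
  proof -
    obtain n where "(1/2) ^ n < 2 * D i" using real_arch_pow_inv[of "2 * D i" "1/2"] D(2)[OF i] by auto
    then show ?thesis using dyadic_scale[of n "2 * D i"] D(4)[OF i] by auto
  qed
  then obtain k where k: "\<And>i. i \<in> I0 \<Longrightarrow> 2 * D i < (1/2) ^ k i" "\<And>i. i \<in> I0 \<Longrightarrow> (1/2) ^ k i \<le> 4 * D i"
    by metis
  define z where "z i = (SOME y. y \<in> U i)" for i
  have z: "z i \<in> U i" if "i \<in> I0" for i
    using that unfolding z_def I0_def by (auto intro: someI_ex)
  define V where "V i = g -` ball (z i) (D i)" for i
  have "open (V i)" for i
    unfolding V_def using g by (simp add: continuous_on_open_vimage)
  moreover have "K \<subseteq> (\<Union>i\<in>I0. V i)"
  proof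
    fix p assume "p \<in> K"
    then obtain i where i: "g p \<in> U i" using U(1) by blast
    then have "i \<in> I0" by (auto simp: I0_def)
    have "dist (z i) (g p) \<le> diameter (U i)"
      using z[OF \<open>i \<in> I0\<close>] i U(2) by (intro diameter_bounded_bound)
    then have "p \<in> V i" using D(1)[OF \<open>i \<in> I0\<close>] by (simp add: V_def)
    then show "p \<in> (\<Union>i\<in>I0. V i)" using \<open>i \<in> I0\<close> by blast
  qed
  ultimately obtain I where I: "I \<subseteq> I0" "finite I" "K \<subseteq> (\<Union>i\<in>I. V i)"
    using compactE_image[OF K, of I0 V] by metis
  have "\<forall>p\<in>K. \<exists>i\<in>I. dist (g p) (z i) < (1/2) ^ k i / 2"
  proof
    fix p assume "p \<in> K"
    then obtain i where i: "i \<in> I" "p \<in> V i" using I(3) by blast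
    then have "dist (g p) (z i) < D i" by (simp add: V_def dist_commute)
    also have "\<dots> < (1/2) ^ k i / 2" using k(1)[of i] i I(1) by auto
    finally show "\<exists>i\<in>I. dist (g p) (z i) < (1/2) ^ k i / 2" using i(1) by blast
  qed
  moreover have "(\<Sum>i\<in>I. ((1/2) ^ k i) powr \<sigma>) \<le> 32 * e"
  proof -
    have "(\<Sum>i\<in>I. ((1/2) ^ k i) powr \<sigma>) \<le> (\<Sum>i\<in>I. 16 * (h i + e' * (1/2) ^ Suc i))"
    proof (rule sum_mono)
      fix i assume "i \<in> I"
      then have i: "i \<in> I0" using I(1) by blast
      have "((1/2) ^ k i) powr \<sigma> \<le> (4 * D i) powr \<sigma>" using k(2)[OF i] \<sigma> by (intro powr_mono2) auto
      also have "\<dots> = 4 powr \<sigma> * D i powr \<sigma>" using D(2)[OF i] by (simp add: powr_mult)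
      also have "\<dots> \<le> 16 * D i powr \<sigma>"
      proof (rule mult_right_mono)
        have "(4::real) powr \<sigma> \<le> 4 powr 2" using \<sigma> by (intro powr_mono) auto
        then show "(4::real) powr \<sigma> \<le> 16" by (simp add: powr_numeral)
      qed simp
      finally show "((1/2) ^ k i) powr \<sigma> \<le> 16 * (h i + e' * (1/2) ^ Suc i)" unfolding D(3)[OF i] .
    qed
    also have "\<dots> = 16 * ((\<Sum>i\<in>I. h i) + e' * (\<Sum>i\<in>I. (1/2) ^ Suc i))"
      by (simp only: sum_distrib_left sum.distrib[symmetric] distrib_left)
    also have "(\<Sum>i\<in>I. (1/2) ^ Suc i) \<le> (1::real)"
      using sum_le_suminf[of "\<lambda>i. (1/2::real) ^ Suc i" I] I(2) power_half_series by (simp add: sums_iff)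
    then have "16 * ((\<Sum>i\<in>I. h i) + e' * (\<Sum>i\<in>I. (1/2) ^ Suc i)) \<le> 16 * (e' + e' * 1)"
      using fin_sum[OF I(2,1)] e' by (intro mult_left_mono add_mono) auto
    also have "\<dots> \<le> 32 * e" using e by (simp add: e'_def)
    finally show ?thesis .
  qed
  ultimately show ?thesis using I(2) by blast
qed

section \<open>Energy across scales and its integral over the angle\<close>

context curve_arc
begin

text \<open>A Riesz energy of the projected weights, cut off at scale \<open>(1/2) ^ n\<close>:
  summing \<open>2 powr (k * \<sigma>)\<close> over the dyadic scales above a distance reproduces
  that distance to the power \<open>- \<sigma>\<close>, up to constants.\<close>

definition scale_energy :: "real \<Rightarrow> nat \<Rightarrow> (real ^ 3) set \<Rightarrow> (real ^ 3 \<Rightarrow> real) \<Rightarrow> real \<Rightarrow> real" where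
  "scale_energy \<sigma> n P w \<theta> = (\<Sum>k\<le>n. \<Sum>x\<in>P. \<Sum>y\<in>P.
     w x * w y / ((1/2) ^ k) powr \<sigma> * indicator (angles ((1/2) ^ k) (x - y)) \<theta>)"

lemma scale_energy_nonneg: "(\<And>x. 0 \<le> w x) \<Longrightarrow> 0 \<le> scale_energy \<sigma> n P w \<theta>"
  unfolding scale_energy_def by (intro sum_nonneg mult_nonneg_nonneg divide_nonneg_nonneg) auto

lemma integrable_scale_energy: "integrable lebesgue (scale_energy \<sigma> n P w)"
  and integral_scale_energy: "integral\<^sup>L lebesgue (scale_energy \<sigma> n P w) =
    (\<Sum>k\<le>n. (\<Sum>x\<in>P. \<Sum>y\<in>P. w x * w y * measure lebesgue (angles ((1/2) ^ k) (x - y))) / ((1/2) ^ k) powr \<sigma>)"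
proof -
  have i: "integrable lebesgue (\<lambda>\<theta>. a * indicator (angles d x) \<theta> :: real)" for a d x
    using lmeasurable_angles[of d x] by (intro integrable_mult_right integrable_real_indicator) (auto simp: fmeasurable_def)
  have m: "(LINT \<theta>|lebesgue. a / b * indicator (angles d x) \<theta>) = a * measure lebesgue (angles d x) / b" for a b d x
    by simp
  show "integrable lebesgue (scale_energy \<sigma> n P w)"
    unfolding scale_energy_def[abs_def] by (intro Bochner_Integration.integrable_sum i)
  show "integral\<^sup>L lebesgue (scale_energy \<sigma> n P w) =
    (\<Sum>k\<le>n. (\<Sum>x\<in>P. \<Sum>y\<in>P. w x * w y * measure lebesgue (angles ((1/2) ^ k) (x - y))) / ((1/2) ^ k) powr \<sigma>)"
    unfolding scale_energy_def[abs_def] sum_divide_distrib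
    by (simp only: Bochner_Integration.integral_sum Bochner_Integration.integrable_sum i m)
qed

text \<open>Points assigned to the same ball have projections within \<open>(1/2) ^ k i\<close> of
  each other, hence the half in the radius, and their pairs count at level \<open>k i\<close>. So
  the energy dominates the sum of squared masses over gauges, to which Cauchy-Schwarz
  applies.\<close>

lemma scale_energy_lower_bound:
  assumes \<theta>: "\<theta> \<in> {l..u}" and P: "finite P" and w: "\<And>x. 0 \<le> w x" "1 \<le> sum w P"
    and I: "finite I" "\<And>i. i \<in> I \<Longrightarrow> k i \<le> n"
    and cover: "\<And>p. p \<in> P \<Longrightarrow> \<exists>i\<in>I. dist (perp (\<gamma> \<theta>) p) (z i) < (1/2) ^ k i / 2"
    and small: "(\<Sum>i\<in>I. ((1/2) ^ k i) powr \<sigma>) \<le> e" and e: "0 < e"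
  shows "1 / e \<le> scale_energy \<sigma> n P w \<theta>"
proof -
  obtain f where f: "\<And>p. p \<in> P \<Longrightarrow> f p \<in> I" "\<And>p. p \<in> P \<Longrightarrow> dist (perp (\<gamma> \<theta>) p) (z (f p)) < (1/2) ^ k (f p) / 2"
    using cover by metis
  define b where "b i = ((1/2) ^ k i) powr \<sigma>" for i
  define a where "a i = sum w {p \<in> P. f p = i}" for i
  have b0: "0 < b i" for i by (simp add: b_def)
  have "(\<Sum>i\<in>I. a i) = sum w P"
    unfolding a_def using P I(1) f(1) by (intro sum.group) auto
  \<comment> \<open>Cauchy-Schwarz by completing the square, in a form linear in \<open>a i\<close>
    and \<open>b i\<close>; the parameter \<open>e\<close> is optimal when the masses add up to 1
    and the gauges to \<open>e\<close>.\<close>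
  have am: "2 / e * a i - b i / e\<^sup>2 \<le> a i * a i / b i" for i
  proof -
    have "0 \<le> (a i - b i / e)\<^sup>2 / b i" using b0[of i] by simp
    also have "\<dots> = a i * a i / b i - 2 / e * a i + b i / e\<^sup>2"
      using b0[of i] e by (simp add: power2_eq_square field_simps)
    finally show ?thesis by linarith
  qed
  have "2 / e * 1 - e / e\<^sup>2 \<le> 2 / e * (\<Sum>i\<in>I. a i) - (\<Sum>i\<in>I. b i) / e\<^sup>2"
    using w(2) small e unfolding \<open>(\<Sum>i\<in>I. a i) = sum w P\<close> b_def
    by (intro diff_mono mult_left_mono divide_right_mono) auto
  also have "\<dots> = (\<Sum>i\<in>I. 2 / e * a i - b i / e\<^sup>2)"
    by (simp only: sum_subtractf sum_distrib_left sum_divide_distrib)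
  also have "\<dots> \<le> (\<Sum>i\<in>I. a i * a i / b i)"
    by (intro sum_mono am)
  also have "\<dots> = (\<Sum>i\<in>I. \<Sum>x\<in>{p \<in> P. f p = i}. \<Sum>y\<in>P. if f y = i then w x * w y / b i else 0)"
  proof (rule sum.cong[OF refl])
    fix i
    have "a i = (\<Sum>y\<in>P. if f y = i then w y else 0)"
      unfolding a_def using P by (simp add: sum.inter_filter)
    then have "a i * a i / b i = (\<Sum>x\<in>{p \<in> P. f p = i}. w x) * (\<Sum>y\<in>P. if f y = i then w y else 0) / b i"
      by (simp add: a_def)
    also have "\<dots> = (\<Sum>x\<in>{p \<in> P. f p = i}. \<Sum>y\<in>P. if f y = i then w x * w y / b i else 0)"
      unfolding sum_product sum_divide_distrib by (intro sum.cong refl) auto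
    finally show "a i * a i / b i = (\<Sum>x\<in>{p \<in> P. f p = i}. \<Sum>y\<in>P. if f y = i then w x * w y / b i else 0)" .
  qed
  also have "\<dots> = (\<Sum>i\<in>I. \<Sum>x\<in>{p \<in> P. f p = i}. \<Sum>y\<in>P. if f y = f x then w x * w y / b (f x) else 0)"
    by (intro sum.cong refl) auto
  also have "\<dots> = (\<Sum>x\<in>P. \<Sum>y\<in>P. if f y = f x then w x * w y / b (f x) else 0)"
    using P I(1) f(1) by (intro sum.group) auto
  also have "\<dots> \<le> (\<Sum>x\<in>P. \<Sum>y\<in>P. \<Sum>j\<le>n. w x * w y / ((1/2) ^ j) powr \<sigma> * indicator (angles ((1/2) ^ j) (x - y)) \<theta>)"
  proof (intro sum_mono)
    fix x y assume x: "x \<in> P" and y: "y \<in> P"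
    let ?t = "\<lambda>j. w x * w y / ((1/2) ^ j) powr \<sigma> * indicator (angles ((1/2) ^ j) (x - y)) \<theta>"
    have t0: "0 \<le> ?t j" for j using w(1) by (intro mult_nonneg_nonneg divide_nonneg_nonneg) auto
    show "(if f y = f x then w x * w y / b (f x) else 0) \<le> (\<Sum>j\<le>n. ?t j)"
    proof (cases "f y = f x")
      case True
      have "norm (perp (\<gamma> \<theta>) (x - y)) \<le> (1/2) ^ k (f x)"
        using f(2)[OF x] f(2)[OF y] True dist_triangle_half_l[of "perp (\<gamma> \<theta>) x" "z (f x)" "(1/2) ^ k (f x)" "perp (\<gamma> \<theta>) y"]
        by (simp add: perp_diff dist_norm norm_minus_commute)
      then have "\<theta> \<in> angles ((1/2) ^ k (f x)) (x - y)" using \<theta> by (simp add: angles_def)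
      then have "w x * w y / b (f x) = ?t (k (f x))" by (simp add: b_def)
      also have "\<dots> \<le> (\<Sum>j\<le>n. ?t j)"
        using t0 I(2)[OF f(1)[OF x]] by (intro member_le_sum) auto
      finally show ?thesis using True by simp
    next
      case False
      then show ?thesis using t0 by (simp add: sum_nonneg)
    qed
  qed
  also have "\<dots> = (\<Sum>x\<in>P. \<Sum>j\<le>n. \<Sum>y\<in>P. w x * w y / ((1/2) ^ j) powr \<sigma> * indicator (angles ((1/2) ^ j) (x - y)) \<theta>)"
    by (rule sum.cong[OF refl], rule sum.swap)
  also have "\<dots> = scale_energy \<sigma> n P w \<theta>"
    unfolding scale_energy_def by (rule sum.swap)
  also have "2 / e * 1 - e / e\<^sup>2 = 1 / e" using e by (simp add: power2_eq_square)
  finally show ?thesis .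
qed

text \<open>Only half of the exponent gained in \<open>pair_estimate\<close> is spent on the
  divisor, so level \<open>k\<close> contributes at most a constant times \<open>q ^ k\<close>.
  Uniformity of \<open>M\<close> in \<open>n\<close>, \<open>P\<close> and \<open>w\<close> is what
  Markov's inequality will need.\<close>

lemma integral_scale_energy_le:
  assumes t: "1 < t" "t \<le> 2" and A: "1 \<le> A" and R: "1 \<le> R"
  shows "\<exists>M. \<forall>n P w. finite P \<longrightarrow> P \<subseteq> cball 0 R \<longrightarrow> (\<forall>p. 0 \<le> w p) \<longrightarrow>
    (\<forall>x r. (1/2) ^ n \<le> r \<longrightarrow> sum w {p \<in> P. dist x p \<le> r} \<le> A * r powr t) \<longrightarrow>
    integral\<^sup>L lebesgue (scale_energy (1 + (t - 1)\<^sup>2 / 480) n P w) \<le> M"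
proof (intro exI allI impI)
  fix n P and w :: "real ^ 3 \<Rightarrow> real"
  assume P: "finite P" "P \<subseteq> cball 0 R" and w: "\<forall>p. 0 \<le> w p"
    and fr: "\<forall>x r. (1/2) ^ n \<le> r \<longrightarrow> sum w {p \<in> P. dist x p \<le> r} \<le> A * r powr t"
  let ?C = "arc_weights.pair_const c C A R t"
  define \<epsilon> where "\<epsilon> = (t - 1)\<^sup>2 / 480"
  define q where "q = (1/2 :: real) powr \<epsilon>"
  have \<epsilon>: "0 < \<epsilon>" using t by (simp add: \<epsilon>_def)
  have q: "0 < q" "q < 1"
    using \<epsilon> powr_less_mono2[of \<epsilon> "1/2" 1] by (auto simp: q_def)
  have C: "(\<Sum>x\<in>P. \<Sum>y\<in>P. w x * w y * measure lebesgue (angles ((1/2) ^ k) (x - y)))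
      \<le> ?C * (1/2) ^ k * ((1/2) ^ k) powr ((t - 1)\<^sup>2 / 240)" if "k \<le> n" for k
  proof -
    have "(1/2::real) ^ n \<le> (1/2) ^ k" using that by (intro power_decreasing) auto
    then have "sum w {p \<in> P. dist x p \<le> r} \<le> A * r powr t" if "(1/2) ^ k \<le> r" for x r
      using fr order_trans[OF _ that] by blast
    then interpret arc_weights \<gamma> \<nu> l u c C A R t "(1/2) ^ k" P w
      using t A R P w by unfold_locales (auto simp: power_le_one)
    show ?thesis by (rule pair_estimate)
  qed
  \<comment> \<open>The estimate at level 0 bounds a nonnegative sum by the constant, which gives
    its sign without unfolding it.\<close>
  have C0: "0 \<le> ?C"
  proof -
    have "0 \<le> (\<Sum>x\<in>P. \<Sum>y\<in>P. w x * w y * measure lebesgue (angles ((1/2) ^ 0) (x - y)))"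
      using w by (intro sum_nonneg mult_nonneg_nonneg) auto
    then show ?thesis using C[of 0] by simp
  qed
  have "integral\<^sup>L lebesgue (scale_energy (1 + \<epsilon>) n P w) \<le> (\<Sum>k\<le>n. ?C * q ^ k)"
    unfolding integral_scale_energy
  proof (rule sum_mono)
    fix k assume k: "k \<in> {..n}"
    let ?d = "(1/2 :: real) ^ k"
    have "(\<Sum>x\<in>P. \<Sum>y\<in>P. w x * w y * measure lebesgue (angles ?d (x - y))) / ?d powr (1 + \<epsilon>)
        \<le> ?C * ?d * ?d powr ((t - 1)\<^sup>2 / 240) / ?d powr (1 + \<epsilon>)"
      using C k by (intro divide_right_mono) auto
    also have "(t - 1)\<^sup>2 / 240 = \<epsilon> + \<epsilon>" by (simp add: \<epsilon>_def)
    also have "?C * ?d * ?d powr (\<epsilon> + \<epsilon>) / ?d powr (1 + \<epsilon>) = ?C * ?d powr \<epsilon>"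
    proof -
      have "?C * a * (b * b) / (a * b) = ?C * b" if "a \<noteq> 0" "b \<noteq> 0" for a b using that by simp
      then show ?thesis unfolding powr_add by simp
    qed
    also have "?d powr \<epsilon> = q ^ k"
      by (simp add: q_def powr_powr powr_realpow[symmetric] mult.commute)
    finally show "(\<Sum>x\<in>P. \<Sum>y\<in>P. w x * w y * measure lebesgue (angles ?d (x - y))) / ?d powr (1 + \<epsilon>) \<le> ?C * q ^ k" .
  qed
  also have "\<dots> = ?C * (\<Sum>k\<le>n. q ^ k)" by (simp add: sum_distrib_left)
  also have "\<dots> \<le> ?C * (1 / (1 - q))"
  proof (rule mult_left_mono[OF _ C0])
    have "(\<Sum>k\<le>n. q ^ k) \<le> (\<Sum>k. q ^ k)"
      using q by (intro sum_le_suminf summable_geometric) auto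
    then show "(\<Sum>k\<le>n. q ^ k) \<le> 1 / (1 - q)" using q by (simp add: suminf_geometric)
  qed
  finally show "integral\<^sup>L lebesgue (scale_energy (1 + (t - 1)\<^sup>2 / 480) n P w)
      \<le> arc_weights.pair_const c C A R t * (1 / (1 - (1/2 :: real) powr ((t - 1)\<^sup>2 / 480)))"
    by (simp add: \<epsilon>_def q_def)
qed

text \<open>For each \<open>e\<close>, a bad \<open>\<theta>\<close> has a finite cover of total
  gauge at most \<open>32 * e\<close> with some finest level \<open>m\<close>, so the energy is at
  least \<open>1 / (32 * e)\<close> for all \<open>n \<ge> m\<close>. By Markov's inequality such
  angles have measure O(\<open>e\<close>). The bad set is not shown measurable directly; it is
  enclosed in the null set \<open>Z\<close>.\<close>

lemma negligible_small_projections: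
  assumes t: "1 < t" "t \<le> 2" and A: "1 \<le> A" and K: "compact K"
    and frost: "\<And>n. \<exists>P w. finite P \<and> P \<subseteq> K \<and> (\<forall>p. 0 \<le> w p) \<and> 1 \<le> sum w P \<and>
      (\<forall>x r. (1/2) ^ n \<le> r \<longrightarrow> sum w {p \<in> P. dist x p \<le> r} \<le> A * r powr t)"
  shows "negligible {\<theta> \<in> {l..u}. hausdorff_dim (perp (\<gamma> \<theta>) ` K) < ennreal (1 + (t - 1)\<^sup>2 / 480)}"
proof -
  define \<sigma> where "\<sigma> = 1 + (t - 1)\<^sup>2 / 480"
  have "(t - 1)\<^sup>2 \<le> 1" using t by (simp add: power_le_one)
  then have \<sigma>: "0 < \<sigma>" "\<sigma> \<le> 2" by (auto simp: \<sigma>_def add_pos_nonneg)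
  define Bad where "Bad = {\<theta> \<in> {l..u}. hausdorff_dim (perp (\<gamma> \<theta>) ` K) < ennreal \<sigma>}"
  obtain P w where P: "\<And>n. finite (P n)" "\<And>n. P n \<subseteq> K" and w: "\<And>n p. 0 \<le> w n p" "\<And>n. 1 \<le> sum (w n) (P n)"
    and fr: "\<And>n x r. (1/2) ^ n \<le> r \<Longrightarrow> sum (w n) {p \<in> P n. dist x p \<le> r} \<le> A * r powr t"
  proof -
    let ?Q = "\<lambda>n P w. finite P \<and> P \<subseteq> K \<and> (\<forall>p. 0 \<le> w p) \<and> 1 \<le> sum w P \<and>
      (\<forall>x r. (1/2) ^ n \<le> r \<longrightarrow> sum w {p \<in> P. dist x p \<le> r} \<le> A * r powr t)"
    have "\<forall>n. \<exists>P w. ?Q n P w" using frost by (rule allI)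
    then obtain P where "\<forall>n. \<exists>w. ?Q n (P n) w" by (rule choice[THEN exE])
    then obtain w where "\<forall>n. ?Q n (P n) (w n)" by (rule choice[THEN exE])
    then show ?thesis by (intro that[of P w]) blast+
  qed
  obtain R where R: "1 \<le> R" "K \<subseteq> cball 0 R"
  proof -
    obtain a where "\<And>x. x \<in> K \<Longrightarrow> norm x \<le> a" using compact_imp_bounded[OF K] bounded_iff by blast
    then show ?thesis by (intro that[of "max 1 a"]) (auto simp: le_max_iff_disj)
  qed
  define H where "H n = scale_energy \<sigma> n (P n) (w n)" for n
  obtain M where M': "\<And>n P w. finite P \<Longrightarrow> P \<subseteq> cball 0 R \<Longrightarrow> \<forall>p. 0 \<le> w p \<Longrightarrow>
      \<forall>x r. (1/2) ^ n \<le> r \<longrightarrow> sum w {p \<in> P. dist x p \<le> r} \<le> A * r powr t \<Longrightarrow>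
      integral\<^sup>L lebesgue (scale_energy \<sigma> n P w) \<le> M"
    using integral_scale_energy_le[OF t A R(1)] unfolding \<sigma>_def by blast
  have M: "integral\<^sup>L lebesgue (H n) \<le> M" for n
    unfolding H_def using P(1) order_trans[OF P(2) R(2)] w(1) fr by (intro M') auto
  define N where "N e n = {\<theta>. 1 / e \<le> H n \<theta>}" for e :: real and n
  have Hi: "integrable lebesgue (H n)" for n unfolding H_def by (rule integrable_scale_energy)
  have Nm: "N e n \<in> sets lebesgue" for e n
  proof -
    have "H n \<in> borel_measurable lebesgue" using Hi by (rule borel_measurable_integrable)
    then have "{\<theta> \<in> space lebesgue. 1 / e \<le> H n \<theta>} \<in> sets lebesgue" by measurable
    then show ?thesis by (simp add: N_def)
  qed
  have Ne: "emeasure lebesgue (N e n) \<le> ennreal (e * M)" if e: "0 < e" for e n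
  proof -
    have "emeasure lebesgue {\<theta> \<in> space lebesgue. 1 / e \<le> H n \<theta>} \<le> ennreal (1 / (1 / e) * integral\<^sup>L lebesgue (H n))"
      using Hi e w(1) by (intro integral_Markov_inequality) (auto simp: H_def scale_energy_nonneg)
    also have "\<dots> \<le> ennreal (e * M)" using M[of n] e by (intro ennreal_leI) (simp add: mult_left_mono)
    finally show ?thesis by (simp add: N_def)
  qed
  text \<open>An increasing union in \<open>m\<close>, so the bound on \<open>N e n\<close>, uniform in \<open>n\<close>, passes to \<open>L e\<close>.\<close>
  define L where "L e = (\<Union>m. \<Inter>n\<in>{m..}. N e n)" for e
  have Lm: "L e \<in> sets lebesgue" for e
    unfolding L_def using Nm by (intro sets.countable_UN sets.countable_INT'') auto
  have Le: "emeasure lebesgue (L e) \<le> ennreal (e * M)" if e: "0 < e" for e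
  proof -
    have "emeasure lebesgue (L e) = (SUP m. emeasure lebesgue (\<Inter>n\<in>{m..}. N e n))"
      unfolding L_def
    proof (rule SUP_emeasure_incseq[symmetric])
      show "range (\<lambda>m. \<Inter>n\<in>{m..}. N e n) \<subseteq> sets lebesgue"
        using Nm by (auto intro!: sets.countable_INT'')
      show "incseq (\<lambda>m. \<Inter>n\<in>{m..}. N e n)"
        by (rule monoI) auto
    qed
    also have "\<dots> \<le> ennreal (e * M)"
    proof (rule SUP_least)
      fix m
      have "emeasure lebesgue (\<Inter>n\<in>{m..}. N e n) \<le> emeasure lebesgue (N e m)"
        using Nm by (intro emeasure_mono) auto
      then show "emeasure lebesgue (\<Inter>n\<in>{m..}. N e n) \<le> ennreal (e * M)" using Ne[OF e] order_trans by blast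
    qed
    finally show ?thesis .
  qed
  have BL: "Bad \<subseteq> L (32 * e)" if e: "0 < e" "e \<le> 1" for e
  proof
    fix \<theta> assume \<theta>: "\<theta> \<in> Bad"
    have "continuous_on UNIV (perp (\<gamma> \<theta>))"
      unfolding perp_def by (intro continuous_intros)
    then obtain I z k where I: "finite (I :: nat set)" "\<And>p. p \<in> K \<Longrightarrow> \<exists>i\<in>I. dist (perp (\<gamma> \<theta>) p) (z i) < (1/2) ^ k i / 2"
      "(\<Sum>i\<in>I. ((1/2) ^ k i) powr \<sigma>) \<le> 32 * e"
      using hausdorff_dim_less_imp_finite_cover[OF _ K _ \<sigma> e, of "perp (\<gamma> \<theta>)"] \<theta> unfolding Bad_def by blast
    obtain m where m: "\<And>i. i \<in> I \<Longrightarrow> k i \<le> m"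
      using I(1) finite_nat_set_iff_bounded_le[of "k ` I"] by auto
    have "\<theta> \<in> N (32 * e) n" if "m \<le> n" for n
      unfolding N_def H_def mem_Collect_eq
    proof (rule scale_energy_lower_bound[where I=I and k=k and z=z])
      show "k i \<le> n" if "i \<in> I" for i using m[OF that] \<open>m \<le> n\<close> by linarith
      show "\<exists>i\<in>I. dist (perp (\<gamma> \<theta>) p) (z i) < (1/2) ^ k i / 2" if "p \<in> P n" for p
        using I(2) P(2) that by blast
    qed (use \<theta> P w I e in \<open>auto simp: Bad_def\<close>)
    then show "\<theta> \<in> L (32 * e)" unfolding L_def by auto
  qed
  define Z where "Z = (\<Inter>j::nat. L (32 * (1 / real (Suc j))))"
  have "Bad \<subseteq> L (32 * (1 / real (Suc j)))" for j by (rule BL) auto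
  then have "Bad \<subseteq> Z" unfolding Z_def by (rule INT_greatest)
  moreover have "Z \<in> null_sets lebesgue"
  proof
    show "Z \<in> sets lebesgue" unfolding Z_def using Lm by (intro sets.countable_INT) auto
    have le: "emeasure lebesgue Z \<le> ennreal (32 * (1 / real (Suc j)) * M)" for j
    proof -
      have "emeasure lebesgue Z \<le> emeasure lebesgue (L (32 * (1 / real (Suc j))))"
        unfolding Z_def using Lm by (intro emeasure_mono) auto
      also have "\<dots> \<le> ennreal (32 * (1 / real (Suc j)) * M)" by (rule Le) simp
      finally show ?thesis .
    qed
    have "(\<lambda>j. ennreal (32 * (1 / real (Suc j)) * M)) \<longlonglongrightarrow> ennreal 0"
    proof (rule tendsto_ennrealI)
      have "(\<lambda>j. 32 * M * inverse (real (Suc j))) \<longlonglongrightarrow> 32 * M * 0"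
        by (intro tendsto_intros LIMSEQ_inverse_real_of_nat)
      then show "(\<lambda>j. 32 * (1 / real (Suc j)) * M) \<longlonglongrightarrow> 0" by (simp add: divide_inverse mult_ac)
    qed
    then have "emeasure lebesgue Z \<le> ennreal 0"
      by (rule tendsto_lowerbound) (use le in auto)
    then show "emeasure lebesgue Z = 0" by simp
  qed
  ultimately have "negligible Bad"
    using negligible_iff_null_sets negligible_subset by blast
  then show ?thesis by (simp add: Bad_def \<sigma>_def)
qed

end

theorem theorem1p8:
  fixes s :: real
  assumes "s > 1"
  shows "\<exists>\<sigma>::real. \<sigma> > 1 \<and>
    (\<forall>(J :: real set) (\<gamma> :: real \<Rightarrow> real ^ 3) (B :: (real ^ 3) set).
       open J \<and> is_interval J \<and>
       Ck_curve_on 3 J \<gamma> \<and> \<gamma> ` J \<subseteq> sphere 0 1 \<and>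
       (\<forall>\<theta>\<in>J. span {\<gamma> \<theta>, nth_vector_derivative 1 \<gamma> \<theta>, nth_vector_derivative 2 \<gamma> \<theta>} = UNIV) \<and>
       analytic_set B \<and> hausdorff_dim B = ennreal s
       \<longrightarrow> (AE \<theta> in lebesgue_on J.
              hausdorff_dim (orth_proj ((span {\<gamma> \<theta>})\<^sup>\<bottom>) ` B) \<ge> ennreal \<sigma>))"
proof -
  \<comment> \<open>Strictly between 1 and \<open>s\<close>, and capped at 2 for the numerical
    bounds; it depends on \<open>s\<close> only, hence so does \<open>\<sigma>\<close>.\<close>
  define t where "t = min 2 ((1 + s) / 2)"
  have t: "1 < t" "t \<le> 2" "t < s" using assms by (auto simp: t_def min_def)
  define \<sigma> where "\<sigma> = 1 + (t - 1)\<^sup>2 / 480"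
  have "1 < \<sigma>" using t by (simp add: \<sigma>_def)
  moreover have "AE \<theta> in lebesgue_on J. hausdorff_dim (orth_proj ((span {\<gamma> \<theta>})\<^sup>\<bottom>) ` B) \<ge> ennreal \<sigma>"
    if J: "open J" and curve: "Ck_curve_on 3 J \<gamma>" and sphere: "\<gamma> ` J \<subseteq> sphere 0 1"
      and span: "\<forall>\<theta>\<in>J. span {\<gamma> \<theta>, nth_vector_derivative 1 \<gamma> \<theta>, nth_vector_derivative 2 \<gamma> \<theta>} = UNIV"
      and B: "analytic_set B" "hausdorff_dim B = ennreal s"
    for J and \<gamma> :: "real \<Rightarrow> real ^ 3" and B
  proof -
    have lt: "ennreal t < hausdorff_dim B" using B(2) t by (simp add: ennreal_less_iff)
    have t0: "0 < t" using t by simp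
    obtain K A where K: "compact K" "K \<subseteq> B" and A: "1 \<le> A"
      and frost: "\<And>n. \<exists>P w. finite P \<and> P \<subseteq> K \<and> (\<forall>p. 0 \<le> w p) \<and> 1 \<le> (\<Sum>p\<in>P. w p) \<and>
        (\<forall>x r. (1/2) ^ n \<le> r \<longrightarrow> (\<Sum>p\<in>{p\<in>P. dist x p \<le> r}. w p) \<le> A * r powr t)"
      by (rule analytic_frostman[OF B(1) t0 lt]) (rule that)
    define Bad where "Bad = {\<theta> \<in> J. hausdorff_dim (perp (\<gamma> \<theta>) ` K) < ennreal \<sigma>}"
    \<comment> \<open>Arcs exist only around individual points of \<open>J\<close>, with no uniform
      length; Lindelof selects countably many sets of this family that still cover
      \<open>J\<close>.\<close>
    define \<F> where "\<F> = {S. open S \<and> negligible (Bad \<inter> S)}"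
    have deriv: "(nth_vector_derivative i \<gamma> has_vector_derivative nth_vector_derivative (Suc i) \<gamma> x) (at x)"
      if "i < 3" "x \<in> J" for i x
      using curve that unfolding Ck_curve_on_def by (simp add: vector_derivative_works[symmetric])
    have "J \<subseteq> \<Union>\<F>"
    proof
      fix z assume z: "z \<in> J"
      obtain \<nu> l u c C where arc: "l < z" "z < u" "{l..u} \<subseteq> J" "curve_arc (nth_vector_derivative 0 \<gamma>) \<nu> l u c C"
      proof (rule curve_arc_exists[OF J z, of "\<lambda>i. nth_vector_derivative i \<gamma>"])
        show "continuous_on J (nth_vector_derivative 3 \<gamma>)" using curve by (simp add: Ck_curve_on_def)
        show "norm (nth_vector_derivative 0 \<gamma> x) = 1" if "x \<in> J" for x using sphere that by auto
        show "span {nth_vector_derivative 0 \<gamma> z, nth_vector_derivative 1 \<gamma> z, nth_vector_derivative 2 \<gamma> z} = UNIV"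
          using span z by simp
      qed (use deriv in auto)
      interpret curve_arc \<gamma> \<nu> l u c C using arc(4) by simp
      have "negligible {\<theta> \<in> {l..u}. hausdorff_dim (perp (\<gamma> \<theta>) ` K) < ennreal \<sigma>}"
        unfolding \<sigma>_def by (rule negligible_small_projections[OF t(1,2) A K(1) frost])
      then have "negligible (Bad \<inter> {l<..<u})"
        by (rule negligible_subset) (auto simp: Bad_def)
      then have "{l<..<u} \<in> \<F>" by (simp add: \<F>_def)
      then show "z \<in> \<Union>\<F>" using arc(1,2) by (intro UnionI[of "{l<..<u}"]) auto
    qed
    obtain \<F>' where F': "\<F>' \<subseteq> \<F>" "countable \<F>'" "\<Union>\<F>' = \<Union>\<F>"
      by (rule Lindelof[of \<F>]) (auto simp: \<F>_def)
    have "negligible (\<Union>((\<lambda>S. Bad \<inter> S) ` \<F>'))"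
      using F' by (intro negligible_countable_Union) (auto simp: \<F>_def)
    moreover have "Bad \<subseteq> \<Union>((\<lambda>S. Bad \<inter> S) ` \<F>')"
      using \<open>J \<subseteq> \<Union>\<F>\<close> F'(3) by (auto simp: Bad_def)
    ultimately have "negligible Bad" by (rule negligible_subset)
    then have "Bad \<in> null_sets lebesgue" by (simp add: negligible_iff_null_sets)
    have good: "hausdorff_dim (orth_proj ((span {\<gamma> \<theta>})\<^sup>\<bottom>) ` B) \<ge> ennreal \<sigma>" if "\<theta> \<in> J" "\<theta> \<notin> Bad" for \<theta>
    proof -
      have "norm (\<gamma> \<theta>) = 1" using sphere that(1) by auto
      then have "orth_proj ((span {\<gamma> \<theta>})\<^sup>\<bottom>) ` B = perp (\<gamma> \<theta>) ` B"
        by (simp add: orth_proj_orthogonal_comp_span)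
      moreover have "ennreal \<sigma> \<le> hausdorff_dim (perp (\<gamma> \<theta>) ` K)" using that by (auto simp: Bad_def)
      moreover have "hausdorff_dim (perp (\<gamma> \<theta>) ` K) \<le> hausdorff_dim (perp (\<gamma> \<theta>) ` B)"
        using K(2) by (intro hausdorff_dim_mono image_mono)
      ultimately show ?thesis by simp
    qed
    have "AE \<theta> in lebesgue. \<theta> \<in> J \<longrightarrow> hausdorff_dim (orth_proj ((span {\<gamma> \<theta>})\<^sup>\<bottom>) ` B) \<ge> ennreal \<sigma>"
      by (rule AE_I'[OF \<open>Bad \<in> null_sets lebesgue\<close>]) (use good in auto)
    then show ?thesis
      using J by (subst AE_restrict_space_iff) auto
  qed
  ultimately show ?thesis by blast
qed

end
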